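(* The category $\mathbf{Ope}_\Sigma$ of symmetric operads, with the Boardman-Vogt tensor product $\otimes_{BV}$ and the Quillen model structure whose weak equivalences are the operadic equivalences, whose cofibrations are the functors injective on objects, and whose fibrations are the functors with the isomorphism lifting property, is a monoidal model category.
   Context: Symmetric operads. A symmetric operad $\mathcal{P}$ (coloured, in sets) consists of a set $\mathrm{ob}(\mathcal{P})$ of objects; for all $n\ge 0$ and objects $p_0,\ldots,p_n$ a set $\mathcal{P}(p_1,\ldots,p_n;p_0)$ of morphisms; identities $\mathrm{id}_p\in\mathcal{P}(p;p)$; an associative unital composition $\psi\circ(\psi_1,\ldots,\psi_n)$ (inputs concatenated); and, for $\sigma\in\Sigma_n$, functions $\sigma^*:\mathcal{P}(p_1,\ldots,p_n;p_0)\to\mathcal{P}(p_{\sigma(1)},\ldots,p_{\sigma(n)};p_0)$ forming an action of the symmetric groups and compatible with composition (the usual equivariance axioms). A functor of symmetric operads is a function on objects together with functions on morphism sets respecting composition, identities and symmetric group actions. $\mathbf{Ope}_\Sigma$ is the resulting category. $j^*(\mathcal{P})$ denotes the category of objects and unary morphisms of $\mathcal{P}$; an isomorphism in $\mathcal{P}$ is a unary morphism invertible in $j^*(\mathcal{P})$. Model structure on $\mathbf{Ope}_\Sigma$. $F:\mathcal{P}\to\mathcal{Q}$ is a weak equivalence (operadic equivalence) if $j^*(F)$ is essentially surjective and all functions $F:\mathcal{P}(p_1,\ldots,p_n;p_0)\to\mathcal{Q}(Fp_1,\ldots,Fp_n;Fp_0)$, $n\ge0$, are bijections; a cofibration if it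 is injective on objects; a fibration if for every $p\in\mathrm{ob}(\mathcal{P})$ and every isomorphism $\psi:Fp\to q$ in $\mathcal{Q}$ there is an isomorphism $\phi:p\to p'$ in $\mathcal{P}$ with $F\phi=\psi$ (the isomorphism lifting property). These classes form a Quillen model structure (in which every object is cofibrant). A trivial cofibration is a cofibration that is a weak equivalence. Boardman-Vogt tensor product. $\mathcal{P}\otimes_{BV}\mathcal{Q}$ is the symmetric operad with object set $\mathrm{ob}(\mathcal{P})\times\mathrm{ob}(\mathcal{Q})$ presented by the following generators: for each $q\in\mathrm{ob}(\mathcal{Q})$ and $\psi\in\mathcal{P}(p_1,\ldots,p_n;p)$, a morphism $\psi\otimes q:(p_1,q),\ldots,(p_n,q)\to(p,q)$; for each $p\in\mathrm{ob}(\mathcal{P})$ and $\varphi\in\mathcal{Q}(q_1,\ldots,q_m;q)$, a morphism $p\otimes\varphi:(p,q_1),\ldots,(p,q_m)\to(p,q)$. The relations are: (1)–(2) for each $q\in\mathrm{ob}(\mathcal{Q})$, $p\mapsto(p,q)$, $\psi\mapsto\psi\otimes q$ is a functor of symmetric operads $\mathcal{P}\to\mathcal{P}\otimes_{BV}\mathcal{Q}$, i.e. it respects composition, identities and the maps $\sigma^*$; (3)–(4) for each $p\in\mathrm{ob}(\mathcal{P})$, $q\mapsto(p,q)$, $\varphi\mapsto p\otimes\varphi$ is likewise a functor of symmetric operads $\mathcal{Q}\to\mathcal{P}\otimes_{BV}\mathcal{Q}$; (5) (interchange) for $\psi\in\mathcal{P}(p_1,\ldots,p_n;p)$ and $\varphi\in\mathcal{Q}(q_1,\ldots,q_m;q)$,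 $$(\psi\otimes q)\circ(p_1\otimes\varphi,\ldots,p_n\otimes\varphi)=\sigma_{m,n}^*\bigl((p\otimes\varphi)\circ(\psi\otimes q_1,\ldots,\psi\otimes q_m)\bigr),$$ where $\sigma_{m,n}\in\Sigma_{mn}$ is the evident permutation making the input lists agree: $\sigma_{m,n}((i-1)m+j)=(j-1)n+i$ for $1\le i\le n$, $1\le j\le m$. With this tensor product $\mathbf{Ope}_\Sigma$ is a closed (symmetric) monoidal category, the unit being the operad with one object and only its identity morphism. Monoidal model category. Since every object is cofibrant, this means that the pushout-product axiom holds: for all cofibrations $F:\mathcal{P}\to\mathcal{Q}$ and $G:\mathcal{P}'\to\mathcal{Q}'$, the map $$F\wedge G:(\mathcal{Q}\otimes_{BV}\mathcal{P}')\coprod_{\mathcal{P}\otimes_{BV}\mathcal{P}'}(\mathcal{P}\otimes_{BV}\mathcal{Q}')\to\mathcal{Q}\otimes_{BV}\mathcal{Q}'$$ induced by $\mathcal{Q}\otimes_{BV}G$ and $F\otimes_{BV}\mathcal{Q}'$ is a cofibration, and it is a trivial cofibration if $F$ or $G$ is a trivial cofibration. *)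

theory Defs
  imports "HOL-Combinatorics.Permutations"
begin

section \<open>Permutations of concatenated lists\<close>

text \<open>
  A permutation \<open>\<sigma> \<in> \<Sigma>\<^sub>n\<close> is a function with \<open>\<sigma> permutes {..<n}\<close> (positions count from 0), and
  \<open>permute_list \<sigma> [p\<^sub>0, \<dots>, p\<^bsub>n-1\<^esub>] = [p\<^bsub>\<sigma> 0\<^esub>, \<dots>, p\<^bsub>\<sigma> (n-1)\<^esub>]\<close>.  A list \<open>L\<close> of positions in which each
  of \<open>0, \<dots>, length L - 1\<close> occurs once is turned into the permutation \<open>k \<mapsto> L ! k\<close>.
\<close>

definition index_perm :: "nat list \<Rightarrow> nat \<Rightarrow> nat" where
  "index_perm L k = (if k < length L then L ! k else k)"

text \<open>The positions \<open>0, 1, 2, \<dots>\<close> cut into consecutive blocks of the lengths \<open>ks\<close>.\<close>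

definition blocks :: "nat list \<Rightarrow> nat list list" where
  "blocks ks = map (\<lambda>i. [sum_list (take i ks)..<sum_list (take (Suc i) ks)]) [0..<length ks]"

definition sum_perm :: "(nat \<Rightarrow> nat) list \<Rightarrow> nat list \<Rightarrow> nat \<Rightarrow> nat" where
  "sum_perm \<sigma>s ks = index_perm (concat (map2 permute_list \<sigma>s (blocks ks)))"

definition block_perm :: "(nat \<Rightarrow> nat) \<Rightarrow> nat list \<Rightarrow> nat \<Rightarrow> nat" where
  "block_perm \<sigma> ks = index_perm (concat (permute_list \<sigma> (blocks ks)))"

text \<open>The zero-based form of \<open>\<sigma>\<^bsub>m,n\<^esub>\<close>, i.e. \<open>i * m + j \<mapsto> j * n + i\<close> for \<open>i < n\<close> and \<open>j < m\<close>.\<close>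

definition interchange_perm :: "nat \<Rightarrow> nat \<Rightarrow> nat \<Rightarrow> nat" where
  "interchange_perm m n k = (if k < m * n then (k mod m) * n + k div m else k)"


section \<open>Symmetric operads and their functors\<close>

text \<open>
  The morphism sets of an operad are given by one set of morphisms, each of which carries its list of
  inputs and its output; \<open>hom P ps p\<close> recovers \<open>P(ps; p)\<close>.  The operations are only constrained where
  they are meaningful (composable morphisms, permutations of the right arity).
\<close>

record ('o, 'm) operad =
  ob :: "'o set"
  mor :: "'m set"
  src :: "'m \<Rightarrow> 'o list"
  tgt :: "'m \<Rightarrow> 'o"
  oid :: "'o \<Rightarrow> 'm"
  ocomp :: "'m \<Rightarrow> 'm list \<Rightarrow> 'm"
  act :: "(nat \<Rightarrow> nat) \<Rightarrow> 'm \<Rightarrow> 'm"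

definition hom :: "('o, 'm) operad \<Rightarrow> 'o list \<Rightarrow> 'o \<Rightarrow> 'm set" where
  "hom P ps p = {f \<in> mor P. src P f = ps \<and> tgt P f = p}"

definition composable :: "('o, 'm) operad \<Rightarrow> 'm \<Rightarrow> 'm list \<Rightarrow> bool" where
  "composable P f gs \<longleftrightarrow> f \<in> mor P \<and> set gs \<subseteq> mor P \<and> map (tgt P) gs = src P f"

abbreviation input_lengths :: "('o, 'm) operad \<Rightarrow> 'm list \<Rightarrow> nat list" where
  "input_lengths P gs \<equiv> map (\<lambda>g. length (src P g)) gs"

locale symmetric_operad =
  fixes P :: "('o, 'm) operad"
  assumes src_ob: "f \<in> mor P \<Longrightarrow> set (src P f) \<subseteq> ob P"
    and tgt_ob: "f \<in> mor P \<Longrightarrow> tgt P f \<in> ob P"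
    and id_hom: "p \<in> ob P \<Longrightarrow> oid P p \<in> hom P [p] p"
    and comp_hom: "composable P f gs \<Longrightarrow> ocomp P f gs \<in> hom P (concat (map (src P) gs)) (tgt P f)"
    and unit_left: "f \<in> mor P \<Longrightarrow> ocomp P (oid P (tgt P f)) [f] = f"
    and unit_right: "f \<in> mor P \<Longrightarrow> ocomp P f (map (oid P) (src P f)) = f"
    and assoc: "\<lbrakk>composable P f gs; list_all2 (composable P) gs hss\<rbrakk>
      \<Longrightarrow> ocomp P (ocomp P f gs) (concat hss) = ocomp P f (map2 (ocomp P) gs hss)"
    and act_hom: "\<lbrakk>f \<in> mor P; \<sigma> permutes {..<length (src P f)}\<rbrakk>
      \<Longrightarrow> act P \<sigma> f \<in> hom P (permute_list \<sigma> (src P f)) (tgt P f)"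
    and act_id: "f \<in> mor P \<Longrightarrow> act P id f = f"
    and act_comp: "\<lbrakk>f \<in> mor P; \<sigma> permutes {..<length (src P f)}; \<tau> permutes {..<length (src P f)}\<rbrakk>
      \<Longrightarrow> act P (\<sigma> \<circ> \<tau>) f = act P \<tau> (act P \<sigma> f)"
    and equivariance_inner: "\<lbrakk>composable P f gs;
        list_all2 (\<lambda>\<sigma> g. \<sigma> permutes {..<length (src P g)}) \<sigma>s gs\<rbrakk>
      \<Longrightarrow> ocomp P f (map2 (act P) \<sigma>s gs) = act P (sum_perm \<sigma>s (input_lengths P gs)) (ocomp P f gs)"
    and equivariance_outer: "\<lbrakk>composable P f gs; \<sigma> permutes {..<length gs}\<rbrakk>
      \<Longrightarrow> ocomp P (act P \<sigma> f) (permute_list \<sigma> gs)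
        = act P (block_perm \<sigma> (input_lengths P gs)) (ocomp P f gs)"

record ('o1, 'm1, 'o2, 'm2) ofunctor =
  on_ob :: "'o1 \<Rightarrow> 'o2"
  on_mor :: "'m1 \<Rightarrow> 'm2"

locale operad_functor =
  source: symmetric_operad P + target: symmetric_operad Q
  for P :: "('o1, 'm1) operad" and Q :: "('o2, 'm2) operad" +
  fixes F :: "('o1, 'm1, 'o2, 'm2) ofunctor"
  assumes map_ob: "p \<in> ob P \<Longrightarrow> on_ob F p \<in> ob Q"
    and map_hom: "f \<in> mor P
      \<Longrightarrow> on_mor F f \<in> hom Q (map (on_ob F) (src P f)) (on_ob F (tgt P f))"
    and map_id: "p \<in> ob P \<Longrightarrow> on_mor F (oid P p) = oid Q (on_ob F p)"
    and map_comp: "composable P f gs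
      \<Longrightarrow> on_mor F (ocomp P f gs) = ocomp Q (on_mor F f) (map (on_mor F) gs)"
    and map_act: "\<lbrakk>f \<in> mor P; \<sigma> permutes {..<length (src P f)}\<rbrakk>
      \<Longrightarrow> on_mor F (act P \<sigma> f) = act Q \<sigma> (on_mor F f)"

definition id_functor :: "('o, 'm, 'o, 'm) ofunctor" where
  "id_functor = \<lparr>on_ob = (\<lambda>p. p), on_mor = (\<lambda>f. f)\<rparr>"

definition comp_functor :: "('o2, 'm2, 'o3, 'm3) ofunctor \<Rightarrow> ('o1, 'm1, 'o2, 'm2) ofunctor
    \<Rightarrow> ('o1, 'm1, 'o3, 'm3) ofunctor" where
  "comp_functor G F = \<lparr>on_ob = on_ob G \<circ> on_ob F, on_mor = on_mor G \<circ> on_mor F\<rparr>"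

definition functor_eq_on :: "('o1, 'm1) operad \<Rightarrow> ('o1, 'm1, 'o2, 'm2) ofunctor
    \<Rightarrow> ('o1, 'm1, 'o2, 'm2) ofunctor \<Rightarrow> bool" where
  "functor_eq_on P F G \<longleftrightarrow>
     (\<forall>p\<in>ob P. on_ob F p = on_ob G p) \<and> (\<forall>f\<in>mor P. on_mor F f = on_mor G f)"


section \<open>The model structure\<close>

definition iso_in :: "('o, 'm) operad \<Rightarrow> 'm \<Rightarrow> 'o \<Rightarrow> 'o \<Rightarrow> bool" where
  "iso_in P f a b \<longleftrightarrow> f \<in> hom P [a] b \<and>
     (\<exists>g\<in>hom P [b] a. ocomp P g [f] = oid P a \<and> ocomp P f [g] = oid P b)"

definition operadic_equivalence :: "('o1, 'm1) operad \<Rightarrow> ('o2, 'm2) operad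
    \<Rightarrow> ('o1, 'm1, 'o2, 'm2) ofunctor \<Rightarrow> bool" where
  "operadic_equivalence P Q F \<longleftrightarrow> operad_functor P Q F \<and>
     (\<forall>q\<in>ob Q. \<exists>p\<in>ob P. \<exists>f. iso_in Q f (on_ob F p) q) \<and>
     (\<forall>ps p. set ps \<subseteq> ob P \<and> p \<in> ob P \<longrightarrow>
        bij_betw (on_mor F) (hom P ps p) (hom Q (map (on_ob F) ps) (on_ob F p)))"

definition cofibration :: "('o1, 'm1) operad \<Rightarrow> ('o2, 'm2) operad
    \<Rightarrow> ('o1, 'm1, 'o2, 'm2) ofunctor \<Rightarrow> bool" where
  "cofibration P Q F \<longleftrightarrow> operad_functor P Q F \<and> inj_on (on_ob F) (ob P)"

definition trivial_cofibration :: "('o1, 'm1) operad \<Rightarrow> ('o2, 'm2) operad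
    \<Rightarrow> ('o1, 'm1, 'o2, 'm2) ofunctor \<Rightarrow> bool" where
  "trivial_cofibration P Q F \<longleftrightarrow> cofibration P Q F \<and> operadic_equivalence P Q F"


section \<open>Operads presented by generators and relations\<close>

datatype ('o, 'g) oterm =
    Gen 'g
  | Id 'o
  | Comp "('o, 'g) oterm" "('o, 'g) oterm list"
  | Act "nat \<Rightarrow> nat" "('o, 'g) oterm"

record ('o, 'g) presentation =
  pob :: "'o set"
  pgen :: "'g set"
  gsrc :: "'g \<Rightarrow> 'o list"
  gtgt :: "'g \<Rightarrow> 'o"
  prel :: "(('o, 'g) oterm \<times> ('o, 'g) oterm) set"

primrec tsrc :: "('o, 'g) presentation \<Rightarrow> ('o, 'g) oterm \<Rightarrow> 'o list" where
  "tsrc X (Gen g) = gsrc X g"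
| "tsrc X (Id p) = [p]"
| "tsrc X (Comp t ts) = concat (map (tsrc X) ts)"
| "tsrc X (Act \<sigma> t) = permute_list \<sigma> (tsrc X t)"

primrec ttgt :: "('o, 'g) presentation \<Rightarrow> ('o, 'g) oterm \<Rightarrow> 'o" where
  "ttgt X (Gen g) = gtgt X g"
| "ttgt X (Id p) = p"
| "ttgt X (Comp t ts) = ttgt X t"
| "ttgt X (Act \<sigma> t) = ttgt X t"

fun wf_term :: "('o, 'g) presentation \<Rightarrow> ('o, 'g) oterm \<Rightarrow> bool" where
  "wf_term X (Gen g) \<longleftrightarrow> g \<in> pgen X"
| "wf_term X (Id p) \<longleftrightarrow> p \<in> pob X"
| "wf_term X (Comp t ts) \<longleftrightarrow>
     wf_term X t \<and> list_all (wf_term X) ts \<and> map (ttgt X) ts = tsrc X t"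
| "wf_term X (Act \<sigma> t) \<longleftrightarrow> wf_term X t \<and> \<sigma> permutes {..<length (tsrc X t)}"

text \<open>The least congruence on well-formed terms which contains the relations and the operad axioms.\<close>

inductive term_eq :: "('o, 'g) presentation \<Rightarrow> ('o, 'g) oterm \<Rightarrow> ('o, 'g) oterm \<Rightarrow> bool"
  for X where
  teq_rel: "(s, t) \<in> prel X \<Longrightarrow> term_eq X s t"
| teq_refl: "wf_term X t \<Longrightarrow> term_eq X t t"
| teq_sym: "term_eq X s t \<Longrightarrow> term_eq X t s"
| teq_trans: "\<lbrakk>term_eq X s t; term_eq X t u\<rbrakk> \<Longrightarrow> term_eq X s u"
| teq_comp_cong: "\<lbrakk>wf_term X (Comp t ts); term_eq X t t'; list_all2 (term_eq X) ts ts'\<rbrakk>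
    \<Longrightarrow> term_eq X (Comp t ts) (Comp t' ts')"
| teq_act_cong: "\<lbrakk>wf_term X (Act \<sigma> t); term_eq X t t'\<rbrakk> \<Longrightarrow> term_eq X (Act \<sigma> t) (Act \<sigma> t')"
| teq_unit_left: "wf_term X t \<Longrightarrow> term_eq X (Comp (Id (ttgt X t)) [t]) t"
| teq_unit_right: "wf_term X t \<Longrightarrow> term_eq X (Comp t (map Id (tsrc X t))) t"
| teq_assoc: "\<lbrakk>wf_term X (Comp t ts); list_all2 (\<lambda>s us. wf_term X (Comp s us)) ts uss\<rbrakk>
    \<Longrightarrow> term_eq X (Comp (Comp t ts) (concat uss)) (Comp t (map2 Comp ts uss))"
| teq_act_id: "wf_term X t \<Longrightarrow> term_eq X (Act id t) t"
| teq_act_comp: "\<lbrakk>wf_term X (Act \<sigma> t); wf_term X (Act \<tau> t)\<rbrakk>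
    \<Longrightarrow> term_eq X (Act (\<sigma> \<circ> \<tau>) t) (Act \<tau> (Act \<sigma> t))"
| teq_equivariance_inner: "\<lbrakk>wf_term X (Comp t ts); list_all2 (\<lambda>\<sigma> s. wf_term X (Act \<sigma> s)) \<sigma>s ts\<rbrakk>
    \<Longrightarrow> term_eq X (Comp t (map2 Act \<sigma>s ts))
          (Act (sum_perm \<sigma>s (map (\<lambda>s. length (tsrc X s)) ts)) (Comp t ts))"
| teq_equivariance_outer: "\<lbrakk>wf_term X (Comp t ts); wf_term X (Act \<sigma> t)\<rbrakk>
    \<Longrightarrow> term_eq X (Comp (Act \<sigma> t) (permute_list \<sigma> ts))
          (Act (block_perm \<sigma> (map (\<lambda>s. length (tsrc X s)) ts)) (Comp t ts))"

definition term_class :: "('o, 'g) presentation \<Rightarrow> ('o, 'g) oterm \<Rightarrow> ('o, 'g) oterm set" where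
  "term_class X t = {s. term_eq X t s}"

definition rep :: "'a set \<Rightarrow> 'a" where
  "rep C = (SOME x. x \<in> C)"

definition presented_operad :: "('o, 'g) presentation \<Rightarrow> ('o, ('o, 'g) oterm set) operad" where
  "presented_operad X = \<lparr>
     ob = pob X,
     mor = term_class X ` {t. wf_term X t},
     src = (\<lambda>C. tsrc X (rep C)),
     tgt = (\<lambda>C. ttgt X (rep C)),
     oid = (\<lambda>p. term_class X (Id p)),
     ocomp = (\<lambda>C Cs. term_class X (Comp (rep C) (map rep Cs))),
     act = (\<lambda>\<sigma> C. term_class X (Act \<sigma> (rep C)))\<rparr>"

primrec eval_term :: "('o2, 'm2) operad \<Rightarrow> ('o1 \<Rightarrow> 'o2) \<Rightarrow> ('g \<Rightarrow> 'm2) \<Rightarrow> ('o1, 'g) oterm \<Rightarrow> 'm2" where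
  "eval_term D f \<gamma> (Gen g) = \<gamma> g"
| "eval_term D f \<gamma> (Id p) = oid D (f p)"
| "eval_term D f \<gamma> (Comp t ts) = ocomp D (eval_term D f \<gamma> t) (map (eval_term D f \<gamma>) ts)"
| "eval_term D f \<gamma> (Act \<sigma> t) = act D \<sigma> (eval_term D f \<gamma> t)"

text \<open>The functor from the presented operad to \<open>D\<close> determined by its values on objects and generators.\<close>

definition induced_functor :: "('o2, 'm2) operad \<Rightarrow> ('o1 \<Rightarrow> 'o2) \<Rightarrow> ('g \<Rightarrow> 'm2)
    \<Rightarrow> ('o1, ('o1, 'g) oterm set, 'o2, 'm2) ofunctor" where
  "induced_functor D f \<gamma> = \<lparr>on_ob = f, on_mor = (\<lambda>C. eval_term D f \<gamma> (rep C))\<rparr>"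

text \<open>
  The relations which say that the object map \<open>i\<close> and the assignment \<open>\<gamma>\<close> of generators to the
  morphisms of \<open>P\<close> constitute a functor out of \<open>P\<close>.
\<close>

definition functor_relations :: "('o1, 'm1) operad \<Rightarrow> ('o1 \<Rightarrow> 'o) \<Rightarrow> ('m1 \<Rightarrow> 'g)
    \<Rightarrow> (('o, 'g) oterm \<times> ('o, 'g) oterm) set" where
  "functor_relations P i \<gamma> =
     {(Gen (\<gamma> (oid P p)), Id (i p)) | p. p \<in> ob P} \<union>
     {(Gen (\<gamma> (ocomp P f gs)), Comp (Gen (\<gamma> f)) (map (\<lambda>g. Gen (\<gamma> g)) gs)) | f gs.
        composable P f gs} \<union>
     {(Gen (\<gamma> (act P \<sigma> f)), Act \<sigma> (Gen (\<gamma> f))) | \<sigma> f.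
        f \<in> mor P \<and> \<sigma> permutes {..<length (src P f)}}"


section \<open>The Boardman-Vogt tensor product\<close>

text \<open>\<open>LeftGen \<psi> q\<close> is \<open>\<psi> \<otimes> q\<close> and \<open>RightGen p \<phi>\<close> is \<open>p \<otimes> \<phi>\<close>.\<close>

datatype ('o1, 'm1, 'o2, 'm2) bv_gen = LeftGen 'm1 'o2 | RightGen 'o1 'm2

definition interchange_relations :: "('o1, 'm1) operad \<Rightarrow> ('o2, 'm2) operad \<Rightarrow>
    (('o1 \<times> 'o2, ('o1, 'm1, 'o2, 'm2) bv_gen) oterm \<times>
     ('o1 \<times> 'o2, ('o1, 'm1, 'o2, 'm2) bv_gen) oterm) set" where
  "interchange_relations P Q =
     {(Comp (Gen (LeftGen \<psi> (tgt Q \<phi>))) (map (\<lambda>p. Gen (RightGen p \<phi>)) (src P \<psi>)),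
       Act (interchange_perm (length (src Q \<phi>)) (length (src P \<psi>)))
         (Comp (Gen (RightGen (tgt P \<psi>) \<phi>)) (map (\<lambda>q. Gen (LeftGen \<psi> q)) (src Q \<phi>))))
      | \<psi> \<phi>. \<psi> \<in> mor P \<and> \<phi> \<in> mor Q}"

definition bv_presentation :: "('o1, 'm1) operad \<Rightarrow> ('o2, 'm2) operad \<Rightarrow>
    ('o1 \<times> 'o2, ('o1, 'm1, 'o2, 'm2) bv_gen) presentation" where
  "bv_presentation P Q = \<lparr>
     pob = ob P \<times> ob Q,
     pgen = {LeftGen \<psi> q | \<psi> q. \<psi> \<in> mor P \<and> q \<in> ob Q} \<union>
            {RightGen p \<phi> | p \<phi>. p \<in> ob P \<and> \<phi> \<in> mor Q},
     gsrc = (\<lambda>g. case g of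
        LeftGen \<psi> q \<Rightarrow> map (\<lambda>p. (p, q)) (src P \<psi>)
      | RightGen p \<phi> \<Rightarrow> map (\<lambda>q. (p, q)) (src Q \<phi>)),
     gtgt = (\<lambda>g. case g of LeftGen \<psi> q \<Rightarrow> (tgt P \<psi>, q) | RightGen p \<phi> \<Rightarrow> (p, tgt Q \<phi>)),
     prel = (\<Union>q\<in>ob Q. functor_relations P (\<lambda>p. (p, q)) (\<lambda>\<psi>. LeftGen \<psi> q)) \<union>
            (\<Union>p\<in>ob P. functor_relations Q (\<lambda>q. (p, q)) (\<lambda>\<phi>. RightGen p \<phi>)) \<union>
            interchange_relations P Q\<rparr>"

type_synonym ('o1, 'm1, 'o2, 'm2) bv_mor =
  "('o1 \<times> 'o2, ('o1, 'm1, 'o2, 'm2) bv_gen) oterm set"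

definition bv_tensor :: "('o1, 'm1) operad \<Rightarrow> ('o2, 'm2) operad
    \<Rightarrow> ('o1 \<times> 'o2, ('o1, 'm1, 'o2, 'm2) bv_mor) operad"  (infixr "\<otimes>\<^sub>B\<^sub>V" 70) where
  "P \<otimes>\<^sub>B\<^sub>V Q = presented_operad (bv_presentation P Q)"

text \<open>
  The functor \<open>F \<otimes> G : P \<otimes> P' \<rightarrow> Q \<otimes> Q'\<close> for \<open>F : P \<rightarrow> Q\<close> and \<open>G : P' \<rightarrow> Q'\<close>.
\<close>

definition bv_tensor_functor :: "('p, 'pm, 'q, 'qm) ofunctor \<Rightarrow> ('p', 'pm', 'q', 'qm') ofunctor
    \<Rightarrow> ('q, 'qm) operad \<Rightarrow> ('q', 'qm') operad
    \<Rightarrow> ('p \<times> 'p', ('p, 'pm, 'p', 'pm') bv_mor, 'q \<times> 'q', ('q, 'qm, 'q', 'qm') bv_mor) ofunctor" where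
  "bv_tensor_functor F G Q Q' = induced_functor (Q \<otimes>\<^sub>B\<^sub>V Q')
     (map_prod (on_ob F) (on_ob G))
     (\<lambda>g. term_class (bv_presentation Q Q') (Gen (case g of
        LeftGen \<psi> p' \<Rightarrow> LeftGen (on_mor F \<psi>) (on_ob G p')
      | RightGen p \<phi> \<Rightarrow> RightGen (on_ob F p) (on_mor G \<phi>))))"


section \<open>Pushouts of operads\<close>

text \<open>
  The pushout of \<open>F : A \<rightarrow> P\<close> and \<open>G : A \<rightarrow> Q\<close>: its objects are the pushout of the object sets, and
  it is generated by the morphisms of \<open>P\<close> and \<open>Q\<close>, subject to functoriality of the two inclusions
  and to commutativity of the square.
\<close>

definition pushout_class :: "('a, 'am) operad \<Rightarrow> ('a, 'am, 'p, 'pm) ofunctor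
    \<Rightarrow> ('a, 'am, 'q, 'qm) ofunctor \<Rightarrow> 'p + 'q \<Rightarrow> ('p + 'q) set" where
  "pushout_class A F G x =
     {y. equivclp (\<lambda>u v. \<exists>a\<in>ob A. u = Inl (on_ob F a) \<and> v = Inr (on_ob G a)) x y}"

definition pushout_presentation :: "('a, 'am) operad \<Rightarrow> ('p, 'pm) operad \<Rightarrow> ('q, 'qm) operad
    \<Rightarrow> ('a, 'am, 'p, 'pm) ofunctor \<Rightarrow> ('a, 'am, 'q, 'qm) ofunctor
    \<Rightarrow> (('p + 'q) set, 'pm + 'qm) presentation" where
  "pushout_presentation A P Q F G = \<lparr>
     pob = pushout_class A F G ` (ob P <+> ob Q),
     pgen = mor P <+> mor Q,
     gsrc = case_sum (\<lambda>f. map (\<lambda>p. pushout_class A F G (Inl p)) (src P f))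
                     (\<lambda>f. map (\<lambda>q. pushout_class A F G (Inr q)) (src Q f)),
     gtgt = case_sum (\<lambda>f. pushout_class A F G (Inl (tgt P f)))
                     (\<lambda>f. pushout_class A F G (Inr (tgt Q f))),
     prel = functor_relations P (\<lambda>p. pushout_class A F G (Inl p)) Inl \<union>
            functor_relations Q (\<lambda>q. pushout_class A F G (Inr q)) Inr \<union>
            {(Gen (Inl (on_mor F f)), Gen (Inr (on_mor G f))) | f. f \<in> mor A}\<rparr>"

type_synonym ('p, 'pm, 'q, 'qm) pushout_mor = "(('p + 'q) set, 'pm + 'qm) oterm set"

definition pushout :: "('a, 'am) operad \<Rightarrow> ('p, 'pm) operad \<Rightarrow> ('q, 'qm) operad
    \<Rightarrow> ('a, 'am, 'p, 'pm) ofunctor \<Rightarrow> ('a, 'am, 'q, 'qm) ofunctor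
    \<Rightarrow> (('p + 'q) set, ('p, 'pm, 'q, 'qm) pushout_mor) operad" where
  "pushout A P Q F G = presented_operad (pushout_presentation A P Q F G)"

definition pushout_inl :: "('a, 'am) operad \<Rightarrow> ('p, 'pm) operad \<Rightarrow> ('q, 'qm) operad
    \<Rightarrow> ('a, 'am, 'p, 'pm) ofunctor \<Rightarrow> ('a, 'am, 'q, 'qm) ofunctor
    \<Rightarrow> ('p, 'pm, ('p + 'q) set, ('p, 'pm, 'q, 'qm) pushout_mor) ofunctor" where
  "pushout_inl A P Q F G = \<lparr>
     on_ob = (\<lambda>p. pushout_class A F G (Inl p)),
     on_mor = (\<lambda>f. term_class (pushout_presentation A P Q F G) (Gen (Inl f)))\<rparr>"

definition pushout_inr :: "('a, 'am) operad \<Rightarrow> ('p, 'pm) operad \<Rightarrow> ('q, 'qm) operad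
    \<Rightarrow> ('a, 'am, 'p, 'pm) ofunctor \<Rightarrow> ('a, 'am, 'q, 'qm) ofunctor
    \<Rightarrow> ('q, 'qm, ('p + 'q) set, ('p, 'pm, 'q, 'qm) pushout_mor) ofunctor" where
  "pushout_inr A P Q F G = \<lparr>
     on_ob = (\<lambda>q. pushout_class A F G (Inr q)),
     on_mor = (\<lambda>f. term_class (pushout_presentation A P Q F G) (Gen (Inr f)))\<rparr>"

text \<open>The functor out of the pushout determined by \<open>H : P \<rightarrow> D\<close> and \<open>K : Q \<rightarrow> D\<close>.\<close>

definition pushout_induced :: "('d, 'dm) operad \<Rightarrow> ('p, 'pm, 'd, 'dm) ofunctor
    \<Rightarrow> ('q, 'qm, 'd, 'dm) ofunctor
    \<Rightarrow> (('p + 'q) set, ('p, 'pm, 'q, 'qm) pushout_mor, 'd, 'dm) ofunctor" where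
  "pushout_induced D H K = induced_functor D
     (\<lambda>C. case_sum (on_ob H) (on_ob K) (rep C)) (case_sum (on_mor H) (on_mor K))"


section \<open>The pushout-product\<close>

text \<open>
  The map \<open>F \<and> G\<close> from the pushout of \<open>Q \<otimes> P' \<leftarrow> P \<otimes> P' \<rightarrow> P \<otimes> Q'\<close> to \<open>Q \<otimes> Q'\<close> induced by \<open>Q \<otimes> G\<close>
  and \<open>F \<otimes> Q'\<close>, for \<open>F : P \<rightarrow> Q\<close> and \<open>G : P' \<rightarrow> Q'\<close>.
\<close>

definition pushout_product_domain where
  "pushout_product_domain P Q F P' Q' G =
     pushout (P \<otimes>\<^sub>B\<^sub>V P') (Q \<otimes>\<^sub>B\<^sub>V P') (P \<otimes>\<^sub>B\<^sub>V Q')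
       (bv_tensor_functor F id_functor Q P') (bv_tensor_functor id_functor G P Q')"

definition pushout_product where
  "pushout_product Q F Q' G =
     pushout_induced (Q \<otimes>\<^sub>B\<^sub>V Q')
       (bv_tensor_functor id_functor G Q Q') (bv_tensor_functor F id_functor Q Q')"


section \<open>Correctness of the constructions\<close>

text \<open>
  The rest of this theory checks the definitions: the permutations act on lists as intended, presented
  operads are operads with the expected universal property, \<open>\<otimes>\<^sub>B\<^sub>V\<close> is a functor in both arguments, and
  \<open>pushout\<close> has the universal property of a pushout.
\<close>

subsection \<open>Permutations\<close>

lemma index_perm_permutes:
  assumes "mset L = mset [0..<length L]"
  shows "index_perm L permutes {..<length L}"
proof -
  have s: "set L = {..<length L}"
    using assms by (metis atLeast_upt mset_eq_setD)
  have d: "distinct L"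
    using assms by (metis distinct_upt mset_eq_imp_distinct_iff)
  have b: "bij_betw ((!) L) {..<length L} {..<length L}"
    using bij_betw_nth[OF d] s by simp
  have "bij_betw (index_perm L) {..<length L} {..<length L}"
    using b by (subst bij_betw_cong[where g="(!) L"]) (auto simp: index_perm_def)
  then show ?thesis
    by (rule bij_imp_permutes) (auto simp: index_perm_def)
qed

lemma permute_list_index_perm:
  "length xs = length L \<Longrightarrow> permute_list (index_perm L) xs = map ((!) xs) L"
  by (rule nth_equalityI) (auto simp: permute_list_def index_perm_def)

lemma blocks_Nil [simp]: "blocks [] = []"
  by (simp add: blocks_def)

lemma length_blocks [simp]: "length (blocks ks) = length ks"
  by (simp add: blocks_def)

lemma blocks_snoc: "blocks (ks @ [k]) = blocks ks @ [[sum_list ks..<sum_list ks + k]]"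
  by (simp add: blocks_def)

lemma concat_blocks: "concat (blocks ks) = [0..<sum_list ks]"
  by (induction ks rule: rev_induct) (simp_all add: blocks_snoc upt_add_eq_append[of 0])

lemma map_length_blocks [simp]: "map length (blocks ks) = ks"
  by (induction ks rule: rev_induct) (simp_all add: blocks_snoc)

lemma length_block [simp]: "i < length ks \<Longrightarrow> length (blocks ks ! i) = ks ! i"
  by (metis length_blocks map_length_blocks nth_map)

lemma nth_blocks: "map (map ((!) (concat xss))) (blocks (map length xss)) = xss"
proof (induction xss rule: rev_induct)
  case (snoc xs xss)
  have a: "map (map ((!) (concat xss @ xs))) (blocks (map length xss))
     = map (map ((!) (concat xss))) (blocks (map length xss))"
  proof (rule map_cong[OF refl], rule map_cong[OF refl])
    fix b j assume "b \<in> set (blocks (map length xss))" "j \<in> set b"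
    then have "j \<in> set (concat (blocks (map length xss)))" by auto
    then have "j < length (concat xss)" by (simp add: concat_blocks length_concat)
    then show "(concat xss @ xs) ! j = concat xss ! j" by (simp add: nth_append)
  qed
  have b: "map ((!) (concat xss @ xs)) [length (concat xss)..<length (concat xss) + length xs] = xs"
    by (rule nth_equalityI) auto
  show ?case using snoc a b by (simp add: blocks_snoc length_concat)
qed simp

lemma mset_concat_cong:
  fixes xss yss :: "'a list list"
  assumes "mset xss = mset yss"
  shows "mset (concat xss) = mset (concat yss)"
proof -
  have "mset (concat zss) = sum_mset (image_mset mset (mset zss))" for zss :: "'a list list"
    by (induction zss) simp_all
  then show ?thesis using assms by simp
qed

lemma mset_concat_pointwise: "list_all2 (\<lambda>xs ys. mset xs = mset ys) xss yss \<Longrightarrow>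
   mset (concat xss) = mset (concat yss)"
  by (induction rule: list_all2_induct) auto

lemma length_block_index:
  assumes "\<sigma> permutes {..<length ks}"
  shows "mset (concat (permute_list \<sigma> (blocks ks))) = mset [0..<sum_list ks]"
proof -
  have "mset (permute_list \<sigma> (blocks ks)) = mset (blocks ks)"
    using assms by simp
  from mset_concat_cong[OF this] show ?thesis
    unfolding concat_blocks .
qed

lemma block_perm_permutes:
  assumes "\<sigma> permutes {..<length ks}"
  shows "block_perm \<sigma> ks permutes {..<sum_list ks}"
proof -
  have l: "length (concat (permute_list \<sigma> (blocks ks))) = sum_list ks"
    using mset_eq_length[OF length_block_index[OF assms]] by simp
  show ?thesis unfolding block_perm_def
    using index_perm_permutes[of "concat (permute_list \<sigma> (blocks ks))"] length_block_index[OF assms] unfolding l by blast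
qed

lemma permute_block_perm:
  assumes "\<sigma> permutes {..<length xss}"
  shows "permute_list (block_perm \<sigma> (map length xss)) (concat xss) = concat (permute_list \<sigma> xss)"
proof -
  have l: "length (concat (permute_list \<sigma> (blocks (map length xss)))) = length (concat xss)"
    using mset_eq_length[OF length_block_index[of \<sigma> "map length xss"]] assms
    by (simp add: length_concat)
  have "permute_list (block_perm \<sigma> (map length xss)) (concat xss)
    = map ((!) (concat xss)) (concat (permute_list \<sigma> (blocks (map length xss))))"
    unfolding block_perm_def by (rule permute_list_index_perm) (simp add: l)
  also have "\<dots> = concat (permute_list \<sigma> (map (map ((!) (concat xss))) (blocks (map length xss))))"
    using assms by (simp add: map_concat permute_list_map)
  finally show ?thesis by (simp add: nth_blocks)
qed

lemma sum_index:
  assumes "list_all2 (\<lambda>\<sigma> k. \<sigma> permutes {..<k}) \<sigma>s ks"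
  shows "mset (concat (map2 permute_list \<sigma>s (blocks ks))) = mset [0..<sum_list ks]"
proof -
  have "mset (concat (map2 permute_list \<sigma>s (blocks ks))) = mset (concat (blocks ks))"
    by (rule mset_concat_pointwise)
       (use assms in \<open>auto simp: list_all2_conv_all_nth\<close>)
  then show ?thesis unfolding concat_blocks .
qed

lemma sum_perm_permutes:
  assumes "list_all2 (\<lambda>\<sigma> k. \<sigma> permutes {..<k}) \<sigma>s ks"
  shows "sum_perm \<sigma>s ks permutes {..<sum_list ks}"
proof -
  let ?L = "concat (map2 permute_list \<sigma>s (blocks ks))"
  have l: "length ?L = sum_list ks"
    using mset_eq_length[OF sum_index[OF assms]] by simp
  show ?thesis unfolding sum_perm_def
    using index_perm_permutes[of ?L] sum_index[OF assms] unfolding l by blast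
qed

lemma permute_sum_perm:
  assumes "list_all2 (\<lambda>\<sigma> xs. \<sigma> permutes {..<length xs}) \<sigma>s xss"
  shows "permute_list (sum_perm \<sigma>s (map length xss)) (concat xss) = concat (map2 permute_list \<sigma>s xss)"
proof -
  let ?b = "blocks (map length xss)"
  have a: "list_all2 (\<lambda>\<sigma> k. \<sigma> permutes {..<k}) \<sigma>s (map length xss)"
    using assms by (simp add: list_all2_conv_all_nth)
  have l: "length (concat (map2 permute_list \<sigma>s ?b)) = length (concat xss)"
    using mset_eq_length[OF sum_index[OF a]] by (simp add: length_concat)
  have "permute_list (sum_perm \<sigma>s (map length xss)) (concat xss)
    = map ((!) (concat xss)) (concat (map2 permute_list \<sigma>s ?b))"
    unfolding sum_perm_def by (rule permute_list_index_perm) (simp add: l)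
  also have "\<dots> = concat (map2 permute_list \<sigma>s (map (map ((!) (concat xss))) ?b))"
    unfolding map_concat
    by (rule arg_cong[where f=concat], rule nth_equalityI)
       (use assms in \<open>auto simp: list_all2_conv_all_nth permute_list_map\<close>)
  finally show ?thesis by (simp add: nth_blocks)
qed

lemma interchange_perm_permutes: "interchange_perm m n permutes {..<m * n}"
proof (rule bij_imp_permutes)
  let ?f = "interchange_perm m n"
  have inj: "inj_on ?f {..<m * n}"
  proof (rule inj_onI)
    fix x y assume "x \<in> {..<m * n}" "y \<in> {..<m * n}" "?f x = ?f y"
    then have x: "x < m * n" and y: "y < m * n"
      and e: "(x mod m) * n + x div m = (y mod m) * n + y div m"
      by (auto simp: interchange_perm_def)
    have "x div m < n" "y div m < n"
      using x y by (simp_all add: less_mult_imp_div_less mult.commute)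
    then have "((x mod m) * n + x div m) mod n = x div m" "((x mod m) * n + x div m) div n = x mod m"
      "((y mod m) * n + y div m) mod n = y div m" "((y mod m) * n + y div m) div n = y mod m"
      by simp_all
    with e have "x div m = y div m" "x mod m = y mod m"
      by metis+
    then show "x = y" by (metis div_mult_mod_eq)
  qed
  have "?f ` {..<m * n} \<subseteq> {..<m * n}"
  proof (rule image_subsetI)
    fix k assume "k \<in> {..<m * n}"
    then have k: "k < m * n" by simp
    then have m: "m > 0" by (cases m) auto
    have "k div m < n" using k by (simp add: less_mult_imp_div_less mult.commute)
    moreover have "k mod m < m" using m by simp
    ultimately have "(k mod m) * n + k div m < (k mod m) * n + n" by simp
    also have "\<dots> = Suc (k mod m) * n" by simp
    also have "\<dots> \<le> m * n" using \<open>k mod m < m\<close> by (intro mult_right_mono) auto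
    finally show "?f k \<in> {..<m * n}" using k by (simp add: interchange_perm_def)
  qed
  then show "bij_betw ?f {..<m * n} {..<m * n}"
    using inj by (simp add: bij_betw_def endo_inj_surj)
qed (auto simp: interchange_perm_def)

lemma nth_concat_rect:
  assumes "\<And>i. i < n \<Longrightarrow> length (f i) = m" "i < n" "j < m"
  shows "concat (map f [0..<n]) ! (i * m + j) = f i ! j"
  using assms
proof (induction n arbitrary: i)
  case (Suc n)
  have l: "length (concat (map f [0..<n])) = n * m"
  proof -
    have "map length (map f [0..<n]) = replicate n m"
      using Suc.prems(1) by (intro nth_equalityI) auto
    then show ?thesis by (simp add: length_concat sum_list_replicate del: map_map)
  qed
  show ?case
  proof (cases "i = n")
    case True
    then show ?thesis using l Suc.prems by (simp add: nth_append)
  next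
    case False
    then have "i < n" using Suc.prems by simp
    have "i * m + j < Suc i * m" using Suc.prems by simp
    also have "\<dots> \<le> n * m" using \<open>i < n\<close> by (intro mult_right_mono) auto
    finally show ?thesis using l Suc \<open>i < n\<close> by (simp add: nth_append)
  qed
qed simp

lemma length_concat_rect: "length (concat (map (\<lambda>x. map (g x) ys) xs)) = length xs * length ys"
  by (simp add: length_concat o_def sum_list_triv)

lemma permute_interchange:
  "permute_list (interchange_perm (length qs) (length ps)) (concat (map (\<lambda>q. map (\<lambda>p. (p, q)) ps) qs))
    = concat (map (\<lambda>p. map (\<lambda>q. (p, q)) qs) ps)" (is "permute_list ?s ?L = ?R")
proof (rule nth_equalityI)
  show l: "length (permute_list ?s ?L) = length ?R"
    by (simp add: length_concat_rect)
  fix k assume "k < length (permute_list ?s ?L)"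
  then have k: "k < length qs * length ps" by (simp add: length_concat_rect)
  let ?m = "length qs" and ?n = "length ps"
  define i j where "i = k div ?m" and "j = k mod ?m"
  have i: "i < ?n" using k by (simp add: i_def less_mult_imp_div_less mult.commute)
  have "?m > 0" using k by (cases qs) auto
  then have j: "j < ?m" by (simp add: j_def)
  have ke: "k = i * ?m + j" by (simp add: i_def j_def)
  have L: "?L = concat (map (\<lambda>j. map (\<lambda>p. (p, qs ! j)) ps) [0..<?m])"
    by (rule arg_cong[where f=concat]) (rule nth_equalityI; simp)
  have R: "?R = concat (map (\<lambda>i. map (\<lambda>q. (ps ! i, q)) qs) [0..<?n])"
    by (rule arg_cong[where f=concat]) (rule nth_equalityI; simp)
  have "permute_list ?s ?L ! k = ?L ! (j * ?n + i)"
    using k by (simp add: permute_list_def length_concat_rect interchange_perm_def i_def j_def)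
  also have "\<dots> = (ps ! i, qs ! j)"
    unfolding L using i j by (subst nth_concat_rect[where m="?n"]) auto
  also have "\<dots> = ?R ! k"
    unfolding R ke using i j by (subst nth_concat_rect[where m="?m"]) auto
  finally show "permute_list ?s ?L ! k = ?R ! k" .
qed


subsection \<open>Presented operads\<close>

locale operad_presentation =
  fixes X :: "('o, 'g) presentation"
  assumes gsrc_ob: "g \<in> pgen X \<Longrightarrow> set (gsrc X g) \<subseteq> pob X"
    and gtgt_ob: "g \<in> pgen X \<Longrightarrow> gtgt X g \<in> pob X"
    and rel_wf: "(s, t) \<in> prel X \<Longrightarrow>
      wf_term X s \<and> wf_term X t \<and> tsrc X s = tsrc X t \<and> ttgt X s = ttgt X t"
begin

lemma wf_tgt: "wf_term X t \<Longrightarrow> ttgt X t \<in> pob X"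
  by (induction t) (auto simp: gtgt_ob)

lemma wf_src: "wf_term X t \<Longrightarrow> set (tsrc X t) \<subseteq> pob X"
proof (induction t)
  case (Gen g)
  then show ?case using gsrc_ob by simp
next
  case (Comp t ts)
  then show ?case by (auto simp: list_all_iff)
qed auto

lemma term_eq_wf: "term_eq X s t \<Longrightarrow>
    wf_term X s \<and> wf_term X t \<and> tsrc X s = tsrc X t \<and> ttgt X s = ttgt X t"
proof (induction rule: term_eq.induct)
  case (teq_rel s t)
  then show ?case by (rule rel_wf)
next
  case (teq_comp_cong t ts t' ts')
  have "map (tsrc X) ts = map (tsrc X) ts'" "map (ttgt X) ts = map (ttgt X) ts'"
    "list_all (wf_term X) ts'"
    using teq_comp_cong.IH(2)
    by (auto simp: list_all2_conv_all_nth list_all_length intro!: nth_equalityI)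
  then show ?case using teq_comp_cong by simp
next
  case (teq_unit_left t)
  then show ?case by (simp add: wf_tgt)
next
  case (teq_unit_right t)
  then show ?case using wf_src[of t] by (simp add: list_all_iff subset_eq o_def)
next
  case (teq_assoc t ts uss)
  have l: "length ts = length uss" using teq_assoc by (simp add: list_all2_lengthD)
  have a: "list_all (wf_term X) (concat uss)" "list_all (wf_term X) (map2 Comp ts uss)"
    using teq_assoc(2) l by (auto simp: list_all2_conv_all_nth list_all_iff set_zip)
      (fastforce simp: in_set_conv_nth)+
  have a': "map (ttgt X) (map2 Comp ts uss) = map (ttgt X) ts"
    "map (\<lambda>us. concat (map (tsrc X) us)) uss = map (tsrc X) (map2 Comp ts uss)"
    by (rule nth_equalityI; use l in simp)+
  have "map (\<lambda>us. map (ttgt X) us) uss = map (tsrc X) ts"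
    by (rule nth_equalityI) (use teq_assoc(2) l in \<open>auto simp: list_all2_conv_all_nth\<close>)
  moreover have "concat (map (tsrc X) (concat uss)) = concat (map (\<lambda>us. concat (map (tsrc X) us)) uss)"
    by (induction uss) simp_all
  ultimately show ?case using teq_assoc(1) a a' by (simp add: map_concat)
next
  case (teq_act_comp \<sigma> t \<tau>)
  then show ?case
    by (auto simp: permute_list_compose intro: permutes_compose)
next
  case (teq_equivariance_inner t ts \<sigma>s)
  have l: "length \<sigma>s = length ts" using teq_equivariance_inner by (simp add: list_all2_lengthD)
  have a: "list_all (wf_term X) (map2 Act \<sigma>s ts)"
    "map (ttgt X) (map2 Act \<sigma>s ts) = map (ttgt X) ts"
    "map (tsrc X) (map2 Act \<sigma>s ts) = map2 permute_list \<sigma>s (map (tsrc X) ts)"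
    "list_all2 (\<lambda>\<sigma> xs. \<sigma> permutes {..<length xs}) \<sigma>s (map (tsrc X) ts)"
    "list_all2 (\<lambda>\<sigma> k. \<sigma> permutes {..<k}) \<sigma>s (map (\<lambda>s. length (tsrc X s)) ts)"
    using teq_equivariance_inner(2) l
    by (auto simp: list_all2_conv_all_nth list_all_length intro!: nth_equalityI)
  show ?case
    using teq_equivariance_inner(1) a(1,2,3) permute_sum_perm[OF a(4)] sum_perm_permutes[OF a(5)]
    by (simp add: length_concat o_def del: map_map) (simp add: o_def)
next
  case (teq_equivariance_outer t ts \<sigma>)
  have l: "length ts = length (tsrc X t)" using teq_equivariance_outer by (metis length_map wf_term.simps(3))
  have s: "\<sigma> permutes {..<length ts}" using l teq_equivariance_outer by simp
  have a: "map (ttgt X) (permute_list \<sigma> ts) = permute_list \<sigma> (map (ttgt X) ts)"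
    "map (tsrc X) (permute_list \<sigma> ts) = permute_list \<sigma> (map (tsrc X) ts)"
    using s by (simp_all add: permute_list_map)
  have b: "list_all (wf_term X) (permute_list \<sigma> ts)"
    using s teq_equivariance_outer by (simp add: list_all_iff)
  show ?case
    using teq_equivariance_outer a b block_perm_permutes[of \<sigma> "map (\<lambda>s. length (tsrc X s)) ts"] s
     permute_block_perm[of \<sigma> "map (tsrc X) ts"]
    by (simp add: length_concat o_def)
qed (auto intro: permutes_id)

abbreviation "cls \<equiv> term_class X"

lemma cls_eq_iff: "wf_term X s \<Longrightarrow> cls s = cls t \<longleftrightarrow> term_eq X s t"
  unfolding term_class_def by (auto intro: term_eq.intros)

lemma rep_cls: "wf_term X t \<Longrightarrow> term_eq X t (rep (cls t))"
  unfolding rep_def by (rule someI2[of _ t]) (auto simp: term_class_def intro: teq_refl)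

lemma rep_mor: "C \<in> mor (presented_operad X) \<Longrightarrow> wf_term X (rep C) \<and> cls (rep C) = C"
  using rep_cls term_eq_wf cls_eq_iff by (fastforce simp: presented_operad_def)

lemma presented_simps:
  "ob (presented_operad X) = pob X"
  "oid (presented_operad X) p = cls (Id p)"
  "wf_term X t \<Longrightarrow> cls t \<in> mor (presented_operad X)"
  "wf_term X t \<Longrightarrow> src (presented_operad X) (cls t) = tsrc X t"
  "wf_term X t \<Longrightarrow> tgt (presented_operad X) (cls t) = ttgt X t"
  using rep_cls[of t] term_eq_wf[of t "rep (cls t)"]
  by (auto simp: presented_operad_def)

lemma rep_list: "list_all (wf_term X) ts \<Longrightarrow> list_all2 (term_eq X) ts (map (\<lambda>t. rep (cls t)) ts)"
  by (auto simp: list_all2_conv_all_nth list_all_length rep_cls)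

lemma ocomp_cls: "wf_term X (Comp t ts) \<Longrightarrow>
   ocomp (presented_operad X) (cls t) (map cls ts) = cls (Comp t ts)"
proof -
  assume w: "wf_term X (Comp t ts)"
  then have "term_eq X (Comp t ts) (Comp (rep (cls t)) (map (\<lambda>t. rep (cls t)) ts))"
    by (intro teq_comp_cong rep_list rep_cls) auto
  with w have "cls (Comp t ts) = cls (Comp (rep (cls t)) (map (\<lambda>t. rep (cls t)) ts))"
    by (simp only: cls_eq_iff)
  then show ?thesis by (simp add: presented_operad_def o_def)
qed

lemma act_cls: "wf_term X (Act \<sigma> t) \<Longrightarrow> act (presented_operad X) \<sigma> (cls t) = cls (Act \<sigma> t)"
proof -
  assume w: "wf_term X (Act \<sigma> t)"
  then have "term_eq X (Act \<sigma> t) (Act \<sigma> (rep (cls t)))"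
    by (intro teq_act_cong rep_cls) auto
  with w have "cls (Act \<sigma> t) = cls (Act \<sigma> (rep (cls t)))"
    by (simp only: cls_eq_iff)
  then show ?thesis by (simp add: presented_operad_def)
qed

lemma mor_cases:
  assumes "C \<in> mor (presented_operad X)"
  obtains t where "wf_term X t" "C = cls t"
  using assms by (auto simp: presented_operad_def)

lemma mors_cases:
  assumes "set Cs \<subseteq> mor (presented_operad X)"
  obtains ts where "list_all (wf_term X) ts" "Cs = map cls ts"
proof
  show "list_all (wf_term X) (map rep Cs)"
    using assms rep_mor by (auto simp: list_all_iff)
  show "Cs = map cls (map rep Cs)"
    using assms rep_mor by (auto simp: subset_iff o_def intro!: map_idI[symmetric])
qed

lemma composable_cls: 
  assumes "list_all (wf_term X) ts" "wf_term X t"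
  shows "composable (presented_operad X) (cls t) (map cls ts) \<longleftrightarrow> wf_term X (Comp t ts)"
proof -
  have "map (tgt (presented_operad X)) (map cls ts) = map (ttgt X) ts"
    using assms by (auto simp: list_all_iff presented_simps)
  then show ?thesis using assms
    by (auto simp: composable_def presented_simps list_all_iff simp del: map_map)
qed

lemma composable_cases:
  assumes "composable (presented_operad X) C Cs"
  obtains t ts where "wf_term X (Comp t ts)" "C = cls t" "Cs = map cls ts"
  using assms composable_cls mor_cases mors_cases unfolding composable_def
  by (metis assms)

lemma src_list: "list_all (wf_term X) ts \<Longrightarrow>
   map (src (presented_operad X)) (map cls ts) = map (tsrc X) ts"
  by (auto simp: list_all_iff presented_simps)

theorem presented_operad: "symmetric_operad (presented_operad X)"
proof
  let ?P = "presented_operad X"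
  show "set (src ?P f) \<subseteq> ob ?P" if "f \<in> mor ?P" for f
    using mor_cases[OF that] wf_src by (metis presented_simps(1,4))
  show "tgt ?P f \<in> ob ?P" if "f \<in> mor ?P" for f
    using mor_cases[OF that] wf_tgt by (metis presented_simps(1,5))
  show "oid ?P p \<in> hom ?P [p] p" if "p \<in> ob ?P" for p
    using that by (simp add: hom_def presented_simps)
  show "ocomp ?P f gs \<in> hom ?P (concat (map (src ?P) gs)) (tgt ?P f)" if c: "composable ?P f gs" for f gs
    using c by (rule composable_cases) (simp add: hom_def presented_simps ocomp_cls src_list del: map_map)
  show "ocomp ?P (oid ?P (tgt ?P f)) [f] = f" if "f \<in> mor ?P" for f
  proof (rule mor_cases[OF that])
    fix t assume t: "wf_term X t" "f = cls t"
    then show ?thesis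
      using ocomp_cls[of "Id (ttgt X t)" "[t]"] teq_unit_left[OF t(1)] wf_tgt[of t]
      by (simp add: presented_simps cls_eq_iff)
  qed
  show "ocomp ?P f (map (oid ?P) (src ?P f)) = f" if "f \<in> mor ?P" for f
  proof (rule mor_cases[OF that])
    fix t assume t: "wf_term X t" "f = cls t"
    have w: "wf_term X (Comp t (map Id (tsrc X t)))" using t wf_src[of t] by (auto simp: list_all_iff o_def)
    have "map (oid ?P) (src ?P f) = map cls (map Id (tsrc X t))"
      using t by (simp add: presented_simps o_def)
    then show ?thesis
      using ocomp_cls[OF w] teq_unit_right[OF t(1)] t(2) cls_eq_iff[OF w] by metis
  qed
  show "ocomp ?P (ocomp ?P f gs) (concat hss) = ocomp ?P f (map2 (ocomp ?P) gs hss)"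
    if c: "composable ?P f gs" "list_all2 (composable ?P) gs hss" for f gs hss
  proof (rule composable_cases[OF c(1)])
    fix t ts assume t: "wf_term X (Comp t ts)" "f = cls t" "gs = map cls ts"
    have h: "set hs \<subseteq> mor ?P" if "hs \<in> set hss" for hs
      using c(2) that by (metis composable_def in_set_conv_nth list_all2_conv_all_nth)
    define uss where "uss = map (map rep) hss"
    have "map (\<lambda>C. cls (rep C)) hs = hs" if "hs \<in> set hss" for hs
      using h[OF that] rep_mor by (intro map_idI) auto
    then have hss: "hss = map (map cls) uss" unfolding uss_def
      by (simp add: o_def map_idI)
    have wu: "list_all (wf_term X) us" if u: "us \<in> set uss" for us
    proof -
      obtain hs where "hs \<in> set hss" "us = map rep hs" using u by (auto simp: uss_def)
      then show ?thesis using h[of hs] rep_mor by (auto simp: list_all_iff)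
    qed
    have l: "length ts = length uss" using list_all2_lengthD[OF c(2)] t hss by simp
    have w: "list_all2 (\<lambda>s us. wf_term X (Comp s us)) ts uss"
      unfolding list_all2_conv_all_nth
    proof (intro conjI allI impI l)
      fix i assume i: "i < length ts"
      have "wf_term X (ts ! i)" using t(1) i by (simp add: list_all_length)
      moreover have "composable ?P (cls (ts ! i)) (map cls (uss ! i))"
        using c(2) i l t hss by (auto simp: list_all2_conv_all_nth)
      ultimately show "wf_term X (Comp (ts ! i) (uss ! i))"
        using composable_cls wu[of "uss ! i"] i l by simp
    qed
    have e: "term_eq X (Comp (Comp t ts) (concat uss)) (Comp t (map2 Comp ts uss))"
      using teq_assoc[OF t(1) w] .
    have m: "map2 (ocomp ?P) gs hss = map cls (map2 Comp ts uss)"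
      by (rule nth_equalityI) (use w l in \<open>auto simp: t hss list_all2_conv_all_nth ocomp_cls\<close>)
    have "ocomp ?P (ocomp ?P f gs) (concat hss) = cls (Comp (Comp t ts) (concat uss))"
      using term_eq_wf[OF e] t(1)
      by (simp add: t hss ocomp_cls map_concat[symmetric] del: wf_term.simps)
    also have "\<dots> = cls (Comp t (map2 Comp ts uss))"
      using e term_eq_wf[OF e] by (simp add: cls_eq_iff del: wf_term.simps)
    also have "\<dots> = ocomp ?P f (map2 (ocomp ?P) gs hss)"
      unfolding m t(2) using term_eq_wf[OF e] by (simp add: ocomp_cls del: wf_term.simps map_map)
    finally show ?thesis .
  qed
  show "act ?P \<sigma> f \<in> hom ?P (permute_list \<sigma> (src ?P f)) (tgt ?P f)"
    if "f \<in> mor ?P" "\<sigma> permutes {..<length (src ?P f)}" for f \<sigma>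
    by (rule mor_cases[OF that(1)]) (use that in \<open>auto simp: presented_simps act_cls hom_def\<close>)
  show "act ?P id f = f" if "f \<in> mor ?P" for f
  proof (rule mor_cases[OF that])
    fix t assume t: "wf_term X t" "f = cls t"
    note e = teq_act_id[OF t(1)]
    show ?thesis using e term_eq_wf[OF e] t(2)
      by (simp add: act_cls cls_eq_iff)
  qed
  show "act ?P (\<sigma> \<circ> \<tau>) f = act ?P \<tau> (act ?P \<sigma> f)"
    if "f \<in> mor ?P" "\<sigma> permutes {..<length (src ?P f)}" "\<tau> permutes {..<length (src ?P f)}" for f \<sigma> \<tau>
  proof (rule mor_cases[OF that(1)])
    fix t assume t: "wf_term X t" "f = cls t"
    have w: "wf_term X (Act \<sigma> t)" "wf_term X (Act \<tau> t)" using t that by (auto simp: presented_simps)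
    note e = teq_act_comp[OF w]
    show ?thesis using w e term_eq_wf[OF e] t
      by (simp add: act_cls cls_eq_iff)
  qed
  show "ocomp ?P f (map2 (act ?P) \<sigma>s gs) = act ?P (sum_perm \<sigma>s (input_lengths ?P gs)) (ocomp ?P f gs)"
    if c: "composable ?P f gs" "list_all2 (\<lambda>\<sigma> g. \<sigma> permutes {..<length (src ?P g)}) \<sigma>s gs" for f gs \<sigma>s
  proof (rule composable_cases[OF c(1)])
    fix t ts assume t: "wf_term X (Comp t ts)" "f = cls t" "gs = map cls ts"
    have w: "list_all2 (\<lambda>\<sigma> s. wf_term X (Act \<sigma> s)) \<sigma>s ts"
      using c(2) t by (auto simp: list_all2_conv_all_nth list_all_length presented_simps)
    have m: "map2 (act ?P) \<sigma>s gs = map cls (map2 Act \<sigma>s ts)"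
      by (rule nth_equalityI) (use w in \<open>auto simp: t list_all2_conv_all_nth act_cls\<close>)
    have il: "input_lengths ?P gs = map (\<lambda>s. length (tsrc X s)) ts"
      using t by (auto simp: list_all_iff presented_simps)
    note e = teq_equivariance_inner[OF t(1) w]
    show ?thesis using e term_eq_wf[OF e] t(1) unfolding m il unfolding t
      by (simp add: ocomp_cls act_cls cls_eq_iff del: wf_term.simps map_map)
  qed
  show "ocomp ?P (act ?P \<sigma> f) (permute_list \<sigma> gs) = act ?P (block_perm \<sigma> (input_lengths ?P gs)) (ocomp ?P f gs)"
    if c: "composable ?P f gs" "\<sigma> permutes {..<length gs}" for f gs \<sigma>
  proof (rule composable_cases[OF c(1)])
    fix t ts assume t: "wf_term X (Comp t ts)" "f = cls t" "gs = map cls ts"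
    have "length ts = length (tsrc X t)" using t(1) by (metis length_map wf_term.simps(3))
    then have w: "wf_term X (Act \<sigma> t)" using t c(2) by simp
    have m: "permute_list \<sigma> gs = map cls (permute_list \<sigma> ts)"
      using c(2) t by (simp add: permute_list_map)
    have il: "input_lengths ?P gs = map (\<lambda>s. length (tsrc X s)) ts"
      using t by (auto simp: list_all_iff presented_simps)
    note e = teq_equivariance_outer[OF t(1) w]
    show ?thesis using e term_eq_wf[OF e] t(1) w unfolding m il unfolding t
      by (simp add: ocomp_cls act_cls cls_eq_iff del: wf_term.simps map_map)
  qed
qed

end


subsection \<open>The universal property of presented operads\<close>

locale presentation_model = operad_presentation X + symmetric_operad D
  for X :: "('o, 'g) presentation" and D :: "('o2, 'm2) operad" +
  fixes f :: "'o \<Rightarrow> 'o2" and \<gamma> :: "'g \<Rightarrow> 'm2"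
  assumes f_ob: "p \<in> pob X \<Longrightarrow> f p \<in> ob D"
    and gen_hom: "g \<in> pgen X \<Longrightarrow> \<gamma> g \<in> hom D (map f (gsrc X g)) (f (gtgt X g))"
    and rel_eval: "(s, t) \<in> prel X \<Longrightarrow> eval_term D f \<gamma> s = eval_term D f \<gamma> t"
begin

abbreviation "ev \<equiv> eval_term D f \<gamma>"

lemma composable_ev:
  assumes "wf_term X (Comp t ts)" "ev t \<in> hom D (map f (tsrc X t)) (f (ttgt X t))"
    "\<And>s. s \<in> set ts \<Longrightarrow> ev s \<in> hom D (map f (tsrc X s)) (f (ttgt X s))"
  shows "composable D (ev t) (map ev ts)"
proof -
  have "map (tgt D) (map ev ts) = map f (map (ttgt X) ts)"
    using assms(3) by (auto simp: hom_def)
  also have "\<dots> = src D (ev t)" using assms(1,2) by (simp add: hom_def)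
  finally show ?thesis using assms by (auto simp: composable_def hom_def)
qed

lemma ev_hom: "wf_term X t \<Longrightarrow> ev t \<in> hom D (map f (tsrc X t)) (f (ttgt X t))"
proof (induction t)
  case (Gen g)
  then show ?case using gen_hom by simp
next
  case (Id p)
  then show ?case using f_ob id_hom by simp
next
  case (Comp t ts)
  then have h: "\<And>s. s \<in> set ts \<Longrightarrow> ev s \<in> hom D (map f (tsrc X s)) (f (ttgt X s))"
    "ev t \<in> hom D (map f (tsrc X t)) (f (ttgt X t))"
    by (auto simp: list_all_iff)
  have "map (src D) (map ev ts) = map (map f) (map (tsrc X) ts)"
    using h by (auto simp: hom_def)
  moreover have "composable D (ev t) (map ev ts)"
    using composable_ev[OF Comp.prems h(2,1)] .
  ultimately show ?case using comp_hom[of "ev t" "map ev ts"] h(2)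
    by (simp add: hom_def map_concat del: map_map)
next
  case (Act \<sigma> t)
  then have "ev t \<in> hom D (map f (tsrc X t)) (f (ttgt X t))" "\<sigma> permutes {..<length (tsrc X t)}" by auto
  then show ?case using act_hom[of "ev t" \<sigma>] by (simp add: hom_def permute_list_map)
qed

lemma ev_simps:
  "wf_term X t \<Longrightarrow> ev t \<in> mor D"
  "wf_term X t \<Longrightarrow> src D (ev t) = map f (tsrc X t)"
  "wf_term X t \<Longrightarrow> tgt D (ev t) = f (ttgt X t)"
  using ev_hom by (auto simp: hom_def)

lemma composable_ev': "wf_term X (Comp t ts) \<Longrightarrow> composable D (ev t) (map ev ts)"
  by (rule composable_ev) (auto intro!: ev_hom simp: list_all_iff)

lemma ev_eq: "term_eq X s t \<Longrightarrow> ev s = ev t"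
proof (induction rule: term_eq.induct)
  case (teq_rel s t)
  then show ?case by (rule rel_eval)
next
  case (teq_comp_cong t ts t' ts')
  have "map ev ts = map ev ts'"
    by (rule nth_equalityI) (use teq_comp_cong.IH(2) in \<open>auto simp: list_all2_conv_all_nth\<close>)
  then show ?case using teq_comp_cong by simp
next
  case (teq_unit_left t)
  then show ?case using unit_left[of "ev t"] by (simp add: ev_simps)
next
  case (teq_unit_right t)
  then show ?case using unit_right[of "ev t"] by (simp add: ev_simps o_def)
next
  case (teq_assoc t ts uss)
  have c: "list_all2 (composable D) (map ev ts) (map (map ev) uss)"
    using teq_assoc(2) by (auto simp: list_all2_conv_all_nth composable_ev' simp del: wf_term.simps)
  have m: "map2 (ocomp D) (map ev ts) (map (map ev) uss) = map ev (map2 Comp ts uss)"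
    by (rule nth_equalityI) auto
  show ?case using assoc[OF composable_ev'[OF teq_assoc(1)] c] unfolding m
    by (simp add: map_concat)
next
  case (teq_act_id t)
  then show ?case using act_id[of "ev t"] by (simp add: ev_simps)
next
  case (teq_act_comp \<sigma> t \<tau>)
  then show ?case using act_comp[of "ev t" \<sigma> \<tau>] by (simp add: ev_simps)
next
  case (teq_equivariance_inner t ts \<sigma>s)
  have wf: "list_all (wf_term X) ts" using teq_equivariance_inner(1) by simp
  have c: "list_all2 (\<lambda>\<sigma> g. \<sigma> permutes {..<length (src D g)}) \<sigma>s (map ev ts)"
    using teq_equivariance_inner(2) wf by (auto simp: list_all2_conv_all_nth list_all_length ev_simps)
  have m: "map2 (act D) \<sigma>s (map ev ts) = map ev (map2 Act \<sigma>s ts)"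
    by (rule nth_equalityI) auto
  have il: "input_lengths D (map ev ts) = map (\<lambda>s. length (tsrc X s)) ts"
    using wf by (auto simp: list_all_iff ev_simps)
  show ?case using equivariance_inner[OF composable_ev'[OF teq_equivariance_inner(1)] c] 
    unfolding m il by simp
next
  case (teq_equivariance_outer t ts \<sigma>)
  have wf: "list_all (wf_term X) ts" using teq_equivariance_outer(1) by simp
  have "length ts = length (tsrc X t)" using teq_equivariance_outer(1) by (metis length_map wf_term.simps(3))
  then have s: "\<sigma> permutes {..<length (map ev ts)}" using teq_equivariance_outer(2) by simp
  have il: "input_lengths D (map ev ts) = map (\<lambda>s. length (tsrc X s)) ts"
    using wf by (auto simp: list_all_iff ev_simps)
  show ?case using equivariance_outer[OF composable_ev'[OF teq_equivariance_outer(1)] s] s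
    unfolding il by (simp add: permute_list_map)
qed auto

lemma on_mor_induced: "wf_term X t \<Longrightarrow> on_mor (induced_functor D f \<gamma>) (cls t) = ev t"
  using ev_eq[OF rep_cls] by (simp add: induced_functor_def)

theorem induced_functor: "operad_functor (presented_operad X) D (induced_functor D f \<gamma>)"
proof -
  let ?P = "presented_operad X" and ?I = "induced_functor D f \<gamma>"
  interpret P: symmetric_operad ?P by (rule presented_operad)
  have ob: "on_ob ?I = f" by (simp add: induced_functor_def)
  show ?thesis
  proof
    show "on_ob ?I p \<in> ob D" if "p \<in> ob ?P" for p
      using that f_ob by (simp add: ob presented_simps)
    show "on_mor ?I x \<in> hom D (map (on_ob ?I) (src ?P x)) (on_ob ?I (tgt ?P x))" if "x \<in> mor ?P" for x
      by (rule mor_cases[OF that]) (simp add: ob presented_simps on_mor_induced ev_hom)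
    show "on_mor ?I (oid ?P p) = oid D (on_ob ?I p)" if "p \<in> ob ?P" for p
      using that by (simp add: ob presented_simps on_mor_induced)
    show "on_mor ?I (ocomp ?P x ys) = ocomp D (on_mor ?I x) (map (on_mor ?I) ys)"
      if "composable ?P x ys" for x ys
    proof (rule composable_cases[OF that])
      fix t ts assume t: "wf_term X (Comp t ts)" "x = cls t" "ys = map cls ts"
      have "map (on_mor ?I) ys = map ev ts"
        using t by (auto simp: on_mor_induced list_all_iff)
      then show ?thesis using t(1) by (simp add: t(2,3) ocomp_cls on_mor_induced del: map_map)
    qed
    show "on_mor ?I (act ?P \<sigma> x) = act D \<sigma> (on_mor ?I x)"
      if "x \<in> mor ?P" "\<sigma> permutes {..<length (src ?P x)}" for x \<sigma>
      by (rule mor_cases[OF that(1)]) (use that in \<open>auto simp: presented_simps act_cls on_mor_induced\<close>)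
  qed
qed

theorem induced_functor_unique:
  assumes "operad_functor (presented_operad X) D H" "\<And>p. p \<in> pob X \<Longrightarrow> on_ob H p = f p"
    "\<And>g. g \<in> pgen X \<Longrightarrow> on_mor H (cls (Gen g)) = \<gamma> g"
  shows "functor_eq_on (presented_operad X) H (induced_functor D f \<gamma>)"
proof -
  interpret H: operad_functor "presented_operad X" D H by fact
  have "on_mor H (cls t) = ev t" if "wf_term X t" for t
    using that
  proof (induction t)
    case (Id p)
    then show ?case using H.map_id[of p] assms(2) by (simp add: presented_simps)
  next
    case (Comp t ts)
    then have "map (on_mor H) (map cls ts) = map ev ts" "on_mor H (cls t) = ev t"
      by (auto simp: list_all_iff)
    moreover have "composable (presented_operad X) (cls t) (map cls ts)"
      using Comp.prems composable_cls by auto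
    ultimately show ?case using H.map_comp[of "cls t" "map cls ts"] Comp.prems by (simp add: ocomp_cls del: map_map)
  next
    case (Act \<sigma> t)
    then show ?case using H.map_act[of "cls t" \<sigma>] by (simp add: presented_simps act_cls)
  qed (use assms in auto)
  then show ?thesis using assms(2)
    by (auto simp: functor_eq_on_def presented_simps on_mor_induced elim!: mor_cases)
      (simp add: induced_functor_def)
qed

end


subsection \<open>Tensor products and pushouts\<close>

lemma functor_relations_wf:
  assumes P: "symmetric_operad P" and "\<And>p. p \<in> ob P \<Longrightarrow> i p \<in> pob X"
    and g: "\<And>f. f \<in> mor P \<Longrightarrow>
      \<gamma> f \<in> pgen X \<and> gsrc X (\<gamma> f) = map i (src P f) \<and> gtgt X (\<gamma> f) = i (tgt P f)"
    and "(s, t) \<in> functor_relations P i \<gamma>"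
  shows "wf_term X s \<and> wf_term X t \<and> tsrc X s = tsrc X t \<and> ttgt X s = ttgt X t"
proof -
  interpret symmetric_operad P by fact
  from assms(4) consider
      (id) p where "p \<in> ob P" "s = Gen (\<gamma> (oid P p))" "t = Id (i p)"
    | (comp) f gs where "composable P f gs" "s = Gen (\<gamma> (ocomp P f gs))"
        "t = Comp (Gen (\<gamma> f)) (map (\<lambda>g. Gen (\<gamma> g)) gs)"
    | (act) \<sigma> f where "f \<in> mor P" "\<sigma> permutes {..<length (src P f)}"
        "s = Gen (\<gamma> (act P \<sigma> f))" "t = Act \<sigma> (Gen (\<gamma> f))"
    unfolding functor_relations_def by blast
  then show ?thesis
  proof cases
    case id
    then show ?thesis using id_hom[of p] g[of "oid P p"] assms(2) by (simp add: hom_def)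
  next
    case comp
    have m: "set gs \<subseteq> mor P" "f \<in> mor P" "src P f = map (tgt P) gs" using comp(1) by (auto simp: composable_def)
    have c: "ocomp P f gs \<in> mor P" "src P (ocomp P f gs) = concat (map (src P) gs)"
      "tgt P (ocomp P f gs) = tgt P f"
      using comp_hom[OF comp(1)] by (auto simp: hom_def)
    have a: "map (\<lambda>x. gsrc X (\<gamma> x)) gs = map (\<lambda>x. map i (src P x)) gs"
      "map (\<lambda>x. gtgt X (\<gamma> x)) gs = map (\<lambda>x. i (tgt P x)) gs"
      using g m by auto
    show ?thesis
      using g[OF c(1)] g[OF m(2)] g m a
      by (auto simp: comp(2,3) c m(3) o_def map_concat list_all_iff simp del: map_eq_conv)
  next
    case act
    then show ?thesis using act_hom[of f \<sigma>] g[of f] g[of "act P \<sigma> f"]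
      by (simp add: hom_def permute_list_map)
  qed
qed

lemma bv_presentation:
  assumes "symmetric_operad P" "symmetric_operad Q"
  shows "operad_presentation (bv_presentation P Q)"
proof -
  interpret P: symmetric_operad P by fact
  interpret Q: symmetric_operad Q by fact
  let ?X = "bv_presentation P Q"
  show ?thesis
  proof
    show "set (gsrc ?X g) \<subseteq> pob ?X" "gtgt ?X g \<in> pob ?X" if "g \<in> pgen ?X" for g
      using that P.src_ob P.tgt_ob Q.src_ob Q.tgt_ob by (fastforce simp: bv_presentation_def)+
    show "wf_term ?X s \<and> wf_term ?X t \<and> tsrc ?X s = tsrc ?X t \<and> ttgt ?X s = ttgt ?X t"
      if st: "(s, t) \<in> prel ?X" for s t
    proof -
      from st consider
          (l) q where "q \<in> ob Q" "(s, t) \<in> functor_relations P (\<lambda>p. (p, q)) (\<lambda>\<psi>. LeftGen \<psi> q)"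
        | (r) p where "p \<in> ob P" "(s, t) \<in> functor_relations Q (\<lambda>q. (p, q)) (\<lambda>\<phi>. RightGen p \<phi>)"
        | (i) "(s, t) \<in> interchange_relations P Q"
        unfolding bv_presentation_def by auto
      then show ?thesis
      proof cases
        case l
        show ?thesis
          by (rule functor_relations_wf[OF assms(1) _ _ l(2)]) (use l in \<open>auto simp: bv_presentation_def\<close>)
      next
        case r
        show ?thesis
          by (rule functor_relations_wf[OF assms(2) _ _ r(2)]) (use r in \<open>auto simp: bv_presentation_def\<close>)
      next
        case i
        then obtain \<psi> \<phi> where m: "\<psi> \<in> mor P" "\<phi> \<in> mor Q"
          and s: "s = Comp (Gen (LeftGen \<psi> (tgt Q \<phi>))) (map (\<lambda>p. Gen (RightGen p \<phi>)) (src P \<psi>))"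
          and t: "t = Act (interchange_perm (length (src Q \<phi>)) (length (src P \<psi>)))
             (Comp (Gen (RightGen (tgt P \<psi>) \<phi>)) (map (\<lambda>q. Gen (LeftGen \<psi> q)) (src Q \<phi>)))"
          unfolding interchange_relations_def by auto
        show ?thesis
          using m P.src_ob[OF m(1)] P.tgt_ob[OF m(1)] Q.src_ob[OF m(2)] Q.tgt_ob[OF m(2)]
            interchange_perm_permutes permute_interchange[of "src Q \<phi>" "src P \<psi>"]
          by (auto simp: s t bv_presentation_def list_all_iff o_def length_concat_rect)
      qed
    qed
  qed
qed

theorem bv_tensor_operad:
  "symmetric_operad P \<Longrightarrow> symmetric_operad Q \<Longrightarrow> symmetric_operad (P \<otimes>\<^sub>B\<^sub>V Q)"
  unfolding bv_tensor_def
  by (intro operad_presentation.presented_operad bv_presentation)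

lemma functor_of_relations:
  assumes "symmetric_operad P" "operad_presentation X" "functor_relations P i \<gamma> \<subseteq> prel X"
    and ip: "\<And>p. p \<in> ob P \<Longrightarrow> i p \<in> pob X"
    and g: "\<And>f. f \<in> mor P \<Longrightarrow>
      \<gamma> f \<in> pgen X \<and> gsrc X (\<gamma> f) = map i (src P f) \<and> gtgt X (\<gamma> f) = i (tgt P f)"
  shows "operad_functor P (presented_operad X)
     \<lparr>on_ob = i, on_mor = (\<lambda>f. term_class X (Gen (\<gamma> f)))\<rparr>"
proof -
  interpret P: symmetric_operad P by fact
  interpret X: operad_presentation X by fact
  interpret Q: symmetric_operad "presented_operad X" by (rule X.presented_operad)
  have r: "X.cls s = X.cls t" if "(s, t) \<in> functor_relations P i \<gamma>" for s t
    using that assms(3) X.rel_wf by (subst X.cls_eq_iff) (auto intro: teq_rel)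
  show ?thesis
  proof (unfold_locales, simp_all)
    show "i p \<in> ob (presented_operad X)" if "p \<in> ob P" for p
      using ip that by (simp add: X.presented_simps)
    show "X.cls (Gen (\<gamma> f)) \<in> hom (presented_operad X) (map i (src P f)) (i (tgt P f))"
      if "f \<in> mor P" for f
      using g[OF that] by (simp add: hom_def X.presented_simps)
    show "X.cls (Gen (\<gamma> (oid P p))) = oid (presented_operad X) (i p)" if "p \<in> ob P" for p
      unfolding X.presented_simps by (rule r) (use that in \<open>auto simp: functor_relations_def\<close>)
    show "X.cls (Gen (\<gamma> (ocomp P f gs))) =
       ocomp (presented_operad X) (X.cls (Gen (\<gamma> f))) (map (\<lambda>f. X.cls (Gen (\<gamma> f))) gs)"
      if c: "composable P f gs" for f gs
    proof -
      have rel: "(Gen (\<gamma> (ocomp P f gs)), Comp (Gen (\<gamma> f)) (map (\<lambda>g. Gen (\<gamma> g)) gs))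
         \<in> functor_relations P i \<gamma>"
        using c unfolding functor_relations_def by blast
      then have w: "wf_term X (Comp (Gen (\<gamma> f)) (map (\<lambda>g. Gen (\<gamma> g)) gs))"
        using X.rel_wf assms(3) by blast
      show ?thesis using r[OF rel] X.ocomp_cls[OF w] by (simp add: o_def)
    qed
    show "X.cls (Gen (\<gamma> (act P \<sigma> f))) = act (presented_operad X) \<sigma> (X.cls (Gen (\<gamma> f)))"
      if "f \<in> mor P" "\<sigma> permutes {..<length (src P f)}" for f \<sigma>
      using r[of "Gen (\<gamma> (act P \<sigma> f))" "Act \<sigma> (Gen (\<gamma> f))"] that g
      by (subst X.act_cls) (auto simp: functor_relations_def)
  qed
qed

text \<open>The universal property of the pushout, among operads over arbitrary types.\<close>

theorem pushout_universal:
  fixes A :: "('a, 'am) operad" and P :: "('p, 'pm) operad" and Q :: "('q, 'qm) operad"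
  assumes F: "operad_functor A P F" and G: "operad_functor A Q G"
  defines "W \<equiv> pushout A P Q F G" and "I \<equiv> pushout_inl A P Q F G" and "J \<equiv> pushout_inr A P Q F G"
  shows "operad_functor P W I" and "operad_functor Q W J"
    and "functor_eq_on A (comp_functor I F) (comp_functor J G)"
    and "\<And>(D :: ('d, 'dm) operad) H K.
      \<lbrakk>operad_functor P D H; operad_functor Q D K; functor_eq_on A (comp_functor H F) (comp_functor K G)\<rbrakk>
      \<Longrightarrow> operad_functor W D (pushout_induced D H K) \<and>
        functor_eq_on P (comp_functor (pushout_induced D H K) I) H \<and>
        functor_eq_on Q (comp_functor (pushout_induced D H K) J) K \<and>
        (\<forall>L. operad_functor W D L \<and> functor_eq_on P (comp_functor L I) H \<and>
             functor_eq_on Q (comp_functor L J) K \<longrightarrow>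
           functor_eq_on W L (pushout_induced D H K))"
proof -
  interpret F: operad_functor A P F by fact
  interpret G: operad_functor A Q G by fact
  let ?c = "pushout_class A F G"
  let ?R = "\<lambda>u v. \<exists>a\<in>ob A. u = Inl (on_ob F a) \<and> v = Inr (on_ob G a)"
  let ?X = "pushout_presentation A P Q F G"
  have glue: "?c (Inl (on_ob F a)) = ?c (Inr (on_ob G a))" if "a \<in> ob A" for a
  proof -
    have "equivclp ?R (Inl (on_ob F a)) (Inr (on_ob G a))"
      using that by (intro r_into_equivclp) blast
    then show ?thesis unfolding pushout_class_def
      by (auto intro: equivclp_trans equivclp_sym)
  qed
  have X: "operad_presentation ?X"
  proof
    show "set (gsrc ?X g) \<subseteq> pob ?X" "gtgt ?X g \<in> pob ?X" if "g \<in> pgen ?X" for g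
      using that F.target.src_ob F.target.tgt_ob G.target.src_ob G.target.tgt_ob
      by (fastforce simp: pushout_presentation_def)+
    show "wf_term ?X s \<and> wf_term ?X t \<and> tsrc ?X s = tsrc ?X t \<and> ttgt ?X s = ttgt ?X t"
      if st: "(s, t) \<in> prel ?X" for s t
    proof -
      from st consider
          (l) "(s, t) \<in> functor_relations P (\<lambda>p. ?c (Inl p)) Inl"
        | (r) "(s, t) \<in> functor_relations Q (\<lambda>q. ?c (Inr q)) Inr"
        | (g) f where "f \<in> mor A" "s = Gen (Inl (on_mor F f))" "t = Gen (Inr (on_mor G f))"
        unfolding pushout_presentation_def by auto
      then show ?thesis
      proof cases
        case l
        show ?thesis
          by (rule functor_relations_wf[OF F.target.symmetric_operad_axioms _ _ l])
             (auto simp: pushout_presentation_def)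
      next
        case r
        show ?thesis
          by (rule functor_relations_wf[OF G.target.symmetric_operad_axioms _ _ r])
             (auto simp: pushout_presentation_def)
      next
        case g
        then show ?thesis
          using F.map_hom[of f] G.map_hom[of f] F.source.src_ob[of f] F.source.tgt_ob[of f] glue
          by (auto simp: pushout_presentation_def hom_def)
      qed
    qed
  qed
  then interpret X: operad_presentation ?X .
  show I: "operad_functor P W I" unfolding W_def I_def pushout_def pushout_inl_def
    by (rule functor_of_relations[OF F.target.symmetric_operad_axioms X])
       (auto simp: pushout_presentation_def)
  show J: "operad_functor Q W J" unfolding W_def J_def pushout_def pushout_inr_def
    by (rule functor_of_relations[OF G.target.symmetric_operad_axioms X])
       (auto simp: pushout_presentation_def)
  have "X.cls (Gen (Inl (on_mor F f))) = X.cls (Gen (Inr (on_mor G f)))" if "f \<in> mor A" for f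
  proof -
    have rel: "(Gen (Inl (on_mor F f)), Gen (Inr (on_mor G f))) \<in> prel ?X"
      using that by (auto simp: pushout_presentation_def)
    then show ?thesis using X.rel_wf[OF rel] by (subst X.cls_eq_iff) (auto intro: teq_rel)
  qed
  then show "functor_eq_on A (comp_functor I F) (comp_functor J G)"
    using glue
    by (simp add: functor_eq_on_def comp_functor_def I_def J_def pushout_inl_def pushout_inr_def)
  fix D :: "('d, 'dm) operad" and H K
  assume H: "operad_functor P D H" and K: "operad_functor Q D K"
    and HK: "functor_eq_on A (comp_functor H F) (comp_functor K G)"
  interpret H: operad_functor P D H by fact
  interpret K: operad_functor Q D K by fact
  let ?f = "\<lambda>C. case_sum (on_ob H) (on_ob K) (rep C)"
  let ?\<gamma> = "case_sum (on_mor H) (on_mor K)"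
  have f: "?f (?c x) = case_sum (on_ob H) (on_ob K) x" for x
  proof -
    have *: "equivclp ?R x y \<Longrightarrow> case_sum (on_ob H) (on_ob K) x = case_sum (on_ob H) (on_ob K) y" for y
      by (induction rule: equivclp_induct)
         (use HK in \<open>auto simp: functor_eq_on_def comp_functor_def\<close>)
    have "x \<in> ?c x" by (simp add: pushout_class_def)
    then have "rep (?c x) \<in> ?c x" unfolding rep_def by (rule someI)
    then show ?thesis using *[of "rep (?c x)"] by (simp add: pushout_class_def)
  qed
  have ev_l: "eval_term D ?f ?\<gamma> s = eval_term D ?f ?\<gamma> t"
    if "(s, t) \<in> functor_relations P (\<lambda>p. ?c (Inl p)) Inl" for s t
    using that f by (auto simp: functor_relations_def H.map_id H.map_comp H.map_act o_def)
  have ev_r: "eval_term D ?f ?\<gamma> s = eval_term D ?f ?\<gamma> t"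
    if "(s, t) \<in> functor_relations Q (\<lambda>q. ?c (Inr q)) Inr" for s t
    using that f by (auto simp: functor_relations_def K.map_id K.map_comp K.map_act o_def)
  interpret M: presentation_model ?X D ?f ?\<gamma>
  proof unfold_locales
    show "?f p \<in> ob D" if "p \<in> pob ?X" for p
      using that H.map_ob K.map_ob by (auto simp: pushout_presentation_def f)
    show "?\<gamma> g \<in> hom D (map ?f (gsrc ?X g)) (?f (gtgt ?X g))" if "g \<in> pgen ?X" for g
      using that H.map_hom K.map_hom by (auto simp: pushout_presentation_def f o_def)
    show "eval_term D ?f ?\<gamma> s = eval_term D ?f ?\<gamma> t" if "(s, t) \<in> prel ?X" for s t
      using that ev_l ev_r HK
      by (auto simp: pushout_presentation_def functor_eq_on_def comp_functor_def)
  qed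
  have ind: "pushout_induced D H K = induced_functor D ?f ?\<gamma>"
    by (simp add: pushout_induced_def)
  have on_ob_ind: "on_ob (induced_functor D ?f ?\<gamma>) = ?f"
    by (simp add: induced_functor_def)
  have gen_ind: "on_mor (induced_functor D ?f ?\<gamma>) (X.cls (Gen g)) = ?\<gamma> g" if "g \<in> mor P <+> mor Q" for g
    using that M.on_mor_induced[of "Gen g"] by (simp add: pushout_presentation_def[of A P Q F G, THEN arg_cong[where f=pgen], simplified])
  have "operad_functor W D (pushout_induced D H K)"
    unfolding ind W_def pushout_def by (rule M.induced_functor)
  moreover have "functor_eq_on P (comp_functor (pushout_induced D H K) I) H"
    "functor_eq_on Q (comp_functor (pushout_induced D H K) J) K"
    unfolding ind using f gen_ind
    by (auto simp: functor_eq_on_def comp_functor_def I_def J_def pushout_inl_def pushout_inr_def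
        on_ob_ind InlI InrI)
  moreover have "functor_eq_on W L (pushout_induced D H K)"
    if L: "operad_functor W D L" "functor_eq_on P (comp_functor L I) H"
      "functor_eq_on Q (comp_functor L J) K" for L
    unfolding ind W_def pushout_def
  proof (rule M.induced_functor_unique)
    show "operad_functor (presented_operad ?X) D L" using L(1) by (simp add: W_def pushout_def)
    show "on_ob L p = ?f p" if "p \<in> pob ?X" for p
      using that L(2,3)
      by (auto simp: f pushout_presentation_def functor_eq_on_def comp_functor_def I_def J_def
          pushout_inl_def pushout_inr_def)
    show "on_mor L (X.cls (Gen g)) = ?\<gamma> g" if "g \<in> pgen ?X" for g
      using that L(2,3)
      by (auto simp: pushout_presentation_def functor_eq_on_def comp_functor_def I_def J_def
          pushout_inl_def pushout_inr_def)
  qed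
  ultimately show "operad_functor W D (pushout_induced D H K) \<and>
        functor_eq_on P (comp_functor (pushout_induced D H K) I) H \<and>
        functor_eq_on Q (comp_functor (pushout_induced D H K) J) K \<and>
        (\<forall>L. operad_functor W D L \<and> functor_eq_on P (comp_functor L I) H \<and>
             functor_eq_on Q (comp_functor L J) K \<longrightarrow>
           functor_eq_on W L (pushout_induced D H K))"
    by blast
qed

theorem bv_tensor_functor:
  assumes F: "operad_functor P Q F" and G: "operad_functor P' Q' G"
  shows "operad_functor (P \<otimes>\<^sub>B\<^sub>V P') (Q \<otimes>\<^sub>B\<^sub>V Q') (bv_tensor_functor F G Q Q')"
proof -
  interpret F: operad_functor P Q F by fact
  interpret G: operad_functor P' Q' G by fact
  let ?X = "bv_presentation P P'" and ?Y = "bv_presentation Q Q'"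
  have X: "operad_presentation ?X"
    by (intro bv_presentation F.source.symmetric_operad_axioms G.source.symmetric_operad_axioms)
  have Y: "operad_presentation ?Y"
    by (intro bv_presentation F.target.symmetric_operad_axioms G.target.symmetric_operad_axioms)
  interpret X: operad_presentation ?X by (rule X)
  interpret Y: operad_presentation ?Y by (rule Y)
  let ?D = "presented_operad ?Y"
  have D: "symmetric_operad ?D" by (rule Y.presented_operad)
  let ?f = "map_prod (on_ob F) (on_ob G)"
  let ?\<gamma> = "\<lambda>g. Y.cls (Gen (case g of LeftGen \<psi> p' \<Rightarrow> LeftGen (on_mor F \<psi>) (on_ob G p')
      | RightGen p \<phi> \<Rightarrow> RightGen (on_ob F p) (on_mor G \<phi>)))"
  have lf: "operad_functor Q ?D \<lparr>on_ob = (\<lambda>p. (p, q)), on_mor = (\<lambda>\<psi>. Y.cls (Gen (LeftGen \<psi> q)))\<rparr>"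
    if "q \<in> ob Q'" for q
    by (rule functor_of_relations[OF F.target.symmetric_operad_axioms Y])
       (use that in \<open>auto simp: bv_presentation_def\<close>)
  have rf: "operad_functor Q' ?D \<lparr>on_ob = (\<lambda>q. (p, q)), on_mor = (\<lambda>\<phi>. Y.cls (Gen (RightGen p \<phi>)))\<rparr>"
    if "p \<in> ob Q" for p
    by (rule functor_of_relations[OF G.target.symmetric_operad_axioms Y])
       (use that in \<open>auto simp: bv_presentation_def\<close>)
  have cF: "composable Q (on_mor F f) (map (on_mor F) gs)" if "composable P f gs" for f gs
  proof -
    have "map (tgt Q) (map (on_mor F) gs) = map (on_ob F) (map (tgt P) gs)"
      unfolding map_map by (rule map_cong[OF refl]) (use that F.map_hom in \<open>auto simp: composable_def hom_def\<close>)
    also have "\<dots> = src Q (on_mor F f)"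
      using that F.map_hom by (simp add: composable_def hom_def)
    finally show ?thesis using that F.map_hom by (auto simp: composable_def hom_def)
  qed
  have cG: "composable Q' (on_mor G f) (map (on_mor G) gs)" if "composable P' f gs" for f gs
  proof -
    have "map (tgt Q') (map (on_mor G) gs) = map (on_ob G) (map (tgt P') gs)"
      unfolding map_map by (rule map_cong[OF refl]) (use that G.map_hom in \<open>auto simp: composable_def hom_def\<close>)
    also have "\<dots> = src Q' (on_mor G f)"
      using that G.map_hom by (simp add: composable_def hom_def)
    finally show ?thesis using that G.map_hom by (auto simp: composable_def hom_def)
  qed
  interpret D: symmetric_operad ?D by (rule D)
  interpret M: presentation_model ?X ?D ?f ?\<gamma>
  proof unfold_locales
    show "?f p \<in> ob ?D" if "p \<in> pob ?X" for p
      unfolding Y.presented_simps(1)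
      using that F.map_ob G.map_ob by (auto simp: bv_presentation_def)
    show "?\<gamma> g \<in> hom ?D (map ?f (gsrc ?X g)) (?f (gtgt ?X g))" if "g \<in> pgen ?X" for g
    proof -
      have "wf_term ?Y (Gen (case g of LeftGen \<psi> p' \<Rightarrow> LeftGen (on_mor F \<psi>) (on_ob G p')
        | RightGen p \<phi> \<Rightarrow> RightGen (on_ob F p) (on_mor G \<phi>)))"
        using that F.map_hom G.map_hom F.map_ob G.map_ob by (auto simp: bv_presentation_def hom_def)
      from Y.presented_simps(3-5)[OF this] show ?thesis
        using that F.map_hom G.map_hom F.map_ob G.map_ob
        by (auto simp: hom_def) (auto simp: bv_presentation_def hom_def)
    qed
    show "eval_term ?D ?f ?\<gamma> s = eval_term ?D ?f ?\<gamma> t" if "(s, t) \<in> prel ?X" for s t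
    proof -
      from that consider
          (l) q where "q \<in> ob P'" "(s, t) \<in> functor_relations P (\<lambda>p. (p, q)) (\<lambda>\<psi>. LeftGen \<psi> q)"
        | (r) p where "p \<in> ob P" "(s, t) \<in> functor_relations P' (\<lambda>q. (p, q)) (\<lambda>\<phi>. RightGen p \<phi>)"
        | (i) "(s, t) \<in> interchange_relations P P'"
        unfolding bv_presentation_def by auto
      then show ?thesis
      proof cases
        case l
        interpret L: operad_functor Q ?D
          "\<lparr>on_ob = (\<lambda>p. (p, on_ob G q)), on_mor = (\<lambda>\<psi>. Y.cls (Gen (LeftGen \<psi> (on_ob G q))))\<rparr>"
          using \<open>q \<in> ob P'\<close> G.map_ob by (intro lf)
        have "f \<in> mor P \<Longrightarrow> on_mor F f \<in> mor Q \<and> src Q (on_mor F f) = map (on_ob F) (src P f)" for f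
          using F.map_hom by (auto simp: hom_def)
        then show ?thesis
          using l(2) L.map_id L.map_comp[OF cF] L.map_act F.map_ob
          by (auto simp: functor_relations_def F.map_id F.map_comp F.map_act o_def)
      next
        case r
        interpret R: operad_functor Q' ?D
          "\<lparr>on_ob = (\<lambda>q. (on_ob F p, q)), on_mor = (\<lambda>\<phi>. Y.cls (Gen (RightGen (on_ob F p) \<phi>)))\<rparr>"
          using \<open>p \<in> ob P\<close> F.map_ob by (intro rf)
        have "f \<in> mor P' \<Longrightarrow> on_mor G f \<in> mor Q' \<and> src Q' (on_mor G f) = map (on_ob G) (src P' f)" for f
          using G.map_hom by (auto simp: hom_def)
        then show ?thesis
          using r(2) R.map_id R.map_comp[OF cG] R.map_act G.map_ob
          by (auto simp: functor_relations_def G.map_id G.map_comp G.map_act o_def)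
      next
        case i
        then obtain \<psi> \<phi> where m: "\<psi> \<in> mor P" "\<phi> \<in> mor P'"
          and s: "s = Comp (Gen (LeftGen \<psi> (tgt P' \<phi>))) (map (\<lambda>p. Gen (RightGen p \<phi>)) (src P \<psi>))"
          and t: "t = Act (interchange_perm (length (src P' \<phi>)) (length (src P \<psi>)))
             (Comp (Gen (RightGen (tgt P \<psi>) \<phi>)) (map (\<lambda>q. Gen (LeftGen \<psi> q)) (src P' \<phi>)))"
          unfolding interchange_relations_def by auto
        let ?a = "on_mor F \<psi>" and ?b = "on_mor G \<phi>"
        have h: "?a \<in> mor Q" "?b \<in> mor Q'" "src Q ?a = map (on_ob F) (src P \<psi>)" "tgt Q ?a = on_ob F (tgt P \<psi>)"
          "src Q' ?b = map (on_ob G) (src P' \<phi>)" "tgt Q' ?b = on_ob G (tgt P' \<phi>)"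
          using F.map_hom[OF m(1)] G.map_hom[OF m(2)] by (auto simp: hom_def)
        let ?s = "Comp (Gen (LeftGen ?a (tgt Q' ?b))) (map (\<lambda>p. Gen (RightGen p ?b)) (src Q ?a))"
        let ?u = "Comp (Gen (RightGen (tgt Q ?a) ?b)) (map (\<lambda>q. Gen (LeftGen ?a q)) (src Q' ?b))"
        let ?t = "Act (interchange_perm (length (src Q' ?b)) (length (src Q ?a))) ?u"
        have "(?s, ?t) \<in> interchange_relations Q Q'"
          using h unfolding interchange_relations_def by blast
        then have rel: "(?s, ?t) \<in> prel ?Y" by (simp add: bv_presentation_def)
        note w = Y.rel_wf[OF rel]
        have u: "wf_term ?Y ?u" using w wf_term.simps(4) by blast
        have "Y.cls ?s = Y.cls ?t"
          using w teq_rel[OF rel] Y.cls_eq_iff by blast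
        moreover have "Y.cls ?s = eval_term ?D ?f ?\<gamma> s"
          using Y.ocomp_cls[of "Gen (LeftGen ?a (tgt Q' ?b))" "map (\<lambda>p. Gen (RightGen p ?b)) (src Q ?a)"] w
          by (simp add: s h o_def)
        moreover have "Y.cls ?t = eval_term ?D ?f ?\<gamma> t"
          using Y.act_cls[OF conjunct1[OF conjunct2[OF w]]] Y.ocomp_cls[OF u]
          by (simp add: t h o_def)
        ultimately show ?thesis by simp
      qed
    qed
  qed
  show ?thesis
    unfolding bv_tensor_functor_def bv_tensor_def by (rule M.induced_functor)
qed

end

theory Submission
  imports Defs
begin

text \<open>
  Write \<open>F : P \<rightarrow> Q\<close> and \<open>G : P' \<rightarrow> Q'\<close> for the two cofibrations, \<open>W\<close> for the pushout of
  \<open>Q \<otimes> P' \<leftarrow> P \<otimes> P' \<rightarrow> P \<otimes> Q'\<close>, with inclusions \<open>I\<close> and \<open>J\<close>, and \<open>\<Phi> : W \<rightarrow> Q \<otimes> Q'\<close> for the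
  pushout-product.  On objects \<open>\<Phi>\<close> is the map from \<open>(Q \<times> P') \<union> (P \<times> Q')\<close>, glued along \<open>P \<times> P'\<close>,
  to \<open>Q \<times> Q'\<close>; for injective object maps \<open>F\<close> and \<open>G\<close> this is injective, so \<open>\<Phi>\<close> is a cofibration.

  Let \<open>F\<close> be a trivial cofibration.  Every object is fibrant and cofibrant, so \<open>F\<close> ought to be a
  deformation retract, and this can be made explicit
  (\<open>trivial_cofibration_deformation_retract\<close>): there are a functor \<open>R : Q \<rightarrow> P\<close> with \<open>R F = id\<close> and a
  natural isomorphism \<open>\<eta> : F R \<cong> id\<close> which is the identity on the image of \<open>F\<close>.  Such data, unlike
  bijectivity on the morphism sets of operads given by generators and relations, are preserved by
  constructions: they only involve functors and equations, and both naturality and the equality of two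
  functors can be tested on generating morphisms.  So \<open>- \<otimes> C\<close> and \<open>C \<otimes> -\<close> preserve deformation
  retracts (\<open>deformation_retract_tensor_right\<close>, \<open>deformation_retract_tensor_left\<close>); the interchange
  relation with the unary morphism \<open>\<eta>\<^sub>q\<close> is exactly naturality with respect to the other tensor factor.

  It follows that \<open>\<Psi> = J (R \<otimes> Q') : Q \<otimes> Q' \<rightarrow> W\<close> is inverse to \<open>\<Phi>\<close> up to natural isomorphism
  (\<open>equivalence_of_pushout\<close>).  Indeed \<open>\<Phi> \<Psi> = (F \<otimes> Q') (R \<otimes> Q') \<cong> id\<close> by the retract \<open>F \<otimes> Q'\<close>.
  Furthermore \<open>\<Psi> \<Phi> J = J (R \<otimes> Q') (F \<otimes> Q') = J\<close> and
  \<open>\<Psi> \<Phi> I = J (R \<otimes> Q') (Q \<otimes> G) = J (P \<otimes> G) (R \<otimes> P') = I (F \<otimes> P') (R \<otimes> P') \<cong> I\<close>, and these two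
  isomorphisms glue to \<open>\<Psi> \<Phi> \<cong> id\<close> since the second one is the identity on the image of \<open>F \<otimes> P'\<close>.
  A functor with such a two-sided quasi-inverse is an operadic equivalence
  (\<open>operadic_equivalenceI\<close>).  For a trivial cofibration \<open>G\<close> the two legs of the pushout exchange
  their roles.
\<close>

section \<open>Commutative squares in an operad\<close>

lemma sum_perm_single: "\<sigma> permutes {..<n} \<Longrightarrow> sum_perm [\<sigma>] [n] = \<sigma>"
  using permutes_in_image[of \<sigma> "{..<n}"] permutes_not_in[of \<sigma> "{..<n}"]
  by (auto simp: fun_eq_iff sum_perm_def blocks_def index_perm_def permute_list_def)

lemma block_perm_unary:
  assumes "\<sigma> permutes {..<n}"
  shows "block_perm \<sigma> (replicate n 1) = \<sigma>"
proof -
  have blk: "blocks (replicate n 1) = map (\<lambda>i. [i]) [0..<n]"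
    by (rule nth_equalityI) (auto simp: blocks_def sum_list_replicate min_def)
  have "concat (permute_list \<sigma> (blocks (replicate n 1))) = permute_list \<sigma> [0..<n]"
    unfolding blk using assms by (simp add: permute_list_map)
  then show ?thesis
    using permutes_in_image[OF assms] permutes_not_in[OF assms] unfolding block_perm_def
    by (auto simp: fun_eq_iff index_perm_def permute_list_def)
qed

text \<open>
  The naturality squares \<open>a \<circ> x = y \<circ> (b\<^sub>1, \<dots>, b\<^sub>n)\<close> of a transformation whose components \<open>a\<close>, \<open>b\<^sub>i\<close>
  are unary.  Composability is included in order that squares can be pasted without side conditions.
\<close>

definition square :: "('o, 'm) operad \<Rightarrow> 'm \<Rightarrow> 'm \<Rightarrow> 'm \<Rightarrow> 'm list \<Rightarrow> bool" where
  "square P a x y bs \<longleftrightarrow> composable P a [x] \<and> composable P y bs \<and> ocomp P a [x] = ocomp P y bs"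

context symmetric_operad
begin

lemma comp_mor:
  "composable P f gs \<Longrightarrow> ocomp P f gs \<in> mor P"
  "composable P f gs \<Longrightarrow> src P (ocomp P f gs) = concat (map (src P) gs)"
  "composable P f gs \<Longrightarrow> tgt P (ocomp P f gs) = tgt P f"
  using comp_hom by (auto simp: hom_def)

lemma assoc_map:
  assumes "composable P f (map B gs)" "\<And>g. g \<in> set gs \<Longrightarrow> composable P (B g) (C g)"
  shows "ocomp P (ocomp P f (map B gs)) (concat (map C gs)) = ocomp P f (map (\<lambda>g. ocomp P (B g) (C g)) gs)"
  using assoc[of f "map B gs" "map C gs"] assms
  by (simp add: list_all2_map1 list_all2_map2 list_all2_same map2_map_map)

lemma assoc_unary:
  "composable P f [x] \<Longrightarrow> composable P x gs \<Longrightarrow> ocomp P (ocomp P f [x]) gs = ocomp P f [ocomp P x gs]"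
  using assoc_map[of f "\<lambda>_. x" "[()]" "\<lambda>_. gs"] by simp

lemma assoc_unary_list:
  assumes "composable P f (map B gs)" "\<And>g. g \<in> set gs \<Longrightarrow> composable P (B g) [X g]"
  shows "ocomp P (ocomp P f (map B gs)) (map X gs) = ocomp P f (map (\<lambda>g. ocomp P (B g) [X g]) gs)"
proof -
  have "concat (map (\<lambda>g. [X g]) gs) = map X gs" by (induction gs) simp_all
  with assoc_map[of f B gs "\<lambda>g. [X g]"] assms show ?thesis by simp
qed

text \<open>
  Naturality squares paste: in \<open>a \<circ> x \<circ> (x\<^sub>1, \<dots>, x\<^sub>n)\<close> the morphism \<open>a\<close> is moved past \<open>x\<close>, and then
  each \<open>b\<^sub>i\<close> past \<open>x\<^sub>i\<close>.  All the lists are images of one index list \<open>gs\<close>, which avoids the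
  bookkeeping of lengths.
\<close>

lemma square_comp:
  assumes sq: "square P a x y (map B gs)"
    and x: "composable P x (map X gs)" and y: "composable P y (map Y gs)"
    and sqs: "\<And>g. g \<in> set gs \<Longrightarrow> square P (B g) (X g) (Y g) (C g)"
  shows "square P a (ocomp P x (map X gs)) (ocomp P y (map Y gs)) (concat (map C gs))"
proof -
  have a: "composable P a [x]" "composable P y (map B gs)" "ocomp P a [x] = ocomp P y (map B gs)"
    using sq by (auto simp: square_def)
  have "ocomp P a [ocomp P x (map X gs)] = ocomp P (ocomp P y (map B gs)) (map X gs)"
    using assoc_unary[OF a(1) x] a(3) by simp
  also have "\<dots> = ocomp P y (map (\<lambda>g. ocomp P (B g) [X g]) gs)"
    by (rule assoc_unary_list[OF a(2)]) (use sqs in \<open>auto simp: square_def\<close>)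
  also have "\<dots> = ocomp P y (map (\<lambda>g. ocomp P (Y g) (C g)) gs)"
    by (rule arg_cong[where f = "ocomp P y"], rule map_cong) (use sqs in \<open>auto simp: square_def\<close>)
  also have "\<dots> = ocomp P (ocomp P y (map Y gs)) (concat (map C gs))"
    using assoc_map[OF y, of C] sqs by (simp add: square_def)
  finally have e: "ocomp P a [ocomp P x (map X gs)] = ocomp P (ocomp P y (map Y gs)) (concat (map C gs))" .
  have "map (tgt P) (concat (map C gs)) = concat (map (src P) (map Y gs))"
    using sqs by (auto simp: map_concat square_def composable_def intro!: arg_cong[where f = concat])
  then have "composable P (ocomp P y (map Y gs)) (concat (map C gs))"
    using sqs y comp_mor[OF y] by (fastforce simp: composable_def square_def)
  moreover have "composable P a [ocomp P x (map X gs)]"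
    using a(1) comp_mor[OF x] by (simp add: composable_def)
  ultimately show ?thesis using e by (simp add: square_def)
qed

text \<open>
  Because all the components are unary, the block and sum permutations of the two equivariance axioms
  both reduce to \<open>\<sigma>\<close> itself.
\<close>

lemma square_act:
  assumes sq: "square P a x y bs" and un: "\<And>b. b \<in> set bs \<Longrightarrow> length (src P b) = 1"
    and \<sigma>: "\<sigma> permutes {..<length bs}"
  shows "square P a (act P \<sigma> x) (act P \<sigma> y) (permute_list \<sigma> bs)"
proof -
  have a: "composable P a [x]" "composable P y bs" "ocomp P a [x] = ocomp P y bs"
    using sq by (auto simp: square_def)
  have il: "input_lengths P bs = replicate (length bs) 1"
    using un by (auto simp: list_eq_iff_nth_eq)
  have "src P x = concat (map (src P) bs)"
    using comp_mor(2)[OF a(1)] comp_mor(2)[OF a(2)] a(3) by simp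
  then have lx: "length (src P x) = length bs"
    using il by (simp add: length_concat o_def sum_list_replicate)
  have "length bs = length (src P y)"
    using a(2) by (metis composable_def length_map)
  then have hx: "act P \<sigma> x \<in> hom P (permute_list \<sigma> (src P x)) (tgt P x)"
    and hy: "act P \<sigma> y \<in> hom P (permute_list \<sigma> (src P y)) (tgt P y)"
    using a \<sigma> lx by (auto intro!: act_hom simp: composable_def)
  have "ocomp P a [act P \<sigma> x] = act P \<sigma> (ocomp P a [x])"
    using equivariance_inner[OF a(1), of "[\<sigma>]"] \<sigma> lx by (simp add: sum_perm_single)
  moreover have "ocomp P (act P \<sigma> y) (permute_list \<sigma> bs) = act P \<sigma> (ocomp P y bs)"
    using equivariance_outer[OF a(2) \<sigma>] \<sigma> by (simp add: il block_perm_unary[simplified])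
  moreover have "composable P a [act P \<sigma> x]"
    using a(1) hx by (simp add: composable_def hom_def)
  moreover have "composable P (act P \<sigma> y) (permute_list \<sigma> bs)"
    using a(2) hy \<sigma> by (simp add: composable_def hom_def permute_list_map[symmetric])
  ultimately show ?thesis using a(3) by (simp add: square_def)
qed

lemma iso_inD:
  assumes "iso_in P f a b"
  shows "f \<in> mor P" "src P f = [a]" "tgt P f = b" "a \<in> ob P" "b \<in> ob P"
  using assms src_ob[of f] tgt_ob[of f] by (auto simp: iso_in_def hom_def)

lemma iso_id: "p \<in> ob P \<Longrightarrow> iso_in P (oid P p) p p"
  using id_hom[of p] unit_left[of "oid P p"] by (auto simp: iso_in_def hom_def)

lemma iso_inverse:
  assumes "iso_in P f a b"
  obtains g where "iso_in P g b a" "ocomp P g [f] = oid P a" "ocomp P f [g] = oid P b"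
  using assms by (auto simp: iso_in_def)

lemma composable_isos:
  assumes "\<And>p. p \<in> set ps \<Longrightarrow> iso_in P (\<eta> p) (a p) (b p)" "y \<in> hom P (map b ps) c"
  shows "composable P y (map \<eta> ps)" "ocomp P y (map \<eta> ps) \<in> hom P (map a ps) c"
proof -
  have "map (tgt P) (map \<eta> ps) = map b ps" "map (src P) (map \<eta> ps) = map (\<lambda>p. [a p]) ps"
    using iso_inD[OF assms(1)] by (auto simp: o_def)
  moreover have "concat (map (\<lambda>p. [a p]) ps) = map a ps" by (induction ps) simp_all
  ultimately show "composable P y (map \<eta> ps)" "ocomp P y (map \<eta> ps) \<in> hom P (map a ps) c"
    using assms(2) iso_inD[OF assms(1)] comp_mor[of y "map \<eta> ps"]
    by (auto simp: composable_def hom_def simp del: map_map)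
qed

lemma composable_iso:
  assumes "iso_in P f a b" "x \<in> hom P ps a"
  shows "composable P f [x]" "ocomp P f [x] \<in> hom P ps b"
  using assms iso_inD[OF assms(1)] comp_mor[of f "[x]"] by (auto simp: composable_def hom_def)

lemma comp_inverse_left:
  assumes "iso_in P f a b" "g \<in> hom P [b] a" "ocomp P g [f] = oid P a" "x \<in> hom P ps a"
  shows "ocomp P g [ocomp P f [x]] = x"
proof -
  have "composable P g [f]" using assms(1,2) iso_inD[OF assms(1)] by (simp add: composable_def hom_def)
  from assoc_unary[OF this composable_iso(1)[OF assms(1,4)]] show ?thesis
    using assms(3,4) unit_left[of x] by (simp add: hom_def)
qed

lemma comp_inverses_right:
  assumes \<eta>: "\<And>p. p \<in> set ps \<Longrightarrow> iso_in P (\<eta> p) (a p) (b p)"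
    and \<iota>: "\<And>p. p \<in> set ps \<Longrightarrow> \<iota> p \<in> hom P [b p] (a p)"
    and e: "\<And>p. p \<in> set ps \<Longrightarrow> ocomp P (\<eta> p) [\<iota> p] = oid P (b p)"
    and y: "y \<in> hom P (map b ps) c"
  shows "ocomp P (ocomp P y (map \<eta> ps)) (map \<iota> ps) = y"
proof -
  have "ocomp P (ocomp P y (map \<eta> ps)) (map \<iota> ps) = ocomp P y (map (\<lambda>p. ocomp P (\<eta> p) [\<iota> p]) ps)"
    by (rule assoc_unary_list[OF composable_isos(1)[OF \<eta> y]])
       (use \<iota> iso_inD[OF \<eta>] in \<open>auto simp: composable_def hom_def\<close>)
  also have "map (\<lambda>p. ocomp P (\<eta> p) [\<iota> p]) ps = map (oid P) (src P y)"
    using e y by (simp add: hom_def)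
  finally show ?thesis using y unit_right[of y] by (simp add: hom_def)
qed

lemma iso_cancel_left:
  assumes "iso_in P f a b" "x \<in> hom P ps a" "y \<in> hom P ps a" "ocomp P f [x] = ocomp P f [y]"
  shows "x = y"
proof -
  obtain g where "g \<in> hom P [b] a" "ocomp P g [f] = oid P a" using assms(1) by (auto simp: iso_in_def)
  from comp_inverse_left[OF assms(1) this] show ?thesis using assms(2-4) by metis
qed

lemma iso_inverses:
  assumes "\<And>p. p \<in> A \<Longrightarrow> iso_in P (\<eta> p) (a p) (b p)"
  obtains \<iota> where "\<forall>p\<in>A. iso_in P (\<iota> p) (b p) (a p) \<and>
    ocomp P (\<iota> p) [\<eta> p] = oid P (a p) \<and> ocomp P (\<eta> p) [\<iota> p] = oid P (b p)"
proof -
  have "\<forall>p\<in>A. \<exists>g. iso_in P g (b p) (a p) \<and> ocomp P g [\<eta> p] = oid P (a p) \<and> ocomp P (\<eta> p) [g] = oid P (b p)"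
    using assms by (fastforce simp: iso_in_def)
  then show ?thesis using that unfolding bchoice_iff by blast
qed

lemma iso_cancel_right:
  assumes \<eta>: "\<And>p. p \<in> set ps \<Longrightarrow> iso_in P (\<eta> p) (a p) (b p)"
    and y: "y \<in> hom P (map b ps) c" and z: "z \<in> hom P (map b ps) c"
    and e: "ocomp P y (map \<eta> ps) = ocomp P z (map \<eta> ps)"
  shows "y = z"
proof -
  obtain \<iota> where \<iota>: "\<forall>p\<in>set ps. iso_in P (\<iota> p) (b p) (a p) \<and>
      ocomp P (\<iota> p) [\<eta> p] = oid P (a p) \<and> ocomp P (\<eta> p) [\<iota> p] = oid P (b p)"
    using iso_inverses[OF \<eta>] .
  have "ocomp P (ocomp P w (map \<eta> ps)) (map \<iota> ps) = w" if "w \<in> hom P (map b ps) c" for w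
    by (rule comp_inverses_right[OF \<eta>]) (use \<iota> that in \<open>auto simp: iso_in_def\<close>)
  then show ?thesis using y z e by metis
qed

text \<open>
  For isomorphisms \<open>\<eta> p : a p \<rightarrow> b p\<close>, conjugation completes either of the sides \<open>x\<close> and \<open>y\<close> to a
  square.
\<close>

lemma square_fill_left:
  assumes \<eta>: "\<And>p. p \<in> set (q # ps) \<Longrightarrow> iso_in P (\<eta> p) (a p) (b p)" and y: "y \<in> hom P (map b ps) (b q)"
  shows "\<exists>x\<in>hom P (map a ps) (a q). ocomp P (\<eta> q) [x] = ocomp P y (map \<eta> ps)"
proof -
  have iso: "iso_in P (\<eta> q) (a q) (b q)" using \<eta> by simp
  obtain \<iota> where \<iota>: "iso_in P \<iota> (b q) (a q)" "ocomp P (\<eta> q) [\<iota>] = oid P (b q)"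
    using iso_inverse[OF iso] by blast
  have "ocomp P y (map \<eta> ps) \<in> hom P (map a ps) (b q)"
    using composable_isos(2)[OF _ y] \<eta> by simp
  moreover have "\<eta> q \<in> hom P [a q] (b q)" using iso by (simp add: iso_in_def)
  ultimately show ?thesis
    using comp_inverse_left[OF \<iota>(1) _ \<iota>(2)] composable_iso(2)[OF \<iota>(1)] by blast
qed

lemma square_fill_right:
  assumes \<eta>: "\<And>p. p \<in> set (q # ps) \<Longrightarrow> iso_in P (\<eta> p) (a p) (b p)" and x: "x \<in> hom P (map a ps) (a q)"
  shows "\<exists>y\<in>hom P (map b ps) (b q). ocomp P (\<eta> q) [x] = ocomp P y (map \<eta> ps)"
proof -
  have "iso_in P (\<eta> p) (a p) (b p)" if "p \<in> set ps" for p
    using \<eta> that by simp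
  then obtain \<iota> where *: "\<forall>p\<in>set ps. iso_in P (\<iota> p) (b p) (a p) \<and>
      ocomp P (\<iota> p) [\<eta> p] = oid P (a p) \<and> ocomp P (\<eta> p) [\<iota> p] = oid P (b p)"
    by (rule iso_inverses)
  then have \<iota>: "\<And>p. p \<in> set ps \<Longrightarrow> iso_in P (\<iota> p) (b p) (a p)"
    "\<And>p. p \<in> set ps \<Longrightarrow> ocomp P (\<iota> p) [\<eta> p] = oid P (a p)"
    by auto
  have h: "ocomp P (\<eta> q) [x] \<in> hom P (map a ps) (b q)"
    using composable_iso(2)[OF _ x] \<eta> by simp
  have "ocomp P (ocomp P (ocomp P (\<eta> q) [x]) (map \<iota> ps)) (map \<eta> ps) = ocomp P (\<eta> q) [x]"
    by (rule comp_inverses_right[OF \<iota>(1) _ \<iota>(2) h]) (use \<eta> in \<open>auto simp: iso_in_def\<close>)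
  then show ?thesis using composable_isos(2)[OF \<iota>(1) h] by (metis)
qed

end


section \<open>Functors and natural isomorphisms\<close>

lemma comp_functor_simps [simp]:
  "on_ob (comp_functor G F) p = on_ob G (on_ob F p)" "on_mor (comp_functor G F) f = on_mor G (on_mor F f)"
  by (simp_all add: comp_functor_def)

lemma id_functor_simps [simp]: "on_ob id_functor p = p" "on_mor id_functor f = f"
  by (simp_all add: id_functor_def)

lemma comp_id_functor [simp]: "comp_functor id_functor F = F" "comp_functor F id_functor = F"
  by (simp_all add: comp_functor_def id_functor_def o_def)

lemma functor_eq_on_refl: "functor_eq_on P F F"
  by (simp add: functor_eq_on_def)

lemma functor_eq_on_sym: "functor_eq_on P F G \<Longrightarrow> functor_eq_on P G F"
  by (simp add: functor_eq_on_def)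

lemma functor_eq_on_trans: "functor_eq_on P F G \<Longrightarrow> functor_eq_on P G H \<Longrightarrow> functor_eq_on P F H"
  by (simp add: functor_eq_on_def)

lemma operad_functor_id: "symmetric_operad P \<Longrightarrow> operad_functor P P id_functor"
  by (simp add: operad_functor_def operad_functor_axioms_def hom_def id_functor_def)

context operad_functor
begin

lemma map_mor:
  "f \<in> mor P \<Longrightarrow> on_mor F f \<in> mor Q"
  "f \<in> mor P \<Longrightarrow> src Q (on_mor F f) = map (on_ob F) (src P f)"
  "f \<in> mor P \<Longrightarrow> tgt Q (on_mor F f) = on_ob F (tgt P f)"
  using map_hom by (auto simp: hom_def)

lemma map_hom': "f \<in> hom P ps p \<Longrightarrow> on_mor F f \<in> hom Q (map (on_ob F) ps) (on_ob F p)"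
  using map_mor by (auto simp: hom_def)

lemma map_composable:
  assumes "composable P f gs"
  shows "composable Q (on_mor F f) (map (on_mor F) gs)"
proof -
  have "map (tgt Q) (map (on_mor F) gs) = map (on_ob F) (map (tgt P) gs)"
    unfolding map_map by (rule map_cong[OF refl]) (use assms map_mor(3) in \<open>auto simp: composable_def\<close>)
  then show ?thesis using assms map_mor by (auto simp: composable_def simp del: map_map)
qed

lemma map_iso: "iso_in P f a b \<Longrightarrow> iso_in Q (on_mor F f) (on_ob F a) (on_ob F b)"
proof -
  assume f: "iso_in P f a b"
  then obtain g where g: "g \<in> hom P [b] a" "ocomp P g [f] = oid P a" "ocomp P f [g] = oid P b"
    by (auto simp: iso_in_def)
  have c: "composable P f [g]" "composable P g [f]" "a \<in> ob P" "b \<in> ob P"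
    using g f source.iso_inD[OF f] by (auto simp: composable_def hom_def)
  have "on_mor F f \<in> hom Q [on_ob F a] (on_ob F b)" "on_mor F g \<in> hom Q [on_ob F b] (on_ob F a)"
    using map_hom'[of f "[a]" b] map_hom'[OF g(1)] f by (auto simp: iso_in_def)
  moreover have "ocomp Q (on_mor F g) [on_mor F f] = oid Q (on_ob F a)"
    "ocomp Q (on_mor F f) [on_mor F g] = oid Q (on_ob F b)"
    using map_comp[OF c(1)] map_comp[OF c(2)] map_id c(3,4) g by auto
  ultimately show ?thesis by (auto simp: iso_in_def)
qed

end

lemma operad_functor_comp:
  assumes "operad_functor P Q F" "operad_functor Q R G"
  shows "operad_functor P R (comp_functor G F)"
proof -
  interpret F: operad_functor P Q F by fact
  interpret G: operad_functor Q R G by fact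
  show ?thesis
  proof
    show "on_ob (comp_functor G F) p \<in> ob R" if "p \<in> ob P" for p
      using that F.map_ob G.map_ob by simp
    show "on_mor (comp_functor G F) f \<in> hom R (map (on_ob (comp_functor G F)) (src P f))
        (on_ob (comp_functor G F) (tgt P f))" if "f \<in> mor P" for f
      using that F.map_mor G.map_mor by (simp add: hom_def)
    show "on_mor (comp_functor G F) (oid P p) = oid R (on_ob (comp_functor G F) p)" if "p \<in> ob P" for p
      using that F.map_id F.map_ob G.map_id by simp
    show "on_mor (comp_functor G F) (ocomp P f gs)
        = ocomp R (on_mor (comp_functor G F) f) (map (on_mor (comp_functor G F)) gs)"
      if "composable P f gs" for f gs
      using F.map_comp[OF that] G.map_comp[OF F.map_composable[OF that]] by (simp add: comp_functor_def)
    show "on_mor (comp_functor G F) (act P \<sigma> f) = act R \<sigma> (on_mor (comp_functor G F) f)"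
      if "f \<in> mor P" "\<sigma> permutes {..<length (src P f)}" for f \<sigma>
      using that F.map_act F.map_mor G.map_act by simp
  qed
qed

text \<open>Natural transformations of operad functors have unary components.\<close>

definition natural_iso :: "('o1, 'm1) operad \<Rightarrow> ('o2, 'm2) operad \<Rightarrow> ('o1, 'm1, 'o2, 'm2) ofunctor
    \<Rightarrow> ('o1, 'm1, 'o2, 'm2) ofunctor \<Rightarrow> ('o1 \<Rightarrow> 'm2) \<Rightarrow> bool" where
  "natural_iso P Q E E' \<eta> \<longleftrightarrow>
     (\<forall>p\<in>ob P. iso_in Q (\<eta> p) (on_ob E p) (on_ob E' p)) \<and>
     (\<forall>f\<in>mor P. square Q (\<eta> (tgt P f)) (on_mor E f) (on_mor E' f) (map \<eta> (src P f)))"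

lemma natural_iso_square:
  "natural_iso P Q E E' \<eta> \<Longrightarrow> f \<in> mor P \<Longrightarrow>
    ocomp Q (\<eta> (tgt P f)) [on_mor E f] = ocomp Q (on_mor E' f) (map \<eta> (src P f))"
  by (simp add: natural_iso_def square_def)

lemma natural_iso_cong:
  "natural_iso P Q E E' \<eta> \<Longrightarrow> functor_eq_on P E K \<Longrightarrow> natural_iso P Q K E' \<eta>"
  by (simp add: natural_iso_def functor_eq_on_def)

text \<open>The naturality square of \<open>f\<close> recovers \<open>f\<close> from \<open>\<Psi> (\<Phi> f)\<close>.\<close>

lemma faithful_of_natural_iso:
  assumes "operad_functor W D \<Phi>" "operad_functor D W \<Psi>"
    and nat: "natural_iso W W (comp_functor \<Psi> \<Phi>) id_functor \<theta>"
    and f: "f \<in> hom W ps p" and g: "g \<in> hom W ps p" and eq: "on_mor \<Phi> f = on_mor \<Phi> g"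
  shows "f = g"
proof -
  interpret \<Phi>: operad_functor W D \<Phi> by fact
  have "set ps \<subseteq> ob W" using f \<Phi>.source.src_ob by (auto simp: hom_def)
  then have iso: "iso_in W (\<theta> q) (on_ob \<Psi> (on_ob \<Phi> q)) q" if "q \<in> set ps" for q
    using nat that by (auto simp: natural_iso_def)
  have "ocomp W f (map \<theta> ps) = ocomp W g (map \<theta> ps)"
    using natural_iso_square[OF nat, of f] natural_iso_square[OF nat, of g] f g eq by (simp add: hom_def)
  then show ?thesis
    using \<Phi>.source.iso_cancel_right[of ps \<theta> "\<lambda>q. on_ob \<Psi> (on_ob \<Phi> q)" "\<lambda>q. q"] iso f g by simp
qed

text \<open>
  For fullness, conjugate \<open>\<Psi> h\<close> by \<open>\<theta>\<close> to obtain \<open>y\<close> with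
  \<open>\<Psi> (\<Phi> y) = \<Psi> h\<close>, and use that \<open>\<Psi>\<close> is faithful by \<open>\<zeta>\<close>.
\<close>

lemma operadic_equivalenceI:
  assumes \<Phi>: "operad_functor W D \<Phi>" and \<Psi>: "operad_functor D W \<Psi>"
    and \<theta>: "natural_iso W W (comp_functor \<Psi> \<Phi>) id_functor \<theta>"
    and \<zeta>: "natural_iso D D (comp_functor \<Phi> \<Psi>) id_functor \<zeta>"
  shows "operadic_equivalence W D \<Phi>"
proof -
  interpret \<Phi>: operad_functor W D \<Phi> by fact
  interpret \<Psi>: operad_functor D W \<Psi> by fact
  have "\<exists>w\<in>ob W. \<exists>f. iso_in D f (on_ob \<Phi> w) d" if "d \<in> ob D" for d
    using \<zeta> that \<Psi>.map_ob by (auto simp: natural_iso_def)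
  moreover have "bij_betw (on_mor \<Phi>) (hom W ps p) (hom D (map (on_ob \<Phi>) ps) (on_ob \<Phi> p))"
    if ob: "set ps \<subseteq> ob W" "p \<in> ob W" for ps p
  proof (rule bij_betw_imageI)
    show "inj_on (on_mor \<Phi>) (hom W ps p)"
      using faithful_of_natural_iso[OF \<Phi> \<Psi> \<theta>] by (auto simp: inj_on_def)
    show "on_mor \<Phi> ` hom W ps p = hom D (map (on_ob \<Phi>) ps) (on_ob \<Phi> p)"
    proof
      show "on_mor \<Phi> ` hom W ps p \<subseteq> hom D (map (on_ob \<Phi>) ps) (on_ob \<Phi> p)"
        using \<Phi>.map_hom' by auto
      show "hom D (map (on_ob \<Phi>) ps) (on_ob \<Phi> p) \<subseteq> on_mor \<Phi> ` hom W ps p"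
      proof
        fix h assume h: "h \<in> hom D (map (on_ob \<Phi>) ps) (on_ob \<Phi> p)"
        let ?e = "\<lambda>q. on_ob \<Psi> (on_ob \<Phi> q)"
        have iso: "iso_in W (\<theta> q) (?e q) q" if "q \<in> set (p # ps)" for q
          using \<theta> that ob by (auto simp: natural_iso_def)
        have \<Psi>h: "on_mor \<Psi> h \<in> hom W (map ?e ps) (?e p)"
          using \<Psi>.map_hom'[OF h] by (simp add: o_def)
        obtain y where y: "y \<in> hom W ps p" "ocomp W (\<theta> p) [on_mor \<Psi> h] = ocomp W y (map \<theta> ps)"
          using \<Phi>.source.square_fill_right[of p ps \<theta> ?e "\<lambda>q. q", OF iso \<Psi>h] by auto
        have "ocomp W (\<theta> p) [on_mor \<Psi> (on_mor \<Phi> y)] = ocomp W (\<theta> p) [on_mor \<Psi> h]"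
          using natural_iso_square[OF \<theta>, of y] y by (simp add: hom_def)
        moreover have "on_mor \<Psi> (on_mor \<Phi> y) \<in> hom W (map ?e ps) (?e p)"
          using \<Psi>.map_hom'[OF \<Phi>.map_hom'[OF y(1)]] by (simp add: o_def)
        ultimately have "on_mor \<Psi> (on_mor \<Phi> y) = on_mor \<Psi> h"
          using \<Phi>.source.iso_cancel_left[OF iso[of p]] \<Psi>h by simp
        then have "on_mor \<Phi> y = h"
          using faithful_of_natural_iso[OF \<Psi> \<Phi> \<zeta> \<Phi>.map_hom'[OF y(1)] h] by simp
        then show "h \<in> on_mor \<Phi> ` hom W ps p" using y(1) by blast
      qed
    qed
  qed
  ultimately show ?thesis using \<Phi> by (simp add: operadic_equivalence_def)
qed


section \<open>Generating sets of morphisms\<close>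

text \<open>
  The smallest suboperad, on all objects, which contains \<open>S\<close>.  Equality and natural isomorphism of
  functors out of tensor products and pushouts are decided on generators, so that the classes of terms
  which make up the morphisms of these operads need not be analysed.
\<close>

inductive_set generated :: "('o, 'm) operad \<Rightarrow> 'm set \<Rightarrow> 'm set" for P S where
  generator: "f \<in> S \<Longrightarrow> f \<in> generated P S"
| ident: "p \<in> ob P \<Longrightarrow> oid P p \<in> generated P S"
| comp: "composable P f gs \<Longrightarrow> f \<in> generated P S \<Longrightarrow> (\<And>g. g \<in> set gs \<Longrightarrow> g \<in> generated P S)
    \<Longrightarrow> ocomp P f gs \<in> generated P S"
| perm: "f \<in> mor P \<Longrightarrow> f \<in> generated P S \<Longrightarrow> \<sigma> permutes {..<length (src P f)}
    \<Longrightarrow> act P \<sigma> f \<in> generated P S"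

lemma (in operad_presentation) presented_generated:
  "mor (presented_operad X) \<subseteq> generated (presented_operad X) (cls ` Gen ` pgen X)"
proof
  fix C assume "C \<in> mor (presented_operad X)"
  then obtain t where t: "wf_term X t" "C = cls t" by (rule mor_cases)
  from t(1) have "cls t \<in> generated (presented_operad X) (cls ` Gen ` pgen X)"
  proof (induction t)
    case (Gen g)
    then show ?case by (auto intro: generator)
  next
    case (Id p)
    then show ?case using ident[of p "presented_operad X"] by (simp add: presented_simps)
  next
    case (Comp t ts)
    have "ocomp (presented_operad X) (cls t) (map cls ts)
        \<in> generated (presented_operad X) (cls ` Gen ` pgen X)"
      by (rule generated.comp) (use Comp composable_cls in \<open>auto simp: list_all_iff\<close>)
    then show ?case using Comp.prems by (simp add: ocomp_cls)
  next
    case (Act \<sigma> t)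
    have "act (presented_operad X) \<sigma> (cls t) \<in> generated (presented_operad X) (cls ` Gen ` pgen X)"
      by (rule generated.perm) (use Act in \<open>auto simp: presented_simps\<close>)
    then show ?case using Act.prems by (simp add: act_cls)
  qed
  then show "C \<in> generated (presented_operad X) (cls ` Gen ` pgen X)" using t(2) by simp
qed

lemma functor_eq_on_generators:
  assumes "operad_functor P Q E" "operad_functor P Q E'" and gen: "mor P \<subseteq> generated P S"
    and ob: "\<And>p. p \<in> ob P \<Longrightarrow> on_ob E p = on_ob E' p"
    and S: "\<And>f. f \<in> S \<Longrightarrow> on_mor E f = on_mor E' f"
  shows "functor_eq_on P E E'"
proof -
  interpret E: operad_functor P Q E by fact
  interpret E': operad_functor P Q E' by fact
  have "on_mor E f = on_mor E' f" if "f \<in> generated P S" for f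
    using that
  proof induction
    case (comp f gs)
    then show ?case by (simp add: E.map_comp E'.map_comp cong: map_cong)
  qed (simp_all add: S ob E.map_id E'.map_id E.map_act E'.map_act)
  then show ?thesis using ob gen by (auto simp: functor_eq_on_def)
qed

text \<open>
  The morphisms with a commutative naturality square form a suboperad, by pasting of squares.
\<close>

lemma natural_iso_on_generators:
  assumes "operad_functor P Q E" "operad_functor P Q E'" and gen: "mor P \<subseteq> generated P S"
    and iso: "\<And>p. p \<in> ob P \<Longrightarrow> iso_in Q (\<eta> p) (on_ob E p) (on_ob E' p)"
    and S: "\<And>f. f \<in> S \<Longrightarrow> f \<in> mor P \<Longrightarrow> ocomp Q (\<eta> (tgt P f)) [on_mor E f] = ocomp Q (on_mor E' f) (map \<eta> (src P f))"
  shows "natural_iso P Q E E' \<eta>"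
proof -
  interpret E: operad_functor P Q E by fact
  interpret E': operad_functor P Q E' by fact
  have sq: "square Q (\<eta> (tgt P f)) (on_mor E f) (on_mor E' f) (map \<eta> (src P f))"
    if f: "f \<in> mor P" and e: "ocomp Q (\<eta> (tgt P f)) [on_mor E f] = ocomp Q (on_mor E' f) (map \<eta> (src P f))" for f
  proof -
    have o: "set (src P f) \<subseteq> ob P" "tgt P f \<in> ob P"
      using f E.source.src_ob E.source.tgt_ob by auto
    show ?thesis unfolding square_def
      using e E.map_hom[OF f] E'.map_hom[OF f] o iso
        E.target.composable_iso(1)[OF iso[OF o(2)], of "on_mor E f"]
        E.target.composable_isos(1)[of "src P f" \<eta> "on_ob E" "on_ob E'" "on_mor E' f" "on_ob E' (tgt P f)"]
      by auto
  qed
  have "f \<in> mor P \<longrightarrow> square Q (\<eta> (tgt P f)) (on_mor E f) (on_mor E' f) (map \<eta> (src P f))"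
    if "f \<in> generated P S" for f
    using that
  proof induction
    case (generator f)
    then show ?case using S sq by blast
  next
    case (ident p)
    have i: "oid P p \<in> mor P" "src P (oid P p) = [p]" "tgt P (oid P p) = p"
      using E.source.id_hom[OF ident] by (auto simp: hom_def)
    show ?case
      using sq[of "oid P p"] i E.map_id[OF ident] E'.map_id[OF ident]
        E.target.unit_right[of "\<eta> p"] E.target.unit_left[of "\<eta> p"] E.target.iso_inD[OF iso[OF ident]]
      by simp
  next
    case (comp f gs)
    have c: "f \<in> mor P" "set gs \<subseteq> mor P" "src P f = map (tgt P) gs"
      using comp(1) by (auto simp: composable_def)
    have "square Q (\<eta> (tgt P f)) (ocomp Q (on_mor E f) (map (on_mor E) gs))
      (ocomp Q (on_mor E' f) (map (on_mor E') gs)) (concat (map (\<lambda>g. map \<eta> (src P g)) gs))"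
      by (rule E.target.square_comp[where B = "\<lambda>g. \<eta> (tgt P g)"])
        (use comp c E.map_composable E'.map_composable in \<open>auto simp: o_def\<close>)
    then show ?case
      by (simp add: E.source.comp_mor[OF comp(1)] E.map_comp[OF comp(1)] E'.map_comp[OF comp(1)]
          map_concat o_def)
  next
    case (perm f \<sigma>)
    have h: "src P (act P \<sigma> f) = permute_list \<sigma> (src P f)" "tgt P (act P \<sigma> f) = tgt P f"
      using E.source.act_hom[of f \<sigma>] perm by (auto simp: hom_def)
    have "length (src Q b) = 1" if "b \<in> set (map \<eta> (src P f))" for b
      using that perm(1) E.source.src_ob[of f] E.target.iso_inD(2)[OF iso] by fastforce
    then have "square Q (\<eta> (tgt P f)) (act Q \<sigma> (on_mor E f)) (act Q \<sigma> (on_mor E' f))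
        (permute_list \<sigma> (map \<eta> (src P f)))"
      using perm by (intro E.target.square_act) auto
    then show ?case using perm h by (simp add: E.map_act E'.map_act permute_list_map)
  qed
  then show ?thesis using gen iso by (auto simp: natural_iso_def)
qed


section \<open>Deformation retracts of operads\<close>

text \<open>
  The isomorphism \<open>\<eta>\<close> is the identity on the image of \<open>F\<close>; this strong form is what allows it to be
  extended by identities along a pushout.
\<close>

definition deformation_retract :: "('o1, 'm1) operad \<Rightarrow> ('o2, 'm2) operad
    \<Rightarrow> ('o1, 'm1, 'o2, 'm2) ofunctor \<Rightarrow> ('o2, 'm2, 'o1, 'm1) ofunctor \<Rightarrow> ('o2 \<Rightarrow> 'm2) \<Rightarrow> bool" where
  "deformation_retract P Q F R \<eta> \<longleftrightarrow> operad_functor P Q F \<and> operad_functor Q P R \<and>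
     functor_eq_on P (comp_functor R F) id_functor \<and>
     natural_iso Q Q (comp_functor F R) id_functor \<eta> \<and>
     (\<forall>p\<in>ob P. \<eta> (on_ob F p) = oid Q (on_ob F p))"

text \<open>
  Choose for each \<open>q\<close> an object \<open>r q\<close> and an isomorphism \<open>\<eta> q : F (r q) \<rightarrow> q\<close>; for \<open>q\<close> in the image of
  \<open>F\<close> take the preimage, which is unique, and the identity.  Since \<open>F\<close> is fully faithful, each \<open>\<psi>\<close> in
  \<open>Q\<close> has exactly one \<open>\<rho> \<psi>\<close> in \<open>P\<close> such that \<open>F (\<rho> \<psi>)\<close> completes the naturality square of \<open>\<eta>\<close> at
  \<open>\<psi>\<close>.  By this uniqueness the functor laws for \<open>\<rho>\<close> reduce to the pasting of squares.
\<close>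

lemma trivial_cofibration_deformation_retract:
  assumes "trivial_cofibration P Q F"
  obtains R \<eta> where "deformation_retract P Q F R \<eta>"
proof -
  have F: "operad_functor P Q F" and inj: "inj_on (on_ob F) (ob P)"
    and ess: "\<And>q. q \<in> ob Q \<Longrightarrow> \<exists>p\<in>ob P. \<exists>f. iso_in Q f (on_ob F p) q"
    and ff: "\<And>ps p. set ps \<subseteq> ob P \<Longrightarrow> p \<in> ob P \<Longrightarrow>
        bij_betw (on_mor F) (hom P ps p) (hom Q (map (on_ob F) ps) (on_ob F p))"
    using assms by (auto simp: trivial_cofibration_def cofibration_def operadic_equivalence_def)
  interpret F: operad_functor P Q F by fact
  have "\<exists>p f. p \<in> ob P \<and> iso_in Q f (on_ob F p) q \<and> (q \<in> on_ob F ` ob P \<longrightarrow> on_ob F p = q \<and> f = oid Q q)"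
    if "q \<in> ob Q" for q
  proof (cases "q \<in> on_ob F ` ob P")
    case True
    then show ?thesis using F.target.iso_id[OF that] by blast
  next
    case False
    then show ?thesis using ess[OF that] by blast
  qed
  then have "\<forall>q\<in>ob Q. \<exists>z. fst z \<in> ob P \<and> iso_in Q (snd z) (on_ob F (fst z)) q \<and>
      (q \<in> on_ob F ` ob P \<longrightarrow> on_ob F (fst z) = q \<and> snd z = oid Q q)"
    by simp
  then obtain z where z: "\<forall>q\<in>ob Q. fst (z q) \<in> ob P \<and> iso_in Q (snd (z q)) (on_ob F (fst (z q))) q \<and>
      (q \<in> on_ob F ` ob P \<longrightarrow> on_ob F (fst (z q)) = q \<and> snd (z q) = oid Q q)"
    unfolding bchoice_iff by blast
  define r where "r q = fst (z q)" for q
  define \<eta> where "\<eta> q = snd (z q)" for q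
  let ?e = "\<lambda>q. on_ob F (r q)"
  have r: "r q \<in> ob P" "iso_in Q (\<eta> q) (?e q) q" if "q \<in> ob Q" for q
    using z that by (auto simp: r_def \<eta>_def)
  have rF: "r (on_ob F p) = p" "\<eta> (on_ob F p) = oid Q (on_ob F p)" if "p \<in> ob P" for p
    using z F.map_ob that inj by (auto simp: r_def \<eta>_def inj_on_def)
  have obs: "set (src Q \<psi>) \<subseteq> ob Q" "tgt Q \<psi> \<in> ob Q" if "\<psi> \<in> mor Q" for \<psi>
    using that F.target.src_ob F.target.tgt_ob by auto
  let ?H = "\<lambda>\<psi>. hom P (map r (src Q \<psi>)) (r (tgt Q \<psi>))"
  have homs: "bij_betw (on_mor F) (?H \<psi>) (hom Q (map ?e (src Q \<psi>)) (?e (tgt Q \<psi>)))" if "\<psi> \<in> mor Q" for \<psi>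
  proof -
    have "set (map r (src Q \<psi>)) \<subseteq> ob P" "r (tgt Q \<psi>) \<in> ob P" using obs[OF that] r(1) by auto
    from ff[OF this] show ?thesis by (simp add: o_def)
  qed
  have ex: "\<exists>f\<in>?H \<psi>. ocomp Q (\<eta> (tgt Q \<psi>)) [on_mor F f] = ocomp Q \<psi> (map \<eta> (src Q \<psi>))"
    if "\<psi> \<in> mor Q" for \<psi>
  proof -
    have "iso_in Q (\<eta> q) (?e q) q" if "q \<in> set (tgt Q \<psi> # src Q \<psi>)" for q
      using that r(2) obs[OF \<open>\<psi> \<in> mor Q\<close>] by auto
    moreover have "\<psi> \<in> hom Q (map (\<lambda>q. q) (src Q \<psi>)) (tgt Q \<psi>)"
      using that by (simp add: hom_def)
    ultimately obtain x where x: "x \<in> hom Q (map ?e (src Q \<psi>)) (?e (tgt Q \<psi>))"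
      "ocomp Q (\<eta> (tgt Q \<psi>)) [x] = ocomp Q \<psi> (map \<eta> (src Q \<psi>))"
      using F.target.square_fill_left[of "tgt Q \<psi>" "src Q \<psi>" \<eta> ?e "\<lambda>q. q" \<psi>] by blast
    moreover obtain f where "f \<in> ?H \<psi>" "x = on_mor F f"
      using x(1) unfolding bij_betw_imp_surj_on[OF homs[OF \<open>\<psi> \<in> mor Q\<close>], symmetric] by (rule imageE)
    ultimately show ?thesis by blast
  qed
  then obtain \<rho> where \<rho>: "\<And>\<psi>. \<psi> \<in> mor Q \<Longrightarrow> \<rho> \<psi> \<in> ?H \<psi>"
    "\<And>\<psi>. \<psi> \<in> mor Q \<Longrightarrow> ocomp Q (\<eta> (tgt Q \<psi>)) [on_mor F (\<rho> \<psi>)] = ocomp Q \<psi> (map \<eta> (src Q \<psi>))"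
    by metis
  \<comment> \<open>Each law for \<open>\<rho>\<close> below is an instance of this characterization.\<close>
  have uniq: "\<rho> \<psi> = f" if "\<psi> \<in> mor Q" "f \<in> ?H \<psi>"
    "ocomp Q (\<eta> (tgt Q \<psi>)) [on_mor F f] = ocomp Q \<psi> (map \<eta> (src Q \<psi>))" for \<psi> f
  proof -
    have "on_mor F (\<rho> \<psi>) = on_mor F f"
      using F.target.iso_cancel_left[OF r(2)[OF obs(2)[OF that(1)]]]
        bij_betwE[OF homs[OF that(1)]] \<rho>[OF that(1)] that(2,3) by metis
    then show ?thesis
      using bij_betw_imp_inj_on[OF homs[OF that(1)]] \<rho>(1)[OF that(1)] that(2) by (auto dest: inj_onD)
  qed
  have \<rho>_mor: "\<rho> \<psi> \<in> mor P" "src P (\<rho> \<psi>) = map r (src Q \<psi>)" "tgt P (\<rho> \<psi>) = r (tgt Q \<psi>)"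
    if "\<psi> \<in> mor Q" for \<psi>
    using \<rho>(1)[OF that] by (auto simp: hom_def)
  have sq: "square Q (\<eta> (tgt Q \<psi>)) (on_mor F (\<rho> \<psi>)) \<psi> (map \<eta> (src Q \<psi>))" if \<psi>: "\<psi> \<in> mor Q" for \<psi>
  proof -
    have "composable Q (\<eta> (tgt Q \<psi>)) [on_mor F (\<rho> \<psi>)]"
      by (rule F.target.composable_iso(1)[OF r(2)[OF obs(2)[OF \<psi>]] F.map_hom'[OF \<rho>(1)[OF \<psi>]]])
    moreover have "composable Q \<psi> (map \<eta> (src Q \<psi>))"
      by (rule F.target.composable_isos(1)[where a = ?e and b = "\<lambda>q. q" and c = "tgt Q \<psi>"])
        (use \<psi> r(2) obs[OF \<psi>] in \<open>auto simp: hom_def\<close>)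
    ultimately show ?thesis using \<rho>(2)[OF \<psi>] by (simp add: square_def)
  qed
  define R where "R = \<lparr>on_ob = r, on_mor = \<rho>\<rparr>"
  have R_simps: "on_ob R = r" "on_mor R = \<rho>" by (simp_all add: R_def)
  have R: "operad_functor Q P R"
  proof (unfold_locales, unfold R_simps)
    show "r q \<in> ob P" if "q \<in> ob Q" for q using r(1)[OF that] .
    show "\<rho> \<psi> \<in> ?H \<psi>" if "\<psi> \<in> mor Q" for \<psi> using \<rho>(1)[OF that] .
    show "\<rho> (oid Q q) = oid P (r q)" if q: "q \<in> ob Q" for q
    proof (rule uniq)
      have i: "oid Q q \<in> mor Q" "src Q (oid Q q) = [q]" "tgt Q (oid Q q) = q"
        using F.target.id_hom[OF q] by (auto simp: hom_def)
      then show "oid Q q \<in> mor Q" by simp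
      show "oid P (r q) \<in> ?H (oid Q q)" using F.source.id_hom[OF r(1)[OF q]] i by simp
      show "ocomp Q (\<eta> (tgt Q (oid Q q))) [on_mor F (oid P (r q))] =
          ocomp Q (oid Q q) (map \<eta> (src Q (oid Q q)))"
        using i F.map_id[OF r(1)[OF q]] F.target.iso_inD[OF r(2)[OF q]]
          F.target.unit_left[of "\<eta> q"] F.target.unit_right[of "\<eta> q"] by simp
    qed
    show "\<rho> (ocomp Q f gs) = ocomp P (\<rho> f) (map \<rho> gs)" if c: "composable Q f gs" for f gs
    proof (rule uniq)
      have m: "f \<in> mor Q" "set gs \<subseteq> mor Q" "src Q f = map (tgt Q) gs"
        using c by (auto simp: composable_def)
      note fg = F.target.comp_mor[OF c]
      show "ocomp Q f gs \<in> mor Q" by (rule fg)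
      have src_gs: "map (src P \<circ> \<rho>) gs = map (\<lambda>g. map r (src Q g)) gs"
        using m(2) \<rho>_mor by auto
      have c': "composable P (\<rho> f) (map \<rho> gs)"
        using m \<rho>_mor by (auto simp: composable_def)
      show "ocomp P (\<rho> f) (map \<rho> gs) \<in> ?H (ocomp Q f gs)"
        using F.source.comp_hom[OF c'] src_gs m \<rho>_mor fg
        by (simp add: map_concat o_def del: map_eq_conv)
      have "square Q (\<eta> (tgt Q f)) (ocomp Q (on_mor F (\<rho> f)) (map (\<lambda>g. on_mor F (\<rho> g)) gs))
          (ocomp Q f (map (\<lambda>g. g) gs)) (concat (map (\<lambda>g. map \<eta> (src Q g)) gs))"
        by (rule F.target.square_comp[where B = "\<lambda>g. \<eta> (tgt Q g)"])
          (use m c sq[of f] sq F.map_composable[OF c'] in \<open>auto simp: o_def\<close>)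
      then show "ocomp Q (\<eta> (tgt Q (ocomp Q f gs))) [on_mor F (ocomp P (\<rho> f) (map \<rho> gs))] =
          ocomp Q (ocomp Q f gs) (map \<eta> (src Q (ocomp Q f gs)))"
        using F.map_comp[OF c'] fg by (simp add: square_def map_concat o_def)
    qed
    show "\<rho> (act Q \<sigma> f) = act P \<sigma> (\<rho> f)" if f: "f \<in> mor Q" and \<sigma>: "\<sigma> permutes {..<length (src Q f)}" for \<sigma> f
    proof (rule uniq)
      have a: "act Q \<sigma> f \<in> mor Q" "src Q (act Q \<sigma> f) = permute_list \<sigma> (src Q f)" "tgt Q (act Q \<sigma> f) = tgt Q f"
        using F.target.act_hom[OF f \<sigma>] by (auto simp: hom_def)
      show "act Q \<sigma> f \<in> mor Q" by (rule a)
      show "act P \<sigma> (\<rho> f) \<in> ?H (act Q \<sigma> f)"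
        using F.source.act_hom[of "\<rho> f" \<sigma>] f \<sigma> \<rho>_mor[OF f] a by (simp add: permute_list_map)
      have "length (src Q b) = 1" if "b \<in> set (map \<eta> (src Q f))" for b
        using that obs(1)[OF f] F.target.iso_inD(2)[OF r(2)] by fastforce
      then have "square Q (\<eta> (tgt Q f)) (act Q \<sigma> (on_mor F (\<rho> f))) (act Q \<sigma> f) (permute_list \<sigma> (map \<eta> (src Q f)))"
        using sq[OF f] \<sigma> by (intro F.target.square_act) auto
      then show "ocomp Q (\<eta> (tgt Q (act Q \<sigma> f))) [on_mor F (act P \<sigma> (\<rho> f))] =
          ocomp Q (act Q \<sigma> f) (map \<eta> (src Q (act Q \<sigma> f)))"
        using F.map_act[of "\<rho> f" \<sigma>] \<rho>_mor[OF f] \<sigma> a by (simp add: square_def permute_list_map)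
    qed
  qed
  moreover have "functor_eq_on P (comp_functor R F) id_functor"
  proof -
    have "\<rho> (on_mor F f) = f" if f: "f \<in> mor P" for f
    proof (rule uniq)
      have o: "set (src P f) \<subseteq> ob P" "tgt P f \<in> ob P"
        using f F.source.src_ob F.source.tgt_ob by auto
      show "on_mor F f \<in> mor Q" by (rule F.map_mor(1)[OF f])
      have "map (r \<circ> on_ob F) (src P f) = src P f"
        using o rF by (intro map_idI) auto
      then show "f \<in> ?H (on_mor F f)"
        using F.map_mor[OF f] o rF f by (simp add: hom_def)
      have "map (\<eta> \<circ> on_ob F) (src P f) = map (oid Q \<circ> on_ob F) (src P f)"
        using o rF by auto
      then show "ocomp Q (\<eta> (tgt Q (on_mor F f))) [on_mor F f] =
          ocomp Q (on_mor F f) (map \<eta> (src Q (on_mor F f)))"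
        using F.map_mor[OF f] o rF F.target.unit_left[of "on_mor F f"] F.target.unit_right[of "on_mor F f"]
        by (simp del: map_eq_conv)
    qed
    then show ?thesis using rF by (simp add: functor_eq_on_def R_simps)
  qed
  moreover have "natural_iso Q Q (comp_functor F R) id_functor \<eta>"
    using r(2) sq by (simp add: natural_iso_def R_simps)
  ultimately have "deformation_retract P Q F R \<eta>"
    using F rF(2) by (simp add: deformation_retract_def)
  then show ?thesis by (rule that)
qed

text \<open>
  Instead of a universal property, the commutative square \<open>I H = J K\<close> has these features of a pushout
  along an injective map: \<open>I\<close> and \<open>J\<close> jointly generate \<open>W\<close>, and on objects \<open>I\<close> is injective and meets
  \<open>J\<close> only in the image of \<open>A\<close>.  In this form the lemma applies to a pushout in either order of its
  legs, hence to a trivial cofibration in either factor of the pushout-product.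

  The assumption \<open>TI\<close> says that the retractions \<open>S\<close> and \<open>T\<close> are compatible.  The quasi-inverse of \<open>\<Phi>\<close>
  is \<open>J T\<close>; the isomorphism \<open>\<theta> : J T \<Phi> \<cong> id\<close> is the identity on the image of \<open>J\<close> and \<open>I \<eta>\<close> on the
  image of \<open>I\<close>.
\<close>

lemma equivalence_of_pushout:
  assumes HS: "deformation_retract A X H S \<eta>" and K: "operad_functor A Y K"
    and I: "operad_functor X W I" and J: "operad_functor Y W J"
    and IH: "functor_eq_on A (comp_functor I H) (comp_functor J K)"
    and ob: "ob W \<subseteq> on_ob I ` ob X \<union> on_ob J ` ob Y"
    and gen: "mor W \<subseteq> generated W (on_mor I ` mor X \<union> on_mor J ` mor Y)"
    and inj: "inj_on (on_ob I) (ob X)"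
    and meet: "\<And>x y. x \<in> ob X \<Longrightarrow> y \<in> ob Y \<Longrightarrow> on_ob I x = on_ob J y \<Longrightarrow> x \<in> on_ob H ` ob A"
    and \<Phi>: "operad_functor W D \<Phi>"
    and LT: "deformation_retract Y D L T \<zeta>" and \<Phi>J: "functor_eq_on Y (comp_functor \<Phi> J) L"
    and TI: "functor_eq_on X (comp_functor T (comp_functor \<Phi> I)) (comp_functor K S)"
  shows "operadic_equivalence W D \<Phi>"
proof -
  interpret I: operad_functor X W I by fact
  interpret J: operad_functor Y W J by fact
  interpret \<Phi>: operad_functor W D \<Phi> by fact
  have S: "operad_functor X A S" and nat_\<eta>: "natural_iso X X (comp_functor H S) id_functor \<eta>"
    and \<eta>H: "\<And>a. a \<in> ob A \<Longrightarrow> \<eta> (on_ob H a) = oid X (on_ob H a)"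
    using HS by (auto simp: deformation_retract_def)
  have T: "operad_functor D Y T" and TL: "functor_eq_on Y (comp_functor T L) id_functor"
    and nat_\<zeta>: "natural_iso D D (comp_functor L T) id_functor \<zeta>"
    using LT by (auto simp: deformation_retract_def)
  interpret S: operad_functor X A S by fact
  interpret T: operad_functor D Y T by fact
  define \<Psi> where "\<Psi> = comp_functor J T"
  have \<Psi>: "operad_functor D W \<Psi>" unfolding \<Psi>_def by (rule operad_functor_comp[OF T J])
  have "functor_eq_on D (comp_functor L T) (comp_functor \<Phi> \<Psi>)"
    using \<Phi>J T.map_ob T.map_mor(1) by (simp add: functor_eq_on_def \<Psi>_def)
  then have \<zeta>: "natural_iso D D (comp_functor \<Phi> \<Psi>) id_functor \<zeta>"
    by (rule natural_iso_cong[OF nat_\<zeta>])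
  have \<Psi>J_ob: "on_ob \<Psi> (on_ob \<Phi> (on_ob J y)) = on_ob J y" if "y \<in> ob Y" for y
    using that \<Phi>J TL by (simp add: functor_eq_on_def \<Psi>_def)
  have \<Psi>J_mor: "on_mor \<Psi> (on_mor \<Phi> (on_mor J g)) = on_mor J g" if "g \<in> mor Y" for g
    using that \<Phi>J TL by (simp add: functor_eq_on_def \<Psi>_def)
  have \<Psi>I_ob: "on_ob \<Psi> (on_ob \<Phi> (on_ob I x)) = on_ob I (on_ob H (on_ob S x))" if "x \<in> ob X" for x
    using that TI IH S.map_ob by (simp add: functor_eq_on_def \<Psi>_def)
  have \<Psi>I_mor: "on_mor \<Psi> (on_mor \<Phi> (on_mor I f)) = on_mor I (on_mor H (on_mor S f))" if "f \<in> mor X" for f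
    using that TI IH S.map_mor(1) by (simp add: functor_eq_on_def \<Psi>_def)
  define \<theta> where "\<theta> w = (if w \<in> on_ob J ` ob Y then oid W w
      else on_mor I (\<eta> (inv_into (ob X) (on_ob I) w)))" for w
  have \<theta>J: "\<theta> (on_ob J y) = oid W (on_ob J y)" if "y \<in> ob Y" for y
    using that by (simp add: \<theta>_def)
  \<comment> \<open>The two descriptions of \<open>\<theta>\<close> agree on the overlap, as \<open>\<eta>\<close> is the identity on the image of \<open>H\<close>.\<close>
  have \<theta>I: "\<theta> (on_ob I x) = on_mor I (\<eta> x)" if x: "x \<in> ob X" for x
  proof (cases "on_ob I x \<in> on_ob J ` ob Y")
    case True
    then obtain a where "a \<in> ob A" "x = on_ob H a" using meet x by blast
    then show ?thesis using True \<eta>H I.map_id x by (simp add: \<theta>_def)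
  next
    case False
    then show ?thesis using inv_into_f_f[OF inj x] by (simp add: \<theta>_def)
  qed
  have "natural_iso W W (comp_functor \<Psi> \<Phi>) id_functor \<theta>"
  proof (rule natural_iso_on_generators[OF operad_functor_comp[OF \<Phi> \<Psi>]
        operad_functor_id[OF I.target.symmetric_operad_axioms] gen])
    show "iso_in W (\<theta> w) (on_ob (comp_functor \<Psi> \<Phi>) w) (on_ob id_functor w)" if "w \<in> ob W" for w
    proof -
      from that ob consider x where "x \<in> ob X" "w = on_ob I x" | y where "y \<in> ob Y" "w = on_ob J y"
        by blast
      then show ?thesis
      proof cases
        case 1
        have "iso_in X (\<eta> x) (on_ob H (on_ob S x)) x"
          using nat_\<eta> 1(1) by (simp add: natural_iso_def)
        from I.map_iso[OF this] show ?thesis using 1 by (simp add: \<theta>I \<Psi>I_ob)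
      next
        case 2
        then show ?thesis using I.target.iso_id J.map_ob by (simp add: \<theta>J \<Psi>J_ob)
      qed
    qed
    fix h assume "h \<in> on_mor I ` mor X \<union> on_mor J ` mor Y"
    then consider f where "f \<in> mor X" "h = on_mor I f" | g where "g \<in> mor Y" "h = on_mor J g"
      by blast
    then show "ocomp W (\<theta> (tgt W h)) [on_mor (comp_functor \<Psi> \<Phi>) h] =
        ocomp W (on_mor id_functor h) (map \<theta> (src W h))"
    proof cases
      case 1
      have sq: "square X (\<eta> (tgt X f)) (on_mor H (on_mor S f)) f (map \<eta> (src X f))"
        using nat_\<eta> 1(1) by (simp add: natural_iso_def)
      then have "ocomp W (on_mor I (\<eta> (tgt X f))) [on_mor I (on_mor H (on_mor S f))]
          = ocomp W (on_mor I f) (map (on_mor I) (map \<eta> (src X f)))"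
        using I.map_comp[of "\<eta> (tgt X f)" "[on_mor H (on_mor S f)]"] I.map_comp[of f "map \<eta> (src X f)"]
        by (simp add: square_def)
      moreover have "map (on_mor I) (map \<eta> (src X f)) = map \<theta> (map (on_ob I) (src X f))"
        using I.source.src_ob[OF 1(1)] \<theta>I by auto
      ultimately show ?thesis
        using 1 I.map_mor[OF 1(1)] \<theta>I[OF I.source.tgt_ob[OF 1(1)]] \<Psi>I_mor by (simp del: map_map)
    next
      case 2
      have "map \<theta> (map (on_ob J) (src Y g)) = map (oid W) (src W h)"
        using 2 J.map_mor[OF 2(1)] J.source.src_ob[OF 2(1)] \<theta>J by auto
      then show ?thesis
        using 2 J.map_mor[OF 2(1)] \<theta>J[OF J.source.tgt_ob[OF 2(1)]] \<Psi>J_mor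
          I.target.unit_left[of h] I.target.unit_right[of h] by (simp del: map_map map_eq_conv)
    qed
  qed
  then show ?thesis by (rule operadic_equivalenceI[OF \<Phi> \<Psi> _ \<zeta>])
qed


section \<open>The tensor product of functors\<close>

text \<open>The functors \<open>- \<otimes> q : P \<rightarrow> P \<otimes> Q\<close> and \<open>p \<otimes> - : Q \<rightarrow> P \<otimes> Q\<close>.\<close>

definition bv_left :: "('p, 'pm) operad \<Rightarrow> ('q, 'qm) operad \<Rightarrow> 'q
    \<Rightarrow> ('p, 'pm, 'p \<times> 'q, ('p, 'pm, 'q, 'qm) bv_mor) ofunctor" where
  "bv_left P Q q = \<lparr>on_ob = (\<lambda>p. (p, q)),
     on_mor = (\<lambda>\<psi>. term_class (bv_presentation P Q) (Gen (LeftGen \<psi> q)))\<rparr>"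

definition bv_right :: "('p, 'pm) operad \<Rightarrow> ('q, 'qm) operad \<Rightarrow> 'p
    \<Rightarrow> ('q, 'qm, 'p \<times> 'q, ('p, 'pm, 'q, 'qm) bv_mor) ofunctor" where
  "bv_right P Q p = \<lparr>on_ob = (\<lambda>q. (p, q)),
     on_mor = (\<lambda>\<phi>. term_class (bv_presentation P Q) (Gen (RightGen p \<phi>)))\<rparr>"

lemma bv_slice_ob [simp]: "on_ob (bv_left P Q q) p = (p, q)" "on_ob (bv_right P Q p) q = (p, q)"
  by (simp_all add: bv_left_def bv_right_def)

lemma ob_bv_tensor [simp]: "ob (P \<otimes>\<^sub>B\<^sub>V Q) = ob P \<times> ob Q"
  by (simp add: bv_tensor_def presented_operad_def bv_presentation_def)

context
  fixes P :: "('p, 'pm) operad" and Q :: "('q, 'qm) operad"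
  assumes P: "symmetric_operad P" and Q: "symmetric_operad Q"
begin

interpretation X: operad_presentation "bv_presentation P Q" by (rule bv_presentation[OF P Q])

lemma bv_left_functor: "q \<in> ob Q \<Longrightarrow> operad_functor P (P \<otimes>\<^sub>B\<^sub>V Q) (bv_left P Q q)"
  unfolding bv_tensor_def bv_left_def
  by (rule functor_of_relations[OF P X.operad_presentation_axioms]) (auto simp: bv_presentation_def)

lemma bv_right_functor: "p \<in> ob P \<Longrightarrow> operad_functor Q (P \<otimes>\<^sub>B\<^sub>V Q) (bv_right P Q p)"
  unfolding bv_tensor_def bv_right_def
  by (rule functor_of_relations[OF Q X.operad_presentation_axioms]) (auto simp: bv_presentation_def)

lemma bv_interchange:
  assumes "\<psi> \<in> mor P" "\<phi> \<in> mor Q"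
  shows "ocomp (P \<otimes>\<^sub>B\<^sub>V Q) (on_mor (bv_left P Q (tgt Q \<phi>)) \<psi>) (map (\<lambda>p. on_mor (bv_right P Q p) \<phi>) (src P \<psi>))
    = act (P \<otimes>\<^sub>B\<^sub>V Q) (interchange_perm (length (src Q \<phi>)) (length (src P \<psi>)))
       (ocomp (P \<otimes>\<^sub>B\<^sub>V Q) (on_mor (bv_right P Q (tgt P \<psi>)) \<phi>) (map (\<lambda>q. on_mor (bv_left P Q q) \<psi>) (src Q \<phi>)))"
proof -
  let ?s = "Comp (Gen (LeftGen \<psi> (tgt Q \<phi>))) (map (\<lambda>p. Gen (RightGen p \<phi>)) (src P \<psi>))"
  let ?u = "Comp (Gen (RightGen (tgt P \<psi>) \<phi>)) (map (\<lambda>q. Gen (LeftGen \<psi> q)) (src Q \<phi>))"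
  let ?t = "Act (interchange_perm (length (src Q \<phi>)) (length (src P \<psi>))) ?u"
  have "(?s, ?t) \<in> interchange_relations P Q"
    unfolding interchange_relations_def using assms by blast
  then have rel: "(?s, ?t) \<in> prel (bv_presentation P Q)" by (simp add: bv_presentation_def)
  then have w: "wf_term (bv_presentation P Q) ?s" "wf_term (bv_presentation P Q) ?t"
    using X.rel_wf by blast+
  then have "X.cls ?s = X.cls ?t" using teq_rel[OF rel] X.cls_eq_iff by blast
  then show ?thesis
    using X.ocomp_cls[OF w(1)] X.ocomp_cls[of "Gen (RightGen (tgt P \<psi>) \<phi>)"
        "map (\<lambda>q. Gen (LeftGen \<psi> q)) (src Q \<phi>)"] X.act_cls[OF w(2)] w(2)
    by (simp add: bv_tensor_def bv_left_def bv_right_def o_def del: wf_term.simps(1,3))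
qed

lemma bv_generated:
  "mor (P \<otimes>\<^sub>B\<^sub>V Q) \<subseteq> generated (P \<otimes>\<^sub>B\<^sub>V Q)
     ({on_mor (bv_left P Q q) \<psi> | \<psi> q. \<psi> \<in> mor P \<and> q \<in> ob Q} \<union>
      {on_mor (bv_right P Q p) \<phi> | p \<phi>. p \<in> ob P \<and> \<phi> \<in> mor Q})"
proof -
  have "X.cls ` Gen ` pgen (bv_presentation P Q) =
     {on_mor (bv_left P Q q) \<psi> | \<psi> q. \<psi> \<in> mor P \<and> q \<in> ob Q} \<union>
      {on_mor (bv_right P Q p) \<phi> | p \<phi>. p \<in> ob P \<and> \<phi> \<in> mor Q}"
    by (auto simp: bv_presentation_def bv_left_def bv_right_def)
  then show ?thesis using X.presented_generated by (simp add: bv_tensor_def)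
qed

text \<open>
  The universal property of the tensor product: functors out of \<open>P \<otimes> Q\<close> are families of functors in
  each variable which satisfy the interchange law.
\<close>

lemma bv_tensor_model:
  assumes D: "symmetric_operad D"
    and L: "\<And>q. q \<in> ob Q \<Longrightarrow> operad_functor P D \<lparr>on_ob = (\<lambda>p. f (p, q)), on_mor = (\<lambda>\<psi>. \<gamma> (LeftGen \<psi> q))\<rparr>"
    and R: "\<And>p. p \<in> ob P \<Longrightarrow> operad_functor Q D \<lparr>on_ob = (\<lambda>q. f (p, q)), on_mor = (\<lambda>\<phi>. \<gamma> (RightGen p \<phi>))\<rparr>"
    and int: "\<And>\<psi> \<phi>. \<psi> \<in> mor P \<Longrightarrow> \<phi> \<in> mor Q \<Longrightarrow>
      ocomp D (\<gamma> (LeftGen \<psi> (tgt Q \<phi>))) (map (\<lambda>p. \<gamma> (RightGen p \<phi>)) (src P \<psi>)) =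
      act D (interchange_perm (length (src Q \<phi>)) (length (src P \<psi>)))
       (ocomp D (\<gamma> (RightGen (tgt P \<psi>) \<phi>)) (map (\<lambda>q. \<gamma> (LeftGen \<psi> q)) (src Q \<phi>)))"
  shows "presentation_model (bv_presentation P Q) D f \<gamma>"
proof -
  interpret D: symmetric_operad D by fact
  let ?L = "\<lambda>q. \<lparr>on_ob = (\<lambda>p. f (p, q)), on_mor = (\<lambda>\<psi>. \<gamma> (LeftGen \<psi> q))\<rparr>"
  let ?R = "\<lambda>p. \<lparr>on_ob = (\<lambda>q. f (p, q)), on_mor = (\<lambda>\<phi>. \<gamma> (RightGen p \<phi>))\<rparr>"
  show ?thesis
  proof
    show "f x \<in> ob D" if "x \<in> pob (bv_presentation P Q)" for x
      using that operad_functor.map_ob[OF L] by (auto simp: bv_presentation_def)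
    show "\<gamma> g \<in> hom D (map f (gsrc (bv_presentation P Q) g)) (f (gtgt (bv_presentation P Q) g))"
      if "g \<in> pgen (bv_presentation P Q)" for g
      using that operad_functor.map_hom[OF L] operad_functor.map_hom[OF R]
      by (auto simp: bv_presentation_def o_def)
    fix s t assume "(s, t) \<in> prel (bv_presentation P Q)"
    then consider
        q where "q \<in> ob Q" "(s, t) \<in> functor_relations P (\<lambda>p. (p, q)) (\<lambda>\<psi>. LeftGen \<psi> q)"
      | p where "p \<in> ob P" "(s, t) \<in> functor_relations Q (\<lambda>q. (p, q)) (\<lambda>\<phi>. RightGen p \<phi>)"
      | "(s, t) \<in> interchange_relations P Q"
      unfolding bv_presentation_def by auto
    then show "eval_term D f \<gamma> s = eval_term D f \<gamma> t"
    proof cases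
      case 1
      interpret L: operad_functor P D "?L q" using L[OF 1(1)] .
      show ?thesis using 1(2) L.map_id L.map_comp L.map_act
        by (auto simp: functor_relations_def o_def)
    next
      case 2
      interpret R: operad_functor Q D "?R p" using R[OF 2(1)] .
      show ?thesis using 2(2) R.map_id R.map_comp R.map_act
        by (auto simp: functor_relations_def o_def)
    next
      case 3
      then show ?thesis using int by (auto simp: interchange_relations_def o_def)
    qed
  qed
qed

end

lemma bv_tensor_functor_ob [simp]: "on_ob (bv_tensor_functor F G Q Q') x = (on_ob F (fst x), on_ob G (snd x))"
  by (cases x) (simp add: bv_tensor_functor_def induced_functor_def)

text \<open>
  The functor \<open>F \<otimes> G\<close> is defined on a class of terms by evaluating an arbitrary representative; that
  this gives the expected value on the class of a generator uses that evaluation respects all the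
  relations.
\<close>

lemma bv_tensor_functor_generators:
  assumes F: "operad_functor P Q F" and G: "operad_functor P' Q' G"
  shows "\<psi> \<in> mor P \<Longrightarrow> p' \<in> ob P' \<Longrightarrow>
      on_mor (bv_tensor_functor F G Q Q') (on_mor (bv_left P P' p') \<psi>) = on_mor (bv_left Q Q' (on_ob G p')) (on_mor F \<psi>)"
    and "p \<in> ob P \<Longrightarrow> \<phi> \<in> mor P' \<Longrightarrow>
      on_mor (bv_tensor_functor F G Q Q') (on_mor (bv_right P P' p) \<phi>) = on_mor (bv_right Q Q' (on_ob F p)) (on_mor G \<phi>)"
proof -
  interpret F: operad_functor P Q F by fact
  interpret G: operad_functor P' Q' G by fact
  note opds = F.source.symmetric_operad_axioms G.source.symmetric_operad_axioms
    F.target.symmetric_operad_axioms G.target.symmetric_operad_axioms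
  let ?\<gamma> = "\<lambda>g. term_class (bv_presentation Q Q') (Gen (case g of
        LeftGen \<psi> p' \<Rightarrow> LeftGen (on_mor F \<psi>) (on_ob G p')
      | RightGen p \<phi> \<Rightarrow> RightGen (on_ob F p) (on_mor G \<phi>)))"
  have model: "presentation_model (bv_presentation P P') (Q \<otimes>\<^sub>B\<^sub>V Q') (map_prod (on_ob F) (on_ob G)) ?\<gamma>"
  proof (rule bv_tensor_model[OF opds(1,2) bv_tensor_operad[OF opds(3,4)]])
    fix p' assume "p' \<in> ob P'"
    from operad_functor_comp[OF F bv_left_functor[OF opds(3,4) G.map_ob[OF this]]]
    show "operad_functor P (Q \<otimes>\<^sub>B\<^sub>V Q')
        \<lparr>on_ob = \<lambda>p. map_prod (on_ob F) (on_ob G) (p, p'), on_mor = \<lambda>\<psi>. ?\<gamma> (LeftGen \<psi> p')\<rparr>"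
      by (simp add: comp_functor_def bv_left_def o_def)
  next
    fix p assume "p \<in> ob P"
    from operad_functor_comp[OF G bv_right_functor[OF opds(3,4) F.map_ob[OF this]]]
    show "operad_functor P' (Q \<otimes>\<^sub>B\<^sub>V Q')
        \<lparr>on_ob = \<lambda>q. map_prod (on_ob F) (on_ob G) (p, q), on_mor = \<lambda>\<phi>. ?\<gamma> (RightGen p \<phi>)\<rparr>"
      by (simp add: comp_functor_def bv_right_def o_def)
  next
    fix \<psi> \<phi> assume "\<psi> \<in> mor P" "\<phi> \<in> mor P'"
    then show "ocomp (Q \<otimes>\<^sub>B\<^sub>V Q') (?\<gamma> (LeftGen \<psi> (tgt P' \<phi>))) (map (\<lambda>p. ?\<gamma> (RightGen p \<phi>)) (src P \<psi>)) =
      act (Q \<otimes>\<^sub>B\<^sub>V Q') (interchange_perm (length (src P' \<phi>)) (length (src P \<psi>)))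
       (ocomp (Q \<otimes>\<^sub>B\<^sub>V Q') (?\<gamma> (RightGen (tgt P \<psi>) \<phi>)) (map (\<lambda>q. ?\<gamma> (LeftGen \<psi> q)) (src P' \<phi>)))"
      using bv_interchange[OF opds(3,4) F.map_mor(1) G.map_mor(1), of \<psi> \<phi>]
      by (simp add: F.map_mor G.map_mor bv_left_def bv_right_def o_def)
  qed
  have gen: "on_mor (bv_tensor_functor F G Q Q') (term_class (bv_presentation P P') (Gen g)) = ?\<gamma> g"
    if "g \<in> pgen (bv_presentation P P')" for g
    unfolding bv_tensor_functor_def
    using presentation_model.on_mor_induced[OF model, of "Gen g"] that by simp
  show "on_mor (bv_tensor_functor F G Q Q') (on_mor (bv_left P P' p') \<psi>) = on_mor (bv_left Q Q' (on_ob G p')) (on_mor F \<psi>)"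
    if "\<psi> \<in> mor P" "p' \<in> ob P'"
    using gen[of "LeftGen \<psi> p'"] that by (simp add: bv_presentation_def[of P P', THEN arg_cong[where f = pgen]] bv_left_def)
  show "on_mor (bv_tensor_functor F G Q Q') (on_mor (bv_right P P' p) \<phi>) = on_mor (bv_right Q Q' (on_ob F p)) (on_mor G \<phi>)"
    if "p \<in> ob P" "\<phi> \<in> mor P'"
    using gen[of "RightGen p \<phi>"] that by (simp add: bv_presentation_def[of P P', THEN arg_cong[where f = pgen]] bv_right_def)
qed

lemma bv_functor_eqI:
  assumes "symmetric_operad P" "symmetric_operad Q"
    and "operad_functor (P \<otimes>\<^sub>B\<^sub>V Q) D E" "operad_functor (P \<otimes>\<^sub>B\<^sub>V Q) D E'"
    and "\<And>p q. p \<in> ob P \<Longrightarrow> q \<in> ob Q \<Longrightarrow> on_ob E (p, q) = on_ob E' (p, q)"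
    and "\<And>\<psi> q. \<psi> \<in> mor P \<Longrightarrow> q \<in> ob Q \<Longrightarrow> on_mor E (on_mor (bv_left P Q q) \<psi>) = on_mor E' (on_mor (bv_left P Q q) \<psi>)"
    and "\<And>p \<phi>. p \<in> ob P \<Longrightarrow> \<phi> \<in> mor Q \<Longrightarrow> on_mor E (on_mor (bv_right P Q p) \<phi>) = on_mor E' (on_mor (bv_right P Q p) \<phi>)"
  shows "functor_eq_on (P \<otimes>\<^sub>B\<^sub>V Q) E E'"
  by (rule functor_eq_on_generators[OF assms(3,4) bv_generated[OF assms(1,2)]])
    (use assms(5-7) in auto)

lemma bv_tensor_functor_comp:
  assumes F: "operad_functor P Q F" and F': "operad_functor Q R F'"
    and G: "operad_functor P' Q' G" and G': "operad_functor Q' R' G'"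
  shows "functor_eq_on (P \<otimes>\<^sub>B\<^sub>V P') (comp_functor (bv_tensor_functor F' G' R R') (bv_tensor_functor F G Q Q'))
     (bv_tensor_functor (comp_functor F' F) (comp_functor G' G) R R')"
proof -
  interpret F: operad_functor P Q F by fact
  interpret G: operad_functor P' Q' G by fact
  note comps = operad_functor_comp[OF F F'] operad_functor_comp[OF G G']
  show ?thesis
    by (rule bv_functor_eqI[OF F.source.symmetric_operad_axioms G.source.symmetric_operad_axioms
          operad_functor_comp[OF bv_tensor_functor[OF F G] bv_tensor_functor[OF F' G']]
          bv_tensor_functor[OF comps]])
      (simp_all add: bv_tensor_functor_generators[OF F G] bv_tensor_functor_generators[OF F' G']
        bv_tensor_functor_generators[OF comps] F.map_ob F.map_mor G.map_ob G.map_mor)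
qed

lemma bv_tensor_functor_eq_id:
  assumes P: "symmetric_operad P" and Q: "symmetric_operad Q"
    and F: "operad_functor P P F" "functor_eq_on P F id_functor"
    and G: "operad_functor Q Q G" "functor_eq_on Q G id_functor"
  shows "functor_eq_on (P \<otimes>\<^sub>B\<^sub>V Q) (bv_tensor_functor F G P Q) id_functor"
  by (rule bv_functor_eqI[OF P Q bv_tensor_functor[OF F(1) G(1)] operad_functor_id[OF bv_tensor_operad[OF P Q]]])
    (use F(2) G(2) in \<open>simp_all add: bv_tensor_functor_generators[OF F(1) G(1)] functor_eq_on_def\<close>)

lemma interchange_perm_unary: "interchange_perm m 1 = id" "interchange_perm 1 n = id"
  by (auto simp: interchange_perm_def fun_eq_iff)

text \<open>
  The isomorphism is \<open>\<eta> \<otimes> C\<close>.  On a generator \<open>\<psi> \<otimes> c\<close> its naturality is that of \<open>\<eta>\<close>; on a generator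
  \<open>q \<otimes> \<phi>\<close> it is the interchange of \<open>\<eta> q\<close> with \<open>\<phi>\<close>, whose permutation is trivial as \<open>\<eta> q\<close> is unary.
\<close>

lemma deformation_retract_tensor_right:
  assumes ret: "deformation_retract P Q F R \<eta>" and C: "symmetric_operad C"
  shows "deformation_retract (P \<otimes>\<^sub>B\<^sub>V C) (Q \<otimes>\<^sub>B\<^sub>V C) (bv_tensor_functor F id_functor Q C)
    (bv_tensor_functor R id_functor P C) (\<lambda>(q, c). on_mor (bv_left Q C c) (\<eta> q))"
proof -
  have F: "operad_functor P Q F" and R: "operad_functor Q P R"
    and RF: "functor_eq_on P (comp_functor R F) id_functor"
    and nat: "natural_iso Q Q (comp_functor F R) id_functor \<eta>"
    and \<eta>F: "\<And>p. p \<in> ob P \<Longrightarrow> \<eta> (on_ob F p) = oid Q (on_ob F p)"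
    using ret by (auto simp: deformation_retract_def)
  interpret F: operad_functor P Q F by fact
  interpret R: operad_functor Q P R by fact
  interpret C: symmetric_operad C by fact
  note P = F.source.symmetric_operad_axioms and Q = F.target.symmetric_operad_axioms
  note idC = operad_functor_id[OF C]
  let ?T = "Q \<otimes>\<^sub>B\<^sub>V C"
  interpret T: symmetric_operad ?T by (rule bv_tensor_operad[OF Q C])
  let ?F = "bv_tensor_functor F id_functor Q C" and ?R = "bv_tensor_functor R id_functor P C"
  let ?\<eta> = "\<lambda>(q, c). on_mor (bv_left Q C c) (\<eta> q)"
  have F': "operad_functor (P \<otimes>\<^sub>B\<^sub>V C) ?T ?F" and R': "operad_functor ?T (P \<otimes>\<^sub>B\<^sub>V C) ?R"
    by (rule bv_tensor_functor[OF F idC], rule bv_tensor_functor[OF R idC])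
  have \<eta>: "iso_in Q (\<eta> q) (on_ob F (on_ob R q)) q" if "q \<in> ob Q" for q
    using nat that by (simp add: natural_iso_def)
  have "functor_eq_on (P \<otimes>\<^sub>B\<^sub>V C) (comp_functor ?R ?F) id_functor"
    using functor_eq_on_trans[OF bv_tensor_functor_comp[OF F R idC idC]
        bv_tensor_functor_eq_id[OF P C operad_functor_comp[OF F R] RF]] idC
    by (simp add: functor_eq_on_refl)
  moreover have "natural_iso ?T ?T (comp_functor ?F ?R) id_functor ?\<eta>"
  proof (rule natural_iso_on_generators[OF operad_functor_comp[OF R' F']
        operad_functor_id[OF T.symmetric_operad_axioms] bv_generated[OF Q C]])
    show "iso_in ?T (?\<eta> x) (on_ob (comp_functor ?F ?R) x) (on_ob id_functor x)" if "x \<in> ob ?T" for x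
      using that operad_functor.map_iso[OF bv_left_functor[OF Q C] \<eta>] by auto
    fix h assume "h \<in> {on_mor (bv_left Q C c) \<psi> | \<psi> c. \<psi> \<in> mor Q \<and> c \<in> ob C} \<union>
        {on_mor (bv_right Q C q) \<phi> | q \<phi>. q \<in> ob Q \<and> \<phi> \<in> mor C}"
    then consider \<psi> c where "\<psi> \<in> mor Q" "c \<in> ob C" "h = on_mor (bv_left Q C c) \<psi>"
      | q \<phi> where "q \<in> ob Q" "\<phi> \<in> mor C" "h = on_mor (bv_right Q C q) \<phi>"
      by blast
    then show "ocomp ?T (?\<eta> (tgt ?T h)) [on_mor (comp_functor ?F ?R) h] =
        ocomp ?T (on_mor id_functor h) (map ?\<eta> (src ?T h))"
    proof cases
      case 1
      interpret L: operad_functor Q ?T "bv_left Q C c" by (rule bv_left_functor[OF Q C 1(2)])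
      have "square Q (\<eta> (tgt Q \<psi>)) (on_mor F (on_mor R \<psi>)) \<psi> (map \<eta> (src Q \<psi>))"
        using nat 1(1) by (simp add: natural_iso_def)
      then have "ocomp ?T (on_mor (bv_left Q C c) (\<eta> (tgt Q \<psi>))) [on_mor (bv_left Q C c) (on_mor F (on_mor R \<psi>))]
          = ocomp ?T h (map (on_mor (bv_left Q C c)) (map \<eta> (src Q \<psi>)))"
        using L.map_comp[of "\<eta> (tgt Q \<psi>)" "[on_mor F (on_mor R \<psi>)]"] L.map_comp[of \<psi> "map \<eta> (src Q \<psi>)"] 1(3)
        by (simp add: square_def)
      moreover have "on_mor ?F (on_mor ?R h) = on_mor (bv_left Q C c) (on_mor F (on_mor R \<psi>))"
        using 1 R.map_mor(1) by (simp add: bv_tensor_functor_generators[OF R idC] bv_tensor_functor_generators[OF F idC])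
      ultimately show ?thesis using 1 L.map_mor[OF 1(1)] by (simp add: o_def)
    next
      case 2
      interpret B: operad_functor C ?T "bv_right Q C q" by (rule bv_right_functor[OF Q C 2(1)])
      note \<eta>q = F.target.iso_inD[OF \<eta>[OF 2(1)]]
      let ?u = "ocomp ?T h (map (\<lambda>c. on_mor (bv_left Q C c) (\<eta> q)) (src C \<phi>))"
      have "iso_in ?T (on_mor (bv_left Q C c) (\<eta> q)) (on_ob F (on_ob R q), c) (q, c)" if "c \<in> ob C" for c
        using operad_functor.map_iso[OF bv_left_functor[OF Q C that] \<eta>[OF 2(1)]] by simp
      then have "?u \<in> hom ?T (map (\<lambda>c. (on_ob F (on_ob R q), c)) (src C \<phi>)) (q, tgt C \<phi>)"
        using B.map_hom[OF 2(2)] C.src_ob[OF 2(2)] 2(3)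
        by (intro T.composable_isos(2)[where b = "\<lambda>c. (q, c)"]) (auto simp: bv_right_def)
      then have "act ?T id ?u = ?u" by (intro T.act_id) (simp add: hom_def)
      moreover have "on_mor ?F (on_mor ?R h) = on_mor (bv_right Q C (on_ob F (on_ob R q))) \<phi>"
        using 2 R.map_ob by (simp add: bv_tensor_functor_generators[OF R idC] bv_tensor_functor_generators[OF F idC])
      ultimately show ?thesis
        using bv_interchange[OF Q C \<eta>q(1) 2(2)] \<eta>q 2 B.map_mor[OF 2(2)]
        by (simp add: interchange_perm_unary[simplified] o_def)
    qed
  qed
  moreover have "?\<eta> (on_ob ?F x) = oid ?T (on_ob ?F x)" if "x \<in> ob (P \<otimes>\<^sub>B\<^sub>V C)" for x
    using that operad_functor.map_id[OF bv_left_functor[OF Q C]] F.map_ob \<eta>F by auto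
  ultimately show ?thesis using F' R' by (simp add: deformation_retract_def)
qed

text \<open>
  The mirror image of the preceding lemma: now the generators \<open>c \<otimes> \<phi>\<close> use naturality of \<open>\<eta>\<close>, and the
  generators \<open>\<psi> \<otimes> q\<close> the interchange of \<open>\<psi>\<close> with the unary \<open>\<eta> q\<close>.
\<close>

lemma deformation_retract_tensor_left:
  assumes ret: "deformation_retract P Q F R \<eta>" and C: "symmetric_operad C"
  shows "deformation_retract (C \<otimes>\<^sub>B\<^sub>V P) (C \<otimes>\<^sub>B\<^sub>V Q) (bv_tensor_functor id_functor F C Q)
    (bv_tensor_functor id_functor R C P) (\<lambda>(c, q). on_mor (bv_right C Q c) (\<eta> q))"
proof -
  have F: "operad_functor P Q F" and R: "operad_functor Q P R"
    and RF: "functor_eq_on P (comp_functor R F) id_functor"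
    and nat: "natural_iso Q Q (comp_functor F R) id_functor \<eta>"
    and \<eta>F: "\<And>p. p \<in> ob P \<Longrightarrow> \<eta> (on_ob F p) = oid Q (on_ob F p)"
    using ret by (auto simp: deformation_retract_def)
  interpret F: operad_functor P Q F by fact
  interpret R: operad_functor Q P R by fact
  interpret C: symmetric_operad C by fact
  note P = F.source.symmetric_operad_axioms and Q = F.target.symmetric_operad_axioms
  note idC = operad_functor_id[OF C]
  let ?T = "C \<otimes>\<^sub>B\<^sub>V Q"
  interpret T: symmetric_operad ?T by (rule bv_tensor_operad[OF C Q])
  let ?F = "bv_tensor_functor id_functor F C Q" and ?R = "bv_tensor_functor id_functor R C P"
  let ?\<eta> = "\<lambda>(c, q). on_mor (bv_right C Q c) (\<eta> q)"
  have F': "operad_functor (C \<otimes>\<^sub>B\<^sub>V P) ?T ?F" and R': "operad_functor ?T (C \<otimes>\<^sub>B\<^sub>V P) ?R"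
    by (rule bv_tensor_functor[OF idC F], rule bv_tensor_functor[OF idC R])
  have \<eta>: "iso_in Q (\<eta> q) (on_ob F (on_ob R q)) q" if "q \<in> ob Q" for q
    using nat that by (simp add: natural_iso_def)
  have "functor_eq_on (C \<otimes>\<^sub>B\<^sub>V P) (comp_functor ?R ?F) id_functor"
    using functor_eq_on_trans[OF bv_tensor_functor_comp[OF idC idC F R]
        bv_tensor_functor_eq_id[OF C P _ _ operad_functor_comp[OF F R] RF]] idC
    by (simp add: functor_eq_on_refl)
  moreover have "natural_iso ?T ?T (comp_functor ?F ?R) id_functor ?\<eta>"
  proof (rule natural_iso_on_generators[OF operad_functor_comp[OF R' F']
        operad_functor_id[OF T.symmetric_operad_axioms] bv_generated[OF C Q]])
    show "iso_in ?T (?\<eta> x) (on_ob (comp_functor ?F ?R) x) (on_ob id_functor x)" if "x \<in> ob ?T" for x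
      using that operad_functor.map_iso[OF bv_right_functor[OF C Q] \<eta>] by auto
    fix h assume "h \<in> {on_mor (bv_left C Q q) \<psi> | \<psi> q. \<psi> \<in> mor C \<and> q \<in> ob Q} \<union>
        {on_mor (bv_right C Q c) \<phi> | c \<phi>. c \<in> ob C \<and> \<phi> \<in> mor Q}"
    then consider \<psi> q where "\<psi> \<in> mor C" "q \<in> ob Q" "h = on_mor (bv_left C Q q) \<psi>"
      | c \<phi> where "c \<in> ob C" "\<phi> \<in> mor Q" "h = on_mor (bv_right C Q c) \<phi>"
      by blast
    then show "ocomp ?T (?\<eta> (tgt ?T h)) [on_mor (comp_functor ?F ?R) h] =
        ocomp ?T (on_mor id_functor h) (map ?\<eta> (src ?T h))"
    proof cases
      case 1
      interpret L: operad_functor C ?T "bv_left C Q (on_ob F (on_ob R q))"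
        by (rule bv_left_functor[OF C Q F.map_ob[OF R.map_ob[OF 1(2)]]])
      interpret L': operad_functor C ?T "bv_left C Q q" by (rule bv_left_functor[OF C Q 1(2)])
      note \<eta>q = F.target.iso_inD[OF \<eta>[OF 1(2)]]
      let ?u = "ocomp ?T (on_mor (bv_right C Q (tgt C \<psi>)) (\<eta> q)) [on_mor (bv_left C Q (on_ob F (on_ob R q))) \<psi>]"
      have "iso_in ?T (on_mor (bv_right C Q (tgt C \<psi>)) (\<eta> q)) (tgt C \<psi>, on_ob F (on_ob R q)) (tgt C \<psi>, q)"
        using operad_functor.map_iso[OF bv_right_functor[OF C Q C.tgt_ob[OF 1(1)]] \<eta>[OF 1(2)]] by simp
      from T.composable_iso(2)[OF this] L.map_hom[OF 1(1)]
      have "?u \<in> mor ?T" by (simp add: hom_def)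
      then have "act ?T id ?u = ?u" by (rule T.act_id)
      moreover have "on_mor ?F (on_mor ?R h) = on_mor (bv_left C Q (on_ob F (on_ob R q))) \<psi>"
        using 1 R.map_ob by (simp add: bv_tensor_functor_generators[OF idC R] bv_tensor_functor_generators[OF idC F])
      ultimately show ?thesis
        using bv_interchange[OF C Q 1(1) \<eta>q(1)] \<eta>q 1 L'.map_mor[OF 1(1)]
        by (simp add: interchange_perm_unary[simplified] o_def)
    next
      case 2
      interpret B: operad_functor Q ?T "bv_right C Q c" by (rule bv_right_functor[OF C Q 2(1)])
      have "square Q (\<eta> (tgt Q \<phi>)) (on_mor F (on_mor R \<phi>)) \<phi> (map \<eta> (src Q \<phi>))"
        using nat 2(2) by (simp add: natural_iso_def)
      then have "ocomp ?T (on_mor (bv_right C Q c) (\<eta> (tgt Q \<phi>))) [on_mor (bv_right C Q c) (on_mor F (on_mor R \<phi>))]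
          = ocomp ?T h (map (on_mor (bv_right C Q c)) (map \<eta> (src Q \<phi>)))"
        using B.map_comp[of "\<eta> (tgt Q \<phi>)" "[on_mor F (on_mor R \<phi>)]"] B.map_comp[of \<phi> "map \<eta> (src Q \<phi>)"] 2(3)
        by (simp add: square_def)
      moreover have "on_mor ?F (on_mor ?R h) = on_mor (bv_right C Q c) (on_mor F (on_mor R \<phi>))"
        using 2 R.map_mor(1) by (simp add: bv_tensor_functor_generators[OF idC R] bv_tensor_functor_generators[OF idC F])
      ultimately show ?thesis using 2 B.map_mor[OF 2(2)] by (simp add: o_def)
    qed
  qed
  moreover have "?\<eta> (on_ob ?F x) = oid ?T (on_ob ?F x)" if "x \<in> ob (C \<otimes>\<^sub>B\<^sub>V P)" for x
    using that operad_functor.map_id[OF bv_right_functor[OF C Q]] F.map_ob \<eta>F by auto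
  ultimately show ?thesis using F' R' by (simp add: deformation_retract_def)
qed


section \<open>The pushout-product\<close>

lemma pushout_ob:
  "ob (pushout A P Q F G) = on_ob (pushout_inl A P Q F G) ` ob P \<union> on_ob (pushout_inr A P Q F G) ` ob Q"
  by (auto simp: pushout_def presented_operad_def pushout_presentation_def pushout_inl_def pushout_inr_def)

lemma pushout_generated:
  assumes F: "operad_functor A P F" and G: "operad_functor A Q G"
  shows "mor (pushout A P Q F G) \<subseteq> generated (pushout A P Q F G)
    (on_mor (pushout_inl A P Q F G) ` mor P \<union> on_mor (pushout_inr A P Q F G) ` mor Q)"
proof -
  interpret F: operad_functor A P F by fact
  interpret G: operad_functor A Q G by fact
  let ?c = "pushout_class A F G" and ?X = "pushout_presentation A P Q F G"
  have glue: "?c (Inl (on_ob F a)) = ?c (Inr (on_ob G a))" if "a \<in> ob A" for a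
    using pushout_universal(3)[OF F G] that
    by (simp add: functor_eq_on_def pushout_inl_def pushout_inr_def)
  interpret X: operad_presentation ?X
  proof
    show "set (gsrc ?X g) \<subseteq> pob ?X" "gtgt ?X g \<in> pob ?X" if "g \<in> pgen ?X" for g
      using that F.target.src_ob F.target.tgt_ob G.target.src_ob G.target.tgt_ob
      by (fastforce simp: pushout_presentation_def)+
    fix s t assume "(s, t) \<in> prel ?X"
    then consider
        (left) "(s, t) \<in> functor_relations P (\<lambda>p. ?c (Inl p)) Inl"
      | (right) "(s, t) \<in> functor_relations Q (\<lambda>q. ?c (Inr q)) Inr"
      | (glued) f where "f \<in> mor A" "s = Gen (Inl (on_mor F f))" "t = Gen (Inr (on_mor G f))"
      unfolding pushout_presentation_def by auto
    then show "wf_term ?X s \<and> wf_term ?X t \<and> tsrc ?X s = tsrc ?X t \<and> ttgt ?X s = ttgt ?X t"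
    proof cases
      case left
      show ?thesis
        by (rule functor_relations_wf[OF F.target.symmetric_operad_axioms _ _ left])
          (auto simp: pushout_presentation_def)
    next
      case right
      show ?thesis
        by (rule functor_relations_wf[OF G.target.symmetric_operad_axioms _ _ right])
          (auto simp: pushout_presentation_def)
    next
      case glued
      then show ?thesis
        using F.map_mor[of f] G.map_mor[of f] F.source.src_ob[of f] F.source.tgt_ob[of f] glue
        by (auto simp: pushout_presentation_def)
    qed
  qed
  have "X.cls ` Gen ` pgen ?X
      = on_mor (pushout_inl A P Q F G) ` mor P \<union> on_mor (pushout_inr A P Q F G) ` mor Q"
    by (auto simp: pushout_presentation_def[of A P Q F G, THEN arg_cong[where f = pgen]]
        pushout_inl_def pushout_inr_def)
  then show ?thesis using X.presented_generated by (simp add: pushout_def)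
qed

theorem theorem2p2:
  fixes P :: "('p, 'pm) operad" and Q :: "('q, 'qm) operad"
    and P' :: "('p', 'pm') operad" and Q' :: "('q', 'qm') operad"
    and F :: "('p, 'pm, 'q, 'qm) ofunctor" and G :: "('p', 'pm', 'q', 'qm') ofunctor"
  assumes "cofibration P Q F" and "cofibration P' Q' G"
  shows "cofibration (pushout_product_domain P Q F P' Q' G) (Q \<otimes>\<^sub>B\<^sub>V Q')
      (pushout_product Q F Q' G) \<and>
    (trivial_cofibration P Q F \<or> trivial_cofibration P' Q' G \<longrightarrow>
      trivial_cofibration (pushout_product_domain P Q F P' Q' G) (Q \<otimes>\<^sub>B\<^sub>V Q')
        (pushout_product Q F Q' G))"
proof -
  have F: "operad_functor P Q F" and G: "operad_functor P' Q' G"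
    and injF: "inj_on (on_ob F) (ob P)" and injG: "inj_on (on_ob G) (ob P')"
    using assms by (auto simp: cofibration_def)
  interpret F: operad_functor P Q F by fact
  interpret G: operad_functor P' Q' G by fact
  note idP = operad_functor_id[OF F.source.symmetric_operad_axioms]
    and idQ = operad_functor_id[OF F.target.symmetric_operad_axioms]
    and idP' = operad_functor_id[OF G.source.symmetric_operad_axioms]
    and idQ' = operad_functor_id[OF G.target.symmetric_operad_axioms]
  let ?A = "P \<otimes>\<^sub>B\<^sub>V P'" and ?X = "Q \<otimes>\<^sub>B\<^sub>V P'" and ?Y = "P \<otimes>\<^sub>B\<^sub>V Q'" and ?D = "Q \<otimes>\<^sub>B\<^sub>V Q'"
  let ?FP' = "bv_tensor_functor F id_functor Q P'" and ?PG = "bv_tensor_functor id_functor G P Q'"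
  let ?QG = "bv_tensor_functor id_functor G Q Q'" and ?FQ' = "bv_tensor_functor F id_functor Q Q'"
  define W where "W = pushout ?A ?X ?Y ?FP' ?PG"
  define I where "I = pushout_inl ?A ?X ?Y ?FP' ?PG"
  define J where "J = pushout_inr ?A ?X ?Y ?FP' ?PG"
  define \<Phi> where "\<Phi> = pushout_induced ?D ?QG ?FQ'"
  have dom: "pushout_product_domain P Q F P' Q' G = W" and prod: "pushout_product Q F Q' G = \<Phi>"
    by (simp_all add: W_def \<Phi>_def pushout_product_domain_def pushout_product_def)
  have FP': "operad_functor ?A ?X ?FP'" and PG: "operad_functor ?A ?Y ?PG"
    and QG: "operad_functor ?X ?D ?QG" and FQ': "operad_functor ?Y ?D ?FQ'"
    by (rule bv_tensor_functor[OF F idP'] bv_tensor_functor[OF idP G]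
        bv_tensor_functor[OF idQ G] bv_tensor_functor[OF F idQ'])+
  have "functor_eq_on ?A (comp_functor ?QG ?FP') (comp_functor ?FQ' ?PG)"
    using functor_eq_on_trans[OF bv_tensor_functor_comp[OF F idQ idP' G, simplified]
        functor_eq_on_sym[OF bv_tensor_functor_comp[OF idP F G idQ', simplified]]] .
  from pushout_universal(4)[OF FP' PG QG FQ' this]
  have \<Phi>: "operad_functor W ?D \<Phi>" and \<Phi>I: "functor_eq_on ?X (comp_functor \<Phi> I) ?QG"
    and \<Phi>J: "functor_eq_on ?Y (comp_functor \<Phi> J) ?FQ'"
    by (auto simp: W_def I_def J_def \<Phi>_def)
  have I: "operad_functor ?X W I" and J: "operad_functor ?Y W J"
    and IJ: "functor_eq_on ?A (comp_functor I ?FP') (comp_functor J ?PG)"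
    unfolding W_def I_def J_def by (rule pushout_universal[OF FP' PG])+
  have ob: "ob W = on_ob I ` ob ?X \<union> on_ob J ` ob ?Y"
    unfolding W_def I_def J_def by (rule pushout_ob)
  have gen: "mor W \<subseteq> generated W (on_mor I ` mor ?X \<union> on_mor J ` mor ?Y)"
    unfolding W_def I_def J_def by (rule pushout_generated[OF FP' PG])
  have I_ob: "on_ob \<Phi> (on_ob I (q, p')) = (q, on_ob G p')" if "q \<in> ob Q" "p' \<in> ob P'" for q p'
    using \<Phi>I that by (simp add: functor_eq_on_def)
  have J_ob: "on_ob \<Phi> (on_ob J (p, q')) = (on_ob F p, q')" if "p \<in> ob P" "q' \<in> ob Q'" for p q'
    using \<Phi>J that by (simp add: functor_eq_on_def)
  have glue: "on_ob I (on_ob F p, p') = on_ob J (p, on_ob G p')" if "p \<in> ob P" "p' \<in> ob P'" for p p'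
    using IJ that by (simp add: functor_eq_on_def)
  have II: "x = x'" if "x \<in> ob ?X" "x' \<in> ob ?X" "on_ob \<Phi> (on_ob I x) = on_ob \<Phi> (on_ob I x')" for x x'
    using that I_ob injG by (auto dest: inj_onD)
  have JJ: "y = y'" if "y \<in> ob ?Y" "y' \<in> ob ?Y" "on_ob \<Phi> (on_ob J y) = on_ob \<Phi> (on_ob J y')" for y y'
    using that J_ob injF by (auto dest: inj_onD)
  have injI: "inj_on (on_ob I) (ob ?X)"
    by (rule inj_onI, rule II) simp_all
  have injJ: "inj_on (on_ob J) (ob ?Y)"
    by (rule inj_onI, rule JJ) simp_all
  \<comment> \<open>In \<open>Q \<times> Q'\<close>, the subsets \<open>Q \<times> P'\<close> and \<open>P \<times> Q'\<close> meet in \<open>P \<times> P'\<close>.\<close>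
  have meet: "\<exists>p\<in>ob P. \<exists>p'\<in>ob P'. x = (on_ob F p, p') \<and> y = (p, on_ob G p')"
    if "x \<in> ob ?X" "y \<in> ob ?Y" "on_ob \<Phi> (on_ob I x) = on_ob \<Phi> (on_ob J y)" for x y
    using that I_ob J_ob by auto
  have "inj_on (on_ob \<Phi>) (ob W)"
  proof (rule inj_onI)
    fix w w' assume w: "w \<in> ob W" "w' \<in> ob W" "on_ob \<Phi> w = on_ob \<Phi> w'"
    have IJ: "on_ob I x = on_ob J y"
      if "x \<in> ob ?X" "y \<in> ob ?Y" "on_ob \<Phi> (on_ob I x) = on_ob \<Phi> (on_ob J y)" for x y
      using meet[OF that] glue by auto
    from w(1,2) consider x x' where "x \<in> ob ?X" "x' \<in> ob ?X" "w = on_ob I x" "w' = on_ob I x'"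
      | x y where "x \<in> ob ?X" "y \<in> ob ?Y" "w = on_ob I x" "w' = on_ob J y"
      | x y where "x \<in> ob ?X" "y \<in> ob ?Y" "w = on_ob J y" "w' = on_ob I x"
      | y y' where "y \<in> ob ?Y" "y' \<in> ob ?Y" "w = on_ob J y" "w' = on_ob J y'"
      unfolding ob by blast
    then show "w = w'" using II JJ IJ w(3) by cases metis+
  qed
  then have cof: "cofibration W ?D \<Phi>" using \<Phi> by (simp add: cofibration_def)
  have "operadic_equivalence W ?D \<Phi>" if "trivial_cofibration P Q F"
  proof -
    obtain R \<eta> where ret: "deformation_retract P Q F R \<eta>"
      using trivial_cofibration_deformation_retract[OF \<open>trivial_cofibration P Q F\<close>] .
    then have R: "operad_functor Q P R" by (simp add: deformation_retract_def)
    let ?RP' = "bv_tensor_functor R id_functor P P'" and ?RQ' = "bv_tensor_functor R id_functor P Q'"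
    \<comment> \<open>\<open>(R \<otimes> Q') (Q \<otimes> G) = R \<otimes> G = (P \<otimes> G) (R \<otimes> P')\<close>\<close>
    have "functor_eq_on ?X (comp_functor ?RQ' (comp_functor \<Phi> I)) (comp_functor ?RQ' ?QG)"
      using \<Phi>I by (simp add: functor_eq_on_def)
    moreover have "functor_eq_on ?X (comp_functor ?RQ' ?QG) (comp_functor ?PG ?RP')"
      using functor_eq_on_trans[OF bv_tensor_functor_comp[OF idQ R G idQ', simplified]
          functor_eq_on_sym[OF bv_tensor_functor_comp[OF R idP idP' G, simplified]]] .
    ultimately have retr: "functor_eq_on ?X (comp_functor ?RQ' (comp_functor \<Phi> I)) (comp_functor ?PG ?RP')"
      by (rule functor_eq_on_trans)
    show ?thesis
    proof (rule equivalence_of_pushout[OF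
          deformation_retract_tensor_right[OF ret G.source.symmetric_operad_axioms] PG I J IJ
          _ gen injI _ \<Phi> deformation_retract_tensor_right[OF ret G.target.symmetric_operad_axioms] \<Phi>J retr])
      show "ob W \<subseteq> on_ob I ` ob ?X \<union> on_ob J ` ob ?Y" by (simp add: ob)
      show "x \<in> on_ob ?FP' ` ob ?A" if "x \<in> ob ?X" "y \<in> ob ?Y" "on_ob I x = on_ob J y" for x y
        using meet[OF that(1,2)] that(3) by force
    qed
  qed
  moreover have "operadic_equivalence W ?D \<Phi>" if "trivial_cofibration P' Q' G"
  proof -
    obtain R \<eta> where ret: "deformation_retract P' Q' G R \<eta>"
      using trivial_cofibration_deformation_retract[OF \<open>trivial_cofibration P' Q' G\<close>] .
    then have R: "operad_functor Q' P' R" by (simp add: deformation_retract_def)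
    let ?PR = "bv_tensor_functor id_functor R P P'" and ?QR = "bv_tensor_functor id_functor R Q P'"
    \<comment> \<open>\<open>(Q \<otimes> R) (F \<otimes> Q') = F \<otimes> R = (F \<otimes> P') (P \<otimes> R)\<close>\<close>
    have "functor_eq_on ?Y (comp_functor ?QR (comp_functor \<Phi> J)) (comp_functor ?QR ?FQ')"
      using \<Phi>J by (simp add: functor_eq_on_def)
    moreover have "functor_eq_on ?Y (comp_functor ?QR ?FQ') (comp_functor ?FP' ?PR)"
      using functor_eq_on_trans[OF bv_tensor_functor_comp[OF F idQ idQ' R, simplified]
          functor_eq_on_sym[OF bv_tensor_functor_comp[OF idP F R idP', simplified]]] .
    ultimately have retr: "functor_eq_on ?Y (comp_functor ?QR (comp_functor \<Phi> J)) (comp_functor ?FP' ?PR)"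
      by (rule functor_eq_on_trans)
    show ?thesis
    proof (rule equivalence_of_pushout[OF
          deformation_retract_tensor_left[OF ret F.source.symmetric_operad_axioms] FP' J I
          functor_eq_on_sym[OF IJ] _ _ injJ _ \<Phi>
          deformation_retract_tensor_left[OF ret F.target.symmetric_operad_axioms] \<Phi>I retr])
      show "ob W \<subseteq> on_ob J ` ob ?Y \<union> on_ob I ` ob ?X" by (auto simp: ob)
      show "mor W \<subseteq> generated W (on_mor J ` mor ?Y \<union> on_mor I ` mor ?X)"
        using gen by (simp add: Un_commute)
      show "y \<in> on_ob ?PG ` ob ?A" if "y \<in> ob ?Y" "x \<in> ob ?X" "on_ob J y = on_ob I x" for x y
        using meet[OF that(2,1)] that(3) by force
    qed
  qed
  ultimately show ?thesis
    using cof unfolding dom prod by (auto simp: trivial_cofibration_def)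
qed

end
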